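(* Let $G$ be a compact Hausdorff group and $X$ a complete operator space. Let $\nu\in\mathcal{M}(G,X)$ be a semivariation translation invariant vector measure with $\nu(G)\neq0$ and let $1\leq p<\infty$. (i) If $f\in L^1(\nu)$ and $g\in L^p(G)$, then $f*g\in L^p(\nu)$. Further, $\|f*g\|_{\nu,p}\leq\|f\|_\nu\|g\|_p\|\nu(G)\|^{-1/p'}$. (ii) If $f\in L^p(\nu)$ and $g\in L^1(G)$, then $f*g\in L^p(\nu)$. Further, $\|f*g\|_{\nu,p}\leq\|f\|_{\nu,p}\|g\|_1$.
   Context: $m_G$ is normalized Haar measure; $p'$ is the conjugate exponent of $p$ (with $1/p'=0$ for $p=1$). $X'$ is the dual of $X$ with closed unit ball $B_{X'}$; $\langle\nu,x'\rangle(A)=\langle\nu(A),x'\rangle$ with total variation $|\langle\nu,x'\rangle|$; the semivariation is $\|\nu\|(A)=\sup_{x'\in B_{X'}}|\langle\nu,x'\rangle|(A)$, and $\|\nu\|=\|\nu\|(G)$. $\mathcal{M}(G,X)$: $\sigma$-additive $X$-valued Borel vector measures on $G$ that are regular, i.e. for each $\epsilon>0$ and Borel $A$ there are open $U$ and closed $F$ with $F\subset A\subset U$, $\|\nu\|(U\setminus F)<\epsilon$. $L^1(\nu)$: functions $f:G\to\mathbb{C}$ with $f\in L^1(|\langle\nu,x'\rangle|)$ for all $x'$ and such that for each Borel $A$ there is a unique $\int_Af\,d\nu\in X$ with $\langle\int_Af\,d\nu,x'\rangle=\int_Af\,d\langle\nu,x'\rangle$ for all $x'$; norm $\|f\|_\nu=\sup_{x'\in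 B_{X'}}\int_G|f|\,d|\langle\nu,x'\rangle|$. $f\in L^p(\nu)$ iff $|f|^p\in L^1(\nu)$, with $\|f\|_{\nu,p}=\||f|^p\|_\nu^{1/p}$. For $t\in G$ let $\tau_t(s)=st$, $\nu_{\tau_t}(A)=\nu(\tau_t(A))$; for simple $\phi$, $\nu_\phi(A)=\int_A\phi\,d\nu$. $\nu$ is semivariation translation invariant if $\|(\nu_{\tau_t})_\phi\|=\|\nu_\phi\|$ for all $t\in G$ and all complex simple functions $\phi$. For such $\nu$ with $\nu(G)\neq0$ one has $L^p(\nu)\subset L^p(G)$, so $f*g(t)=\int_Gf(ts^{-1})g(s)\,dm_G(s)$ is the usual convolution. *)

theory Defs
  imports "HOL-Analysis.Analysis"
begin

section \<open>Complex normed spaces and operator spaces\<close>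

class complex_normed_vector = real_normed_vector +
  fixes scaleC :: "complex \<Rightarrow> 'a \<Rightarrow> 'a"  (infixr "*\<^sub>C" 75)
  assumes scaleC_add_right: "c *\<^sub>C (x + y) = c *\<^sub>C x + c *\<^sub>C y"
    and scaleC_add_left: "(c + d) *\<^sub>C x = c *\<^sub>C x + d *\<^sub>C x"
    and scaleC_scaleC: "c *\<^sub>C (d *\<^sub>C x) = (c * d) *\<^sub>C x"
    and scaleC_of_real: "complex_of_real r *\<^sub>C x = r *\<^sub>R x"
    and norm_scaleC: "norm (c *\<^sub>C x) = cmod c * norm x"

text \<open>
  An \<open>m \<times> n\<close> matrix is a function \<open>nat \<Rightarrow> nat \<Rightarrow> _\<close> of which only the entries with row index
  \<open>< m\<close> and column index \<open>< n\<close> matter. The norm of a scalar matrix is its operator norm between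
  Euclidean spaces.
\<close>

definition matrix_opnorm :: "nat \<Rightarrow> nat \<Rightarrow> (nat \<Rightarrow> nat \<Rightarrow> complex) \<Rightarrow> real" where
  "matrix_opnorm m n a =
     (SUP v \<in> {v :: nat \<Rightarrow> complex. (\<Sum>j<n. (cmod (v j))\<^sup>2) \<le> 1}.
        sqrt (\<Sum>i<m. (cmod (\<Sum>j<n. a i j * v j))\<^sup>2))"

definition (in zero) matrix_dsum :: "nat \<Rightarrow> nat \<Rightarrow> (nat \<Rightarrow> nat \<Rightarrow> 'a) \<Rightarrow> (nat \<Rightarrow> nat \<Rightarrow> 'a) \<Rightarrow> nat \<Rightarrow> nat \<Rightarrow> 'a" where
  "matrix_dsum m n x y = (\<lambda>i j.
     if i < m \<and> j < m then x i j
     else if m \<le> i \<and> i < m + n \<and> m \<le> j \<and> j < m + n then y (i - m) (j - m)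
     else 0)"

text \<open>
  Abstract operator spaces in the sense of Ruan: \<open>matnorm n\<close> is a norm on the \<open>n \<times> n\<close> matrices
  over \<open>'a\<close>, extending the given norm for \<open>n = 1\<close>, such that the direct sum of two matrices has
  the maximum of their norms and \<open>\<parallel>\<alpha> x \<beta>\<parallel> \<le> \<parallel>\<alpha>\<parallel> \<parallel>x\<parallel> \<parallel>\<beta>\<parallel>\<close> for rectangular scalar matrices.
  Completeness is not included; it is the additional sort \<open>banach\<close>.
\<close>

class operator_space = complex_normed_vector +
  fixes matnorm :: "nat \<Rightarrow> (nat \<Rightarrow> nat \<Rightarrow> 'a) \<Rightarrow> real"
  assumes matnorm_cong:
      "(\<And>i j. i < n \<Longrightarrow> j < n \<Longrightarrow> x i j = y i j) \<Longrightarrow> matnorm n x = matnorm n y"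
    and matnorm_eq_0_iff: "matnorm n x = 0 \<longleftrightarrow> (\<forall>i<n. \<forall>j<n. x i j = 0)"
    and matnorm_triangle: "matnorm n (\<lambda>i j. x i j + y i j) \<le> matnorm n x + matnorm n y"
    and matnorm_scaleC: "matnorm n (\<lambda>i j. c *\<^sub>C x i j) = cmod c * matnorm n x"
    and matnorm_1: "matnorm 1 x = norm (x 0 0)"
    and matnorm_dsum: "matnorm (m + n) (matrix_dsum m n x y) = max (matnorm m x) (matnorm n y)"
    and matnorm_mult:
      "matnorm m (\<lambda>i j. \<Sum>k<n. \<Sum>l<n. (a i k * b l j) *\<^sub>C x k l)
         \<le> matrix_opnorm m n a * matnorm n x * matrix_opnorm n m b"

definition topdual :: "('x::complex_normed_vector \<Rightarrow> complex) set" where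
  "topdual = {x'. bounded_linear x' \<and> (\<forall>c x. x' (c *\<^sub>C x) = c * x' x)}"

definition dual_ball :: "('x::complex_normed_vector \<Rightarrow> complex) set" where
  "dual_ball = {x' \<in> topdual. onorm x' \<le> 1}"


section \<open>Complex measures\<close>

text \<open>
  Complex and vector measures are set functions, of which only the values on Borel sets matter.
\<close>

definition variation :: "('g::topological_space set \<Rightarrow> complex) \<Rightarrow> 'g set \<Rightarrow> ennreal" where
  "variation \<mu> A =
     (SUP P \<in> {P. finite P \<and> P \<subseteq> sets borel \<and> partition_on A P}. \<Sum>E\<in>P. ennreal (cmod (\<mu> E)))"

definition variation_measure :: "('g::topological_space set \<Rightarrow> complex) \<Rightarrow> 'g measure" where
  "variation_measure \<mu> = measure_of UNIV (sets borel) (variation \<mu>)"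

text \<open>
  The positive part of the Jordan decomposition of a finite signed measure \<open>\<rho>\<close>; the negative part
  is the positive part of \<open>-\<rho>\<close>.
\<close>

definition positive_part :: "('g::topological_space set \<Rightarrow> real) \<Rightarrow> 'g measure" where
  "positive_part \<rho> =
     measure_of UNIV (sets borel) (\<lambda>A. SUP B \<in> {B \<in> sets borel. B \<subseteq> A}. ennreal (\<rho> B))"

definition signed_integral :: "('g::topological_space set \<Rightarrow> real) \<Rightarrow> 'g set \<Rightarrow> ('g \<Rightarrow> complex) \<Rightarrow> complex" where
  "signed_integral \<rho> A f =
     (LINT s:A|positive_part \<rho>. f s) - (LINT s:A|positive_part (\<lambda>B. - \<rho> B). f s)"

definition complex_integral :: "('g::topological_space set \<Rightarrow> complex) \<Rightarrow> 'g set \<Rightarrow> ('g \<Rightarrow> complex) \<Rightarrow> complex" where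
  "complex_integral \<mu> A f =
     signed_integral (\<lambda>B. Re (\<mu> B)) A f + \<i> * signed_integral (\<lambda>B. Im (\<mu> B)) A f"


section \<open>Vector measures\<close>

definition semivariation :: "('g::topological_space set \<Rightarrow> 'x::complex_normed_vector) \<Rightarrow> 'g set \<Rightarrow> ennreal" where
  "semivariation \<nu> A = (SUP x' \<in> dual_ball. variation (\<lambda>B. x' (\<nu> B)) A)"

definition vector_measure :: "('g::topological_space set \<Rightarrow> 'x::complex_normed_vector) \<Rightarrow> bool" where
  "vector_measure \<nu> \<longleftrightarrow>
     (\<forall>A :: nat \<Rightarrow> 'g set. range A \<subseteq> sets borel \<longrightarrow> disjoint_family A \<longrightarrow>
        (\<lambda>n. \<nu> (A n)) sums \<nu> (\<Union>n. A n))"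

definition regular_vector_measures :: "('g::topological_space set \<Rightarrow> 'x::complex_normed_vector) set" where
  "regular_vector_measures =
     {\<nu>. vector_measure \<nu> \<and>
         (\<forall>e>0. \<forall>A\<in>sets borel. \<exists>U F. open U \<and> closed F \<and> F \<subseteq> A \<and> A \<subseteq> U \<and>
            semivariation \<nu> (U - F) < ennreal e)}"

definition is_integral ::
  "('g::topological_space set \<Rightarrow> 'x::complex_normed_vector) \<Rightarrow> ('g \<Rightarrow> complex) \<Rightarrow> 'g set \<Rightarrow> 'x \<Rightarrow> bool" where
  "is_integral \<nu> f A x \<longleftrightarrow> (\<forall>x'\<in>topdual. x' x = complex_integral (\<lambda>B. x' (\<nu> B)) A f)"

definition vector_integral ::
  "('g::topological_space set \<Rightarrow> 'x::complex_normed_vector) \<Rightarrow> ('g \<Rightarrow> complex) \<Rightarrow> 'g set \<Rightarrow> 'x" where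
  "vector_integral \<nu> f A = (THE x. is_integral \<nu> f A x)"

text \<open>\<open>L\<^sup>1(\<nu>)\<close> and \<open>L\<^sup>p(\<nu>)\<close> consist of functions, not of classes modulo null sets.\<close>

definition L1v :: "('g::topological_space set \<Rightarrow> 'x::complex_normed_vector) \<Rightarrow> ('g \<Rightarrow> complex) set" where
  "L1v \<nu> = {f. (\<forall>x'\<in>topdual. integrable (variation_measure (\<lambda>B. x' (\<nu> B))) f) \<and>
                (\<forall>A\<in>sets borel. \<exists>!x. is_integral \<nu> f A x)}"

text \<open>The supremum below is finite for \<open>f \<in> L1v \<nu>\<close>.\<close>

definition L1v_norm :: "('g::topological_space set \<Rightarrow> 'x::complex_normed_vector) \<Rightarrow> ('g \<Rightarrow> complex) \<Rightarrow> real" where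
  "L1v_norm \<nu> f =
     enn2real (SUP x' \<in> dual_ball. \<integral>\<^sup>+ s. ennreal (cmod (f s)) \<partial>variation_measure (\<lambda>B. x' (\<nu> B)))"

text \<open>Measurability of \<open>f\<close> has to be required, as it does not follow from that of \<open>|f|\<^sup>p\<close>.\<close>

definition Lpv ::
  "('g::topological_space set \<Rightarrow> 'x::complex_normed_vector) \<Rightarrow> real \<Rightarrow> ('g \<Rightarrow> complex) set" where
  "Lpv \<nu> p = {f \<in> borel_measurable borel. (\<lambda>s. complex_of_real (cmod (f s) powr p)) \<in> L1v \<nu>}"

definition Lpv_norm ::
  "('g::topological_space set \<Rightarrow> 'x::complex_normed_vector) \<Rightarrow> real \<Rightarrow> ('g \<Rightarrow> complex) \<Rightarrow> real" where
  "Lpv_norm \<nu> p f = L1v_norm \<nu> (\<lambda>s. complex_of_real (cmod (f s) powr p)) powr (1 / p)"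


section \<open>Haar measure, translations and convolution\<close>

text \<open>
  Groups are written additively, as in the class \<open>topological_group_add\<close>, which does not assume
  commutativity: \<open>s t\<close> becomes \<open>s + t\<close> and \<open>t s\<^sup>-\<^sup>1\<close> becomes \<open>t - s\<close>.
\<close>

text \<open>The Haar measure is characterised as the regular left invariant Borel probability measure.\<close>

definition normalized_haar_measure :: "'g::topological_group_add measure \<Rightarrow> bool" where
  "normalized_haar_measure M \<longleftrightarrow>
     sets M = sets borel \<and> emeasure M UNIV = 1 \<and>
     (\<forall>t. \<forall>A\<in>sets borel. emeasure M ((\<lambda>s. t + s) ` A) = emeasure M A) \<and>
     (\<forall>e>0. \<forall>A\<in>sets borel. \<exists>U F. open U \<and> closed F \<and> F \<subseteq> A \<and> A \<subseteq> U \<and>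
        emeasure M (U - F) < ennreal e)"

definition Lp :: "'g measure \<Rightarrow> real \<Rightarrow> ('g \<Rightarrow> complex) set" where
  "Lp M p = {f \<in> borel_measurable M. integrable M (\<lambda>s. cmod (f s) powr p)}"

definition Lp_norm :: "'g measure \<Rightarrow> real \<Rightarrow> ('g \<Rightarrow> complex) \<Rightarrow> real" where
  "Lp_norm M p f = (\<integral>s. cmod (f s) powr p \<partial>M) powr (1 / p)"

definition convolution ::
  "'g::group_add measure \<Rightarrow> ('g \<Rightarrow> complex) \<Rightarrow> ('g \<Rightarrow> complex) \<Rightarrow> 'g \<Rightarrow> complex" where
  "convolution M f g t = (\<integral>s. f (t - s) * g s \<partial>M)"

definition translate :: "'g::group_add \<Rightarrow> ('g set \<Rightarrow> 'x) \<Rightarrow> 'g set \<Rightarrow> 'x" where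
  "translate t \<nu> A = \<nu> ((\<lambda>s. s + t) ` A)"

definition semivariation_translation_invariant ::
  "('g::topological_group_add set \<Rightarrow> 'x::complex_normed_vector) \<Rightarrow> bool" where
  "semivariation_translation_invariant \<nu> \<longleftrightarrow>
     (\<forall>t \<phi>. simple_function borel \<phi> \<longrightarrow>
        semivariation (vector_integral (translate t \<nu>) \<phi>) UNIV =
        semivariation (vector_integral \<nu> \<phi>) UNIV)"

text \<open>Since \<open>x / 0 = 0\<close>, this gives \<open>1 / conjugate_exponent 1 = 0\<close>, as it should be for \<open>p = 1\<close>.\<close>

definition conjugate_exponent :: "real \<Rightarrow> real" where
  "conjugate_exponent p = p / (p - 1)"

end

(*
  For a Borel function F >= 0 put N(F) = sup of the integrals of F against |<nu,x'>| over the dual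
  ball. The invariance hypothesis, which concerns simple functions, extends by monotone convergence
  to N(F(. - t)) <= N(F). With a Tonelli theorem this gives N(F * G) <= N(F) |G|_1 and, averaging
  over all translates, |nu(G)| |F|_1 <= N(F). By Jensen,
    |f * g|^p <= |f|_1^(p-1) (|f| * |g|^p)   and   |f * g|^p <= |g|_1^(p-1) (|f|^p * |g|),
  whence the norm estimates. For membership in L^1(nu), truncate the second factor of the dominating
  convolution: the truncated convolution is bounded as its first factor lies in L^1(G), the error is
  N-small, and N-limits of simple functions are integrable. This uses N(f) < oo for f in L^1(nu),
  a consequence of the Baire category theorem.
*)

theory Submission
  imports Defs
begin

text \<open>\<open>G\<close> need not be second countable, so a Borel function of
  \<open>t - s\<close> need not be measurable for the product \<sigma>-algebra, and the usual
  Tonelli theorem does not apply. Regularity of Haar measure and of the measures |<\<nu>,x'>| takes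
  the place of countability. The second factor \<open>w\<close> of a convolution is moved into the
  measure \<open>density m w\<close>; what remains is a Borel function of a jointly continuous
  expression in \<open>t\<close> and \<open>s\<close>, the kind of integrand that the Tonelli
  theorem proved here covers.

  The functionals \<open>x'\<close> form a set and not a normed type. For the Baire argument they
  are parametrised by real bounded functionals, which form a Banach space; the same complexification
  turns a real Hahn-Banach theorem into norming functionals. These make weak integrals unique, turn
  uniform weak estimates into Cauchy sequences, and supply the factor |\<nu>(G)|.

  The power of |\<nu>(G)| in (i) arises from |f|_1 <= N(f) / |\<nu>(G)|: inserted in |f|_1^((p-1)/p)
  N(f)^(1/p), this leaves N(f) |\<nu>(G)|^(-(p-1)/p).\<close>

section \<open>Norming functionals\<close>

definition sublinear :: "('a::real_vector \<Rightarrow> real) \<Rightarrow> bool" where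
  "sublinear q \<longleftrightarrow> (\<forall>x y. q (x + y) \<le> q x + q y) \<and> (\<forall>c\<ge>0. \<forall>x. q (c *\<^sub>R x) = c * q x)"

lemma sublinear_add: "sublinear q \<Longrightarrow> q (x + y) \<le> q x + q y"
  and sublinear_scaleR: "sublinear q \<Longrightarrow> 0 \<le> c \<Longrightarrow> q (c *\<^sub>R x) = c * q x"
  by (auto simp: sublinear_def)

lemma sublinear_0: "sublinear q \<Longrightarrow> q 0 = 0"
  using sublinear_scaleR[of q 0 0] by simp

lemma sublinear_minus: "sublinear q \<Longrightarrow> - q (- x) \<le> q x"
  using sublinear_add[of q x "- x"] sublinear_0[of q] by simp

text \<open>Applying the inequality with \<open>1 / c\<close> to \<open>c *\<^sub>R x\<close> yields
  its converse.\<close>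

lemma sublinearI:
  assumes add: "\<And>x y. q (x + y) \<le> q x + q y" and zero: "q 0 = 0"
    and le: "\<And>c x. 0 < c \<Longrightarrow> q (c *\<^sub>R x) \<le> c * q x"
  shows "sublinear q"
proof -
  have "q (c *\<^sub>R x) = c * q x" if c: "0 < c" for c x
  proof -
    have "c * q x \<le> q (c *\<^sub>R x)" using le[of "1 / c" "c *\<^sub>R x"] c by (simp add: field_simps)
    then show ?thesis using le[OF c, of x] by simp
  qed
  then show ?thesis using add zero by (auto simp: sublinear_def le_less)
qed

text \<open>
  The modified functional \<open>q'\<close> is different from \<open>q\<close> unless \<open>q\<close> is additive
  along \<open>y\<close>; this makes minimal sublinear functionals linear.
\<close>

lemma sublinear_shrink:
  assumes q: "sublinear q"
  obtains q' where "sublinear q'" "q' \<le> q" "\<And>x. q' x \<le> q (x + y) - q y"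
proof -
  define S where "S x = {q (x + t *\<^sub>R y) - t * q y | t. 0 \<le> t}" for x
  define q' where "q' x = Inf (S x)" for x
  have ne: "S x \<noteq> {}" for x unfolding S_def by auto
  have lower: "- q (- x) \<le> r" if r: "r \<in> S x" for x r
  proof -
    obtain t where t: "0 \<le> t" "r = q (x + t *\<^sub>R y) - t * q y" using r by (auto simp: S_def)
    have "q ((x + t *\<^sub>R y) + - x) \<le> q (x + t *\<^sub>R y) + q (- x)" by (rule sublinear_add[OF q])
    moreover have "q ((x + t *\<^sub>R y) + - x) = t * q y" using sublinear_scaleR[OF q t(1), of y] by
      simp
    ultimately show ?thesis using t by simp
  qed
  have bdd: "bdd_below (S x)" for x using lower[of _ x] by (auto simp: bdd_below_def)
  have le: "q' x \<le> q (x + t *\<^sub>R y) - t * q y" if "0 \<le> t" for x t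
    unfolding q'_def using that by (intro cInf_lower bdd) (auto simp: S_def)
  have ge: "c \<le> q' x" if "\<And>t. 0 \<le> t \<Longrightarrow> c \<le> q (x + t *\<^sub>R y) - t * q y" for x c
    unfolding q'_def using that ne[of x] by (intro cInf_greatest) (auto simp: S_def)
  have sub: "q' (x + z) \<le> q' x + q' z" for x z
  proof -
    have "q' (x + z) - (q (x + t *\<^sub>R y) - t * q y) \<le> q' z" if t: "0 \<le> t" for t
    proof (rule ge)
      fix s :: real assume s: "0 \<le> s"
      have "q' (x + z) \<le> q ((x + z) + (t + s) *\<^sub>R y) - (t + s) * q y" using s t by (intro le) simp
      also have "(x + z) + (t + s) *\<^sub>R y = (x + t *\<^sub>R y) + (z + s *\<^sub>R y)"
        by (simp add: scaleR_add_left)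
      also have "q \<dots> \<le> q (x + t *\<^sub>R y) + q (z + s *\<^sub>R y)" by (rule sublinear_add[OF q])
      finally show "q' (x + z) - (q (x + t *\<^sub>R y) - t * q y) \<le> q (z + s *\<^sub>R y) - s * q y"
        by (simp add: algebra_simps)
    qed
    then have "q' (x + z) - q' z \<le> q' x" by (intro ge) (auto simp: algebra_simps)
    then show ?thesis by simp
  qed
  have hom_le: "q' (c *\<^sub>R x) \<le> c * q' x" if c: "0 < c" for c x
  proof -
    have "q' (c *\<^sub>R x) / c \<le> q' x"
    proof (rule ge)
      fix t :: real assume t: "0 \<le> t"
      have "q' (c *\<^sub>R x) \<le> q (c *\<^sub>R x + (c * t) *\<^sub>R y) - (c * t) * q y" using c t by (intro le) simp
      also have "c *\<^sub>R x + (c * t) *\<^sub>R y = c *\<^sub>R (x + t *\<^sub>R y)" by (simp add: scaleR_add_right)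
      also have "q \<dots> = c * q (x + t *\<^sub>R y)" using c by (intro sublinear_scaleR[OF q]) simp
      finally show "q' (c *\<^sub>R x) / c \<le> q (x + t *\<^sub>R y) - t * q y"
        using c by (simp add: field_simps)
    qed
    then show ?thesis using c by (simp add: field_simps)
  qed
  have zero: "q' 0 = 0"
  proof (rule antisym)
    show "q' 0 \<le> 0" using le[of 0 0] sublinear_0[OF q] by simp
    show "0 \<le> q' 0" by (rule ge) (simp add: sublinear_scaleR[OF q])
  qed
  show ?thesis
  proof (rule that[of q'])
    show "sublinear q'" by (rule sublinearI[OF sub zero hom_le])
    show "q' \<le> q" using le[of 0] by (auto simp: le_fun_def)
    show "q' x \<le> q (x + y) - q y" for x using le[of 1 x] by simp
  qed
qed

text \<open>Zorn's lemma for the reversed pointwise order. The pointwise infimum of a nonempty chain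
  is finite, since any sublinear \<open>q \<le> p\<close> satisfies
  \<open>q x \<ge> - q (- x) \<ge> - p (- x)\<close>.\<close>

lemma minimal_sublinear:
  assumes p: "sublinear p"
  obtains q where "sublinear q" "q \<le> p" "\<And>r. sublinear r \<Longrightarrow> r \<le> q \<Longrightarrow> r = q"
proof -
  define S where "S = {q. sublinear q \<and> q \<le> p}"
  have "\<exists>m\<in>S. \<forall>a\<in>S. a \<le> m \<longrightarrow> a = m"
  proof (rule predicate_Zorn)
    show "partial_order_on S (relation_of (\<lambda>a b. b \<le> a) S)"
      by (rule partial_order_on_relation_ofI) auto
    fix C assume C: "C \<in> Chains (relation_of (\<lambda>a b. b \<le> a) S)"
    have CS: "C \<subseteq> S" using C by (auto simp: Chains_def relation_of_def)
    have tot: "a \<le> b \<or> b \<le> a" if "a \<in> C" "b \<in> C" for a b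
      using C that by (auto simp: Chains_def relation_of_def)
    show "\<exists>u\<in>S. \<forall>a\<in>C. u \<le> a"
    proof (cases "C = {}")
      case True then show ?thesis using p by (auto simp: S_def)
    next
      case False
      define u where "u x = (INF q\<in>C. q x)" for x
      have lin: "sublinear q" "q \<le> p" if "q \<in> C" for q using CS that by (auto simp: S_def)
      have bdd: "bdd_below ((\<lambda>q. q x) ` C)" for x
      proof (rule bdd_belowI2)
        fix q assume q: "q \<in> C"
        have "- p (- x) \<le> - q (- x)" using lin(2)[OF q] by (auto simp: le_fun_def)
        also have "\<dots> \<le> q x" by (rule sublinear_minus[OF lin(1)[OF q]])
        finally show "- p (- x) \<le> q x" .
      qed
      have le: "u x \<le> q x" if "q \<in> C" for q x
        unfolding u_def using that by (intro cINF_lower bdd)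
      have ge: "c \<le> u x" if "\<And>q. q \<in> C \<Longrightarrow> c \<le> q x" for c x
        unfolding u_def using that False by (intro cINF_greatest)
      have sub: "u (x + y) \<le> u x + u y" for x y
      proof -
        have "u (x + y) - a x \<le> u y" if a: "a \<in> C" for a
        proof (rule ge)
          fix b assume b: "b \<in> C"
          \<comment> \<open>The chain supplies a member below both \<open>a\<close> and
            \<open>b\<close>, so that subadditivity is applied to a single functional.\<close>
          obtain c where c: "c \<in> C" "c \<le> a" "c \<le> b" using tot[OF a b] a b by auto
          have "u (x + y) \<le> c (x + y)" by (rule le[OF c(1)])
          also have "\<dots> \<le> c x + c y" by (rule sublinear_add[OF lin(1)[OF c(1)]])
          also have "\<dots> \<le> a x + b y" using c by (intro add_mono) (auto simp: le_fun_def)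
          finally show "u (x + y) - a x \<le> b y" by simp
        qed
        then have "u (x + y) - u y \<le> u x" by (intro ge) (simp add: algebra_simps)
        then show ?thesis by simp
      qed
      have hom_le: "u (c *\<^sub>R x) \<le> c * u x" if c: "0 < c" for c x
      proof -
        have "u (c *\<^sub>R x) / c \<le> u x"
        proof (rule ge)
          fix q assume q: "q \<in> C"
          have "u (c *\<^sub>R x) \<le> c * q x"
            using le[OF q, of "c *\<^sub>R x"] sublinear_scaleR[OF lin(1)[OF q], of c x] c by simp
          then show "u (c *\<^sub>R x) / c \<le> q x" using c by (simp add: field_simps)
        qed
        then show ?thesis using c by (simp add: field_simps)
      qed
      have u0: "u 0 = 0"
        unfolding u_def using False lin(1) by (simp add: sublinear_0 cong: INF_cong_simp)
      obtain q0 where q0: "q0 \<in> C" using False by blast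
      have "u \<le> q0" using le[OF q0] by (simp add: le_fun_def)
      then have "u \<le> p" using lin(2)[OF q0] by simp
      then have "u \<in> S" using sublinearI[OF sub u0 hom_le] by (simp add: S_def)
      then show ?thesis using le by (auto simp: le_fun_def)
    qed
  qed
  then obtain m where m: "m \<in> S" and min: "\<And>a. a \<in> S \<Longrightarrow> a \<le> m \<Longrightarrow> a = m" by blast
  show ?thesis
  proof (rule that[of m])
    show "sublinear m" "m \<le> p" using m by (auto simp: S_def)
    fix r assume "sublinear r" "r \<le> m"
    then show "r = m" using m by (intro min) (auto simp: S_def)
  qed
qed

text \<open>A minimal \<open>q\<close> is not changed by shrinking along \<open>y\<close>, so that
  \<open>q x \<le> q (x + y) - q y\<close>, the converse of subadditivity.\<close>

lemma linear_below_sublinear: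
  assumes p: "sublinear p"
  obtains u where "linear u" "u \<le> p"
proof -
  obtain q where q: "sublinear q" and qp: "q \<le> p"
    and min: "\<And>r. sublinear r \<Longrightarrow> r \<le> q \<Longrightarrow> r = q"
    using minimal_sublinear[OF p] by blast
  have "q x + q y \<le> q (x + y)" for x y
  proof -
    obtain q' where "sublinear q'" "q' \<le> q" and *: "\<And>x. q' x \<le> q (x + y) - q y"
      using sublinear_shrink[OF q, of y thesis] by blast
    then have "q' = q" by (intro min)
    then show ?thesis using *[of x] by simp
  qed
  then have add: "q (x + y) = q x + q y" for x y
    using sublinear_add[OF q, of x y] by (simp add: antisym)
  have neg: "q (- x) = - q x" for x
    using add[of x "- x"] sublinear_0[OF q] by simp
  have "q (c *\<^sub>R x) = c * q x" for c x
  proof (cases "0 \<le> c")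
    case False
    then have "q (- (c *\<^sub>R x)) = (- c) * q x"
      using sublinear_scaleR[OF q, of "- c" x] by simp
    then show ?thesis by (simp add: neg)
  qed (simp add: sublinear_scaleR[OF q])
  then have "linear q" by (intro linearI) (simp_all add: add)
  then show ?thesis using qp that by blast
qed

text \<open>Shrinking the norm along \<open>x0\<close> forces
  \<open>q (- x0) \<le> - norm x0\<close>; a linear functional below \<open>q\<close> then has at
  least the value \<open>norm x0\<close> at \<open>x0\<close>.\<close>

lemma real_norming_functional:
  fixes x0 :: "'a::real_normed_vector"
  obtains u where "linear u" "\<And>x. u x \<le> norm x" "u x0 = norm x0"
proof -
  have "sublinear (norm :: 'a \<Rightarrow> real)" by (auto simp: sublinear_def norm_triangle_ineq)
  then obtain q :: "'a \<Rightarrow> real" where q: "sublinear q" "q \<le> norm"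
    and *: "\<And>x. q x \<le> norm (x + x0) - norm x0"
    using sublinear_shrink[of norm x0 thesis] by blast
  obtain u where u: "linear u" "u \<le> q" using linear_below_sublinear[OF q(1)] by blast
  have le: "u x \<le> norm x" for x using u(2) q(2) by (auto simp: le_fun_def intro: order_trans)
  have "- u x0 = u (- x0)" by (simp add: linear_neg[OF u(1)])
  also have "\<dots> \<le> q (- x0)" using u(2) by (simp add: le_fun_def)
  also have "\<dots> \<le> - norm x0" using *[of "- x0"] by simp
  finally have "u x0 = norm x0" using le[of x0] by simp
  then show ?thesis using u(1) le that by blast
qed

section \<open>The complex dual, its unit ball and complexification\<close>

lemma topdual_linear: "x' \<in> topdual \<Longrightarrow> bounded_linear x'"
  and topdual_scaleC: "x' \<in> topdual \<Longrightarrow> x' (c *\<^sub>C x) = c * x' x"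
  by (auto simp: topdual_def)

lemma dual_ball_topdual: "x' \<in> dual_ball \<Longrightarrow> x' \<in> topdual"
  by (auto simp: dual_ball_def)

lemma dual_ball_bound:
  assumes "x' \<in> dual_ball"
  shows "cmod (x' x) \<le> norm x"
proof -
  have "cmod (x' x) \<le> onorm x' * norm x"
    using assms by (intro onorm topdual_linear dual_ball_topdual)
  also have "\<dots> \<le> 1 * norm x" using assms by (intro mult_right_mono) (auto simp: dual_ball_def)
  finally show ?thesis by simp
qed

lemma dual_ballI:
  assumes "x' \<in> topdual" "\<And>x. cmod (x' x) \<le> norm x"
  shows "x' \<in> dual_ball"
  using assms onorm_bound[of 1 x'] by (auto simp: dual_ball_def)

lemma zero_dual_ball: "(\<lambda>x. 0) \<in> dual_ball"
  by (intro dual_ballI) (auto simp: topdual_def)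

lemma topdual_scale: "x' \<in> topdual \<Longrightarrow> (\<lambda>x. c * x' x) \<in> topdual"
  by (auto simp: topdual_def bounded_linear_const_mult)

lemma topdual_normalize:
  assumes "x' \<in> topdual"
  obtains c y' where "0 < c" "y' \<in> dual_ball" "x' = (\<lambda>x. complex_of_real c * y' x)"
proof -
  \<comment> \<open>The maximum keeps \<open>c\<close> positive when \<open>x'\<close> is the zero
    functional.\<close>
  define c where "c = max 1 (onorm x')"
  have c: "0 < c" by (simp add: c_def)
  define y' where "y' x = complex_of_real (1 / c) * x' x" for x
  show ?thesis
  proof (rule that[OF c])
    show "y' \<in> dual_ball"
    proof (rule dual_ballI)
      show "y' \<in> topdual" unfolding y'_def by (intro topdual_scale assms)
      fix x
      have "cmod (x' x) \<le> onorm x' * norm x" by (intro onorm topdual_linear assms)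
      also have "\<dots> \<le> c * norm x" by (intro mult_right_mono) (auto simp: c_def)
      finally show "cmod (y' x) \<le> norm x"
        using c by (simp add: y'_def norm_divide field_simps norm_mult)
    qed
    show "x' = (\<lambda>x. complex_of_real c * y' x)" using c by (simp add: y'_def)
  qed
qed

text \<open>The complex-linear functional with real part \<open>u\<close>, namely u(x) - i
  u(ix).\<close>

definition complexify :: "('x::complex_normed_vector \<Rightarrow> real) \<Rightarrow> 'x \<Rightarrow> complex" where
  "complexify u x = Complex (u x) (- u (\<i> *\<^sub>C x))"

lemma scaleC_eq: "c *\<^sub>C (x::'x::complex_normed_vector) = Re c *\<^sub>R x + Im c *\<^sub>R (\<i> *\<^sub>C x)"
proof -
  have "c *\<^sub>C x = (complex_of_real (Re c) + complex_of_real (Im c) * \<i>) *\<^sub>C x"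
    by (metis complex_eq mult.commute)
  then show ?thesis by (simp only: scaleC_add_left scaleC_scaleC[symmetric] scaleC_of_real)
qed

lemma ii_scaleC_ii: "\<i> *\<^sub>C \<i> *\<^sub>C (x::'x::complex_normed_vector) = - x"
  using scaleC_scaleC[of \<i> \<i> x] scaleC_of_real[of "-1" x] by simp

lemma ii_scaleC_scaleR: "\<i> *\<^sub>C (r *\<^sub>R (x::'x::complex_normed_vector)) = r *\<^sub>R (\<i> *\<^sub>C x)"
  using scaleC_scaleC[of \<i> "of_real r" x] scaleC_scaleC[of "of_real r" \<i> x]
  by (simp add: scaleC_of_real mult.commute)

lemma complexify_topdual:
  assumes lin: "linear u" and le: "\<And>x. u x \<le> K * norm x"
  shows "complexify u \<in> topdual" "cmod (complexify u x) \<le> K * norm x"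
proof -
  interpret u: linear u by fact
  have hom: "complexify u (c *\<^sub>C x) = c * complexify u x" for c x
  proof -
    have "\<i> *\<^sub>C c *\<^sub>C x = Re c *\<^sub>R (\<i> *\<^sub>C x) - Im c *\<^sub>R x"
      by (subst scaleC_eq[of c x]) (simp add: scaleC_add_right ii_scaleC_scaleR ii_scaleC_ii)
    then have 2: "u (\<i> *\<^sub>C c *\<^sub>C x) = Re c * u (\<i> *\<^sub>C x) - Im c * u x"
      by (simp add: u.diff u.scale)
    have 1: "u (c *\<^sub>C x) = Re c * u x + Im c * u (\<i> *\<^sub>C x)"
      by (subst scaleC_eq[of c x]) (simp add: u.add u.scale)
    show ?thesis by (simp add: complexify_def complex_eq_iff 1 2)
  qed
  have bd: "cmod (complexify u x) \<le> K * norm x" for x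
  proof (cases "complexify u x = 0")
    case True
    have "0 \<le> K * norm x" using le[of x] le[of "- x"] u.neg[of x] by simp
    then show ?thesis using True by simp
  next
    case False
    \<comment> \<open>\<open>c\<close> has modulus 1 and rotates the value to the positive real
      axis, where the functional agrees with \<open>u\<close>.\<close>
    define c where "c = cnj (complexify u x) / cmod (complexify u x)"
    have "complexify u (c *\<^sub>C x) = complex_of_real (cmod (complexify u x))"
      using False complex_norm_square[of "complexify u x"] unfolding hom c_def
      by (simp add: power2_eq_square field_simps)
    then have "cmod (complexify u x) = u (c *\<^sub>C x)" by (simp add: complexify_def complex_eq_iff)
    also have "\<dots> \<le> K * norm (c *\<^sub>C x)" by (rule le)
    also have "norm (c *\<^sub>C x) = norm x"
      using False by (simp add: norm_scaleC c_def norm_divide)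
    finally show ?thesis .
  qed
  have "bounded_linear (complexify u)"
    by (rule bounded_linear_intro[where K = K])
       (auto simp: complexify_def complex_eq_iff u.add u.scale scaleC_add_right ii_scaleC_scaleR
             bd[unfolded complexify_def] mult.commute)
  then show "complexify u \<in> topdual" using hom by (auto simp: topdual_def)
  show "cmod (complexify u x) \<le> K * norm x" by (rule bd)
qed

lemma complexify_Re:
  assumes "x' \<in> topdual"
  shows "complexify (\<lambda>x. Re (x' x)) = x'"
  by (auto simp: complexify_def complex_eq_iff topdual_scaleC[OF assms])

lemma norming_functional:
  fixes x0 :: "'x::complex_normed_vector"
  obtains x' where "x' \<in> dual_ball" "x' x0 = complex_of_real (norm x0)"
proof -
  obtain u where u: "linear u" "\<And>x. u x \<le> norm x" "u x0 = norm x0"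
    using real_norming_functional[of x0 thesis] by blast
  have b: "complexify u \<in> topdual" "cmod (complexify u x) \<le> norm x" for x
    using complexify_topdual[OF u(1), of 1] u(2) by simp_all
  have re: "Re (complexify u x0) = norm x0" by (simp add: complexify_def u(3))
  \<comment> \<open>The real part alone already has the maximal modulus allowed, which forces the
    imaginary part to vanish.\<close>
  have "(cmod (complexify u x0))\<^sup>2 \<le> (norm x0)\<^sup>2" using b(2) by (intro power_mono) auto
  then have "Im (complexify u x0) = 0" unfolding cmod_power2 re by simp
  then have "complexify u x0 = complex_of_real (norm x0)" using re by (simp add: complex_eq_iff)
  then show ?thesis using that dual_ballI[OF b] by blast
qed

text \<open>A functional norming \<open>x - y\<close> would detect a difference. Weak vector
  integrals are therefore unique.\<close>

lemma topdual_separates: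
  assumes "\<And>x'. x' \<in> topdual \<Longrightarrow> x' x = x' y"
  shows "x = y"
proof -
  obtain x' where x': "x' \<in> dual_ball" "x' (x - y) = complex_of_real (norm (x - y))"
    using norming_functional[of "x - y" thesis] by blast
  have "x' (x - y) = x' x - x' y"
    using topdual_linear[OF dual_ball_topdual[OF x'(1)]] by (simp add: bounded_linear.linear
      linear_diff)
  then show ?thesis using x'(2) assms[OF dual_ball_topdual[OF x'(1)]] by simp
qed


section \<open>Total variation\<close>

text \<open>The condition of \<open>vector_measure\<close> over arbitrary real normed spaces: one
  notion then serves vector measures, complex measures and their real and imaginary parts.\<close>

definition sigma_additive :: "('g::topological_space set \<Rightarrow> 'b::real_normed_vector) \<Rightarrow> bool" where
  "sigma_additive \<mu> \<longleftrightarrow>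
     (\<forall>A :: nat \<Rightarrow> 'g set. range A \<subseteq> sets borel \<longrightarrow> disjoint_family A \<longrightarrow>
        (\<lambda>n. \<mu> (A n)) sums \<mu> (\<Union>n. A n))"

lemma sigma_additive_sums:
  "sigma_additive \<mu> \<Longrightarrow> range A \<subseteq> sets borel \<Longrightarrow> disjoint_family A \<Longrightarrow> (\<lambda>n. \<mu> (A n)) sums \<mu> (\<Union>n. A n)"
  by (auto simp: sigma_additive_def)

lemma sigma_additive_empty:
  assumes "sigma_additive \<mu>" shows "\<mu> {} = 0"
proof -
  have "(\<lambda>n::nat. \<mu> {}) sums \<mu> {}"
    using sigma_additive_sums[OF assms, of "\<lambda>_. {}"] by (simp add: disjoint_family_on_def)
  then show ?thesis by (simp add: sums_iff summable_const_iff)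
qed

lemma sigma_additive_Un:
  assumes \<mu>: "sigma_additive \<mu>" and "A \<in> sets borel" "B \<in> sets borel" "A \<inter> B = {}"
  shows "\<mu> (A \<union> B) = \<mu> A + \<mu> B"
proof -
  have "(\<lambda>n. \<mu> (binaryset A B n)) sums \<mu> (\<Union>n. binaryset A B n)"
    using assms by (intro sigma_additive_sums)
      (auto simp: range_binaryset_eq disjoint_family_on_def binaryset_def)
  moreover have "(\<lambda>n. \<mu> (binaryset A B n)) sums (\<mu> A + \<mu> B)"
    by (intro binaryset_sums sigma_additive_empty \<mu>)
  ultimately show ?thesis by (simp add: UN_binaryset_eq sums_iff)
qed

lemma sigma_additive_Diff:
  assumes \<mu>: "sigma_additive \<mu>" and "A \<in> sets borel" "B \<in> sets borel" "A \<subseteq> B"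
  shows "\<mu> (B - A) = \<mu> B - \<mu> A"
proof -
  have "\<mu> (A \<union> (B - A)) = \<mu> A + \<mu> (B - A)" using assms by (intro sigma_additive_Un) auto
  moreover have "A \<union> (B - A) = B" using assms by auto
  ultimately show ?thesis by simp
qed

lemma sigma_additive_UN:
  assumes \<mu>: "sigma_additive \<mu>" and "finite I" "\<And>i. i \<in> I \<Longrightarrow> E i
    \<in> sets borel" "disjoint_family_on E I"
  shows "\<mu> (\<Union>i\<in>I. E i) = (\<Sum>i\<in>I. \<mu> (E i))"
  using assms(2-)
proof (induction rule: finite_induct)
  case empty then show ?case using sigma_additive_empty[OF \<mu>] by simp
next
  case (insert i I)
  have "\<mu> (E i \<union> (\<Union>i\<in>I. E i)) = \<mu> (E i) + \<mu> (\<Union>i\<in>I. E i)"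
    using insert.prems insert.hyps
    by (intro sigma_additive_Un \<mu>) (auto simp: disjoint_family_on_def)
  also have "\<mu> (\<Union>i\<in>I. E i) = (\<Sum>i\<in>I. \<mu> (E i))"
    using insert.prems by (intro insert.IH) (auto simp: disjoint_family_on_def)
  finally show ?case using insert.hyps by simp
qed

lemma sigma_additive_compose:
  assumes "sigma_additive \<mu>" "bounded_linear h"
  shows "sigma_additive (\<lambda>B. h (\<mu> B))"
  unfolding sigma_additive_def
  by (intro allI impI bounded_linear.sums[OF assms(2)] sigma_additive_sums[OF assms(1)])

lemma sigma_additive_Int:
  assumes "sigma_additive \<mu>" "E \<in> sets borel"
  shows "sigma_additive (\<lambda>B. \<mu> (B \<inter> E))"
  unfolding sigma_additive_def
proof (intro allI impI)
  fix A :: "nat \<Rightarrow> 'a set" assume A: "range A \<subseteq> sets borel" "disjoint_family A"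
  have "(\<lambda>n. \<mu> (A n \<inter> E)) sums \<mu> (\<Union>n. A n \<inter> E)"
    using A assms(2) by (intro sigma_additive_sums assms) (auto simp: disjoint_family_on_def)
  then show "(\<lambda>n. \<mu> (A n \<inter> E)) sums \<mu> ((\<Union>n. A n) \<inter> E)" by (simp add: Int_UN_distrib2)
qed

lemma sigma_additive_sum:
  assumes "\<And>i. i \<in> I \<Longrightarrow> sigma_additive (\<mu> i)"
  shows "sigma_additive (\<lambda>B. \<Sum>i\<in>I. \<mu> i B)"
  unfolding sigma_additive_def
  by (intro allI impI sums_sum sigma_additive_sums[OF assms])

section \<open>The total variation as a countably additive measure\<close>

lemma variation_least:
  assumes "\<And>P. finite P \<Longrightarrow> P \<subseteq> sets borel \<Longrightarrow> partition_on A P \<Longrightarrow> (\<Sum>E\<in>P. ennreal (cmod (\<mu> E))) \<le> c"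
  shows "variation \<mu> A \<le> c"
  unfolding variation_def by (rule SUP_least) (use assms in auto)

text \<open>Partitions consist of nonempty sets that exhaust \<open>A\<close>. Empty members of the
  family are therefore dropped, at no cost as \<open>\<mu> {} = 0\<close>, and the rest of
  \<open>A\<close> is added as a further cell.\<close>

lemma variation_upper:
  assumes I: "finite I" "\<And>i. i \<in> I \<Longrightarrow> E i \<in> sets borel" "disjoint_family_on E I"
    and A: "(\<Union>i\<in>I. E i) \<subseteq> A" "A \<in> sets borel" and \<mu>: "\<mu> {} = 0"
  shows "(\<Sum>i\<in>I. ennreal (cmod (\<mu> (E i)))) \<le> variation \<mu> A"
proof -
  define J where "J = {i \<in> I. E i \<noteq> {}}"
  define R where "R = A - (\<Union>i\<in>J. E i)"
  define P where "P = E ` J \<union> ({R} - {{}})"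
  have J: "finite J" using I by (simp add: J_def)
  have "inj_on E J" using I(3) by (auto simp: inj_on_def J_def disjoint_family_on_def)
  have "(\<Sum>i\<in>I. ennreal (cmod (\<mu> (E i)))) = (\<Sum>i\<in>J. ennreal (cmod (\<mu> (E i))))"
    using I \<mu> by (intro sum.mono_neutral_right) (auto simp: J_def)
  also have "\<dots> = (\<Sum>B\<in>E ` J. ennreal (cmod (\<mu> B)))"
    using \<open>inj_on E J\<close> by (simp add: sum.reindex)
  also have "\<dots> \<le> (\<Sum>B\<in>P. ennreal (cmod (\<mu> B)))"
    using J by (intro sum_mono2) (auto simp: P_def)
  also have "\<dots> \<le> variation \<mu> A"
    unfolding variation_def
  proof (rule SUP_upper, intro CollectI conjI)
    show "finite P" using J by (simp add: P_def)
    have "R \<in> sets borel" unfolding R_def using J I A by (intro sets.Diff sets.finite_UN) (auto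
      simp: J_def)
    then show "P \<subseteq> sets borel" using I(2) by (auto simp: P_def J_def)
    have "(\<Union>i\<in>J. E i) \<subseteq> A" using A(1) unfolding J_def by blast
    moreover have "\<Union>P = (\<Union>i\<in>J. E i) \<union> R" by (cases "R = {}") (simp_all add: P_def Un_commute)
    ultimately have "\<Union>P = A" by (simp add: R_def Un_absorb1)
    moreover have "disjoint P"
    proof (rule disjointI)
      have d: "E i \<inter> E j = {}" if "i \<in> J" "j \<in> J" "E i \<noteq> E j" for i j
        using disjoint_family_onD[OF I(3), of i j] that unfolding J_def by blast
      have R: "R \<inter> E i = {}" if "i \<in> J" for i using that by (auto simp: R_def)
      fix a b assume "a \<in> P" "b \<in> P" and ne: "a \<noteq> b"
      then have "a \<in> E ` J \<or> a = R" "b \<in> E ` J \<or> b = R" by (auto simp: P_def)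
      then show "a \<inter> b = {}" using ne d R by (metis Int_commute imageE)
    qed
    moreover have "{} \<notin> P" by (auto simp: P_def J_def)
    ultimately show "partition_on A P" by (simp add: partition_on_def)
  qed
  finally show ?thesis .
qed

lemma variation_ge:
  assumes "B \<subseteq> A" "B \<in> sets borel" "A \<in> sets borel" "\<mu> {} = 0"
  shows "ennreal (cmod (\<mu> B)) \<le> variation \<mu> A"
  using variation_upper[of "{()}" "\<lambda>_. B" A \<mu>] assms by (simp add: disjoint_family_on_def)

lemma variation_mono:
  assumes "B \<subseteq> A" "A \<in> sets borel" "\<mu> {} = 0"
  shows "variation \<mu> B \<le> variation \<mu> A"
proof (rule variation_least)
  fix P assume P: "finite P" "P \<subseteq> sets borel" "partition_on B P"
  then show "(\<Sum>E\<in>P. ennreal (cmod (\<mu> E))) \<le> variation \<mu> A"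
    using variation_upper[of P "\<lambda>x. x" A \<mu>] assms
    by (auto simp: partition_on_def disjoint_family_on_def disjoint_def)
qed

lemma variation_empty: "\<mu> {} = 0 \<Longrightarrow> variation \<mu> {} = 0"
  unfolding variation_def by (intro antisym SUP_least) (auto simp: partition_on_def intro!:
    sum.neutral simp del: sum_ennreal)

lemma variation_cong:
  assumes "\<And>B. B \<in> sets borel \<Longrightarrow> B \<subseteq> A \<Longrightarrow> cmod (\<mu> B) = cmod (\<mu>' B)"
  shows "variation \<mu> A = variation \<mu>' A"
  unfolding variation_def
proof (rule SUP_cong)
  fix P assume "P \<in> {P. finite P \<and> P \<subseteq> sets borel \<and> partition_on A P}"
  then show "(\<Sum>E\<in>P. ennreal (cmod (\<mu> E))) = (\<Sum>E\<in>P. ennreal (cmod (\<mu>' E)))"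
    using assms by (intro sum.cong) (auto simp: partition_on_def)
qed simp

lemma variation_cmult: "variation (\<lambda>B. c * \<mu> B) A = ennreal (cmod c) * variation \<mu> A"
proof -
  have "variation (\<lambda>B. c * \<mu> B) A =
      (SUP P \<in> {P. finite P \<and> P \<subseteq> sets borel \<and> partition_on A P}.
        ennreal (cmod c) * (\<Sum>E\<in>P. ennreal (cmod (\<mu> E))))"
    by (simp add: variation_def norm_mult ennreal_mult sum_distrib_left del: sum_ennreal)
  also have "\<dots> = ennreal (cmod c) * variation \<mu> A"
    unfolding variation_def by (simp add: SUP_mult_left_ennreal)
  finally show ?thesis .
qed

text \<open>A partition of \<open>A\<close> and one of \<open>B\<close> together form a partition of
  the union. They have no cell in common because cells are nonempty.\<close>

lemma variation_superadd:
  assumes "A \<in> sets borel" "B \<in> sets borel" "A \<inter> B = {}" "\<mu> {} = 0"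
  shows "variation \<mu> A + variation \<mu> B \<le> variation \<mu> (A \<union> B)"
proof -
  let ?P = "\<lambda>A. {P. finite P \<and> P \<subseteq> sets borel \<and> partition_on A P}"
  let ?s = "\<lambda>P. \<Sum>E\<in>P. ennreal (cmod (\<mu> E))"
  have ne: "?P A \<noteq> {}" if "A \<in> sets borel" for A :: "'a set"
  proof -
    have "{A} - {{}} \<in> ?P A" using that by (auto simp: partition_on_def disjoint_def)
    then show ?thesis by blast
  qed
  have "?s P + ?s Q \<le> variation \<mu> (A \<union> B)" if "P \<in> ?P A" "Q \<in> ?P B" for P Q
  proof -
    have "x \<subseteq> A \<inter> B \<and> x \<noteq> {}" if "x \<in> P \<inter> Q" for x
      using that \<open>P \<in> ?P A\<close> \<open>Q \<in> ?P B\<close> by (auto simp: partition_on_def)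
    then have "P \<inter> Q = {}" using assms(3) by blast
    then have "?s P + ?s Q = ?s (P \<union> Q)" using that by (simp add: sum.union_disjoint del:
      sum_ennreal)
    also have "\<dots> \<le> variation \<mu> (A \<union> B)"
      unfolding variation_def using that assms(3) disjoint_union[of P Q]
      by (intro SUP_upper) (auto simp: partition_on_def)
    finally show ?thesis .
  qed
  then have "?s P + variation \<mu> B \<le> variation \<mu> (A \<union> B)" if "P \<in> ?P A" for P
    unfolding variation_def[of \<mu> B] using that
    unfolding ennreal_SUP_add_right[OF ne[OF assms(2)]] by (intro SUP_least)
  then show ?thesis
    unfolding variation_def[of \<mu> A]
    unfolding ennreal_SUP_add_left[OF ne[OF assms(1)], symmetric] by (intro SUP_least)
qed

lemma ennreal_norm_suminf_le:
  fixes f :: "nat \<Rightarrow> 'b::banach"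
  assumes "f sums s"
  shows "ennreal (norm s) \<le> (\<Sum>n. ennreal (norm (f n)))"
proof (cases "(\<Sum>n. ennreal (norm (f n))) = top")
  case False
  then have sm: "summable (\<lambda>n. norm (f n))" by (intro summable_suminf_not_top) auto
  have "norm s \<le> (\<Sum>n. norm (f n))" using summable_norm[OF sm] assms by (simp add: sums_iff)
  then show ?thesis using sm by (simp add: suminf_ennreal2 ennreal_leI)
qed simp

text \<open>Superadditivity bounds the partial sums from above. Conversely, each cell
  \<open>E\<close> of a partition of the union is cut into the pieces \<open>E \<inter> A n\<close>,
  which for fixed \<open>n\<close> form a disjoint family in \<open>A n\<close>.\<close>

lemma variation_countably_additive:
  assumes \<mu>: "sigma_additive \<mu>"
  shows "countably_additive (sets borel) (variation \<mu>)"
proof (rule countably_additiveI)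
  note \<mu>0 = sigma_additive_empty[OF \<mu>]
  fix A :: "nat \<Rightarrow> 'a set"
  assume A: "range A \<subseteq> sets borel" "disjoint_family A" "(\<Union>n. A n) \<in> sets borel"
  show "(\<Sum>n. variation \<mu> (A n)) = variation \<mu> (\<Union>n. A n)"
  proof (rule antisym)
    have "(\<Sum>i<n. variation \<mu> (A i)) \<le> variation \<mu> (\<Union>i<n. A i)" for n
    proof (induction n)
      case (Suc n)
      have "(\<Sum>i<Suc n. variation \<mu> (A i)) \<le> variation \<mu> (\<Union>i<n. A i) + variation \<mu> (A n)"
        using Suc by (simp add: add_right_mono)
      also have "\<dots> \<le> variation \<mu> ((\<Union>i<n. A i) \<union> A n)"
      proof (rule variation_superadd)
        show "(\<Union>i<n. A i) \<inter> A n = {}"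
          using disjoint_family_onD[OF A(2), of _ n] by force
      qed (use A(1) \<mu>0 in auto)
      also have "(\<Union>i<n. A i) \<union> A n = (\<Union>i<Suc n. A i)" by (auto simp: lessThan_Suc)
      finally show ?case .
    qed (simp add: variation_empty \<mu>0)
    also have "variation \<mu> (\<Union>i<n. A i) \<le> variation \<mu> (\<Union>n. A n)" for n
      using A \<mu>0 by (intro variation_mono) auto
    finally show "(\<Sum>n. variation \<mu> (A n)) \<le> variation \<mu> (\<Union>n. A n)"
      by (intro suminf_le_const) auto
    show "variation \<mu> (\<Union>n. A n) \<le> (\<Sum>n. variation \<mu> (A n))"
    proof (rule variation_least)
      fix P assume P: "finite P" "P \<subseteq> sets borel" "partition_on (\<Union>n. A n) P"
      have "ennreal (cmod (\<mu> E)) \<le> (\<Sum>n. ennreal (cmod (\<mu> (E \<inter> A n))))" if E: "E \<in> P" for E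
      proof (rule ennreal_norm_suminf_le)
        have "(\<lambda>n. \<mu> (E \<inter> A n)) sums \<mu> (\<Union>n. E \<inter> A n)"
          using A P E by (intro sigma_additive_sums \<mu>) (auto simp: disjoint_family_on_def)
        moreover have "(\<Union>n. E \<inter> A n) = E" using E P(3) by (auto simp: partition_on_def)
        ultimately show "(\<lambda>n. \<mu> (E \<inter> A n)) sums \<mu> E" by simp
      qed
      then have "(\<Sum>E\<in>P. ennreal (cmod (\<mu> E))) \<le> (\<Sum>E\<in>P. \<Sum>n. ennreal (cmod (\<mu> (E \<inter> A n))))"
        by (rule sum_mono)
      also have "\<dots> = (\<Sum>n. \<Sum>E\<in>P. ennreal (cmod (\<mu> (E \<inter> A n))))"
        by (rule suminf_sum[symmetric]) simp
      also have "\<dots> \<le> (\<Sum>n. variation \<mu> (A n))"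
      proof (rule suminf_le)
        fix n
        have "disjoint_family_on (\<lambda>E. E \<inter> A n) P"
          using partition_onD2[OF P(3)] unfolding disjoint_family_on_def disjoint_def by blast
        then show "(\<Sum>E\<in>P. ennreal (cmod (\<mu> (E \<inter> A n)))) \<le> variation \<mu> (A n)"
          using P(1,2) A(1) \<mu>0 by (intro variation_upper[of P "\<lambda>E. E \<inter> A n"]) auto
      qed auto
      finally show "(\<Sum>E\<in>P. ennreal (cmod (\<mu> E))) \<le> (\<Sum>n. variation \<mu> (A n))" .
    qed
  qed
qed

lemma variation_measure_simps [simp]:
  "sets (variation_measure \<mu>) = sets borel" "space (variation_measure \<mu>) = UNIV"
  unfolding variation_measure_def
  by (simp_all add: sets.sigma_sets_eq[of borel, simplified])

lemma emeasure_variation_measure: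
  assumes "sigma_additive \<mu>" "A \<in> sets borel"
  shows "emeasure (variation_measure \<mu>) A = variation \<mu> A"
  unfolding variation_measure_def
proof (rule emeasure_measure_of_sigma)
  show "sigma_algebra UNIV (sets borel :: 'a set set)"
    using sets.sigma_algebra_axioms[of "borel :: 'a measure"] by simp
  show "positive (sets borel) (variation \<mu>)"
    by (simp add: positive_def variation_empty sigma_additive_empty assms)
qed (intro variation_countably_additive assms)+

text \<open>Real or imaginary parts contribute at least half of the sum of moduli, and the indices
  of one sign at least half of that; hence the factor 4.\<close>

lemma complex_subset_sum:
  fixes z :: "'i \<Rightarrow> complex"
  assumes I: "finite I"
  shows "\<exists>S\<subseteq>I. (\<Sum>i\<in>I. cmod (z i)) \<le> 4 * cmod (\<Sum>i\<in>S. z i)"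
proof (rule ccontr)
  assume "\<not> (\<exists>S\<subseteq>I. (\<Sum>i\<in>I. cmod (z i)) \<le> 4 * cmod (\<Sum>i\<in>S. z i))"
  then have less: "4 * cmod (\<Sum>i\<in>S. z i) < (\<Sum>i\<in>I. cmod (z i))" if "S \<subseteq> I" for S
    using that by (auto simp: not_le)
  have split: "(\<Sum>i\<in>I. \<bar>h (z i)\<bar>) < (\<Sum>i\<in>I. cmod (z i)) / 2"
    if h: "linear h" "\<And>w. \<bar>h w\<bar> \<le> cmod w" for h :: "complex \<Rightarrow> real"
  proof -
    define S where "S = {i \<in> I. 0 \<le> h (z i)}"
    have "(\<Sum>i\<in>I. \<bar>h (z i)\<bar>) = (\<Sum>i\<in>S. \<bar>h (z i)\<bar>) + (\<Sum>i\<in>I - S. \<bar>h (z i)\<bar>)"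
      using I by (subst sum.subset_diff[of S]) (auto simp: S_def)
    also have "(\<Sum>i\<in>S. \<bar>h (z i)\<bar>) = h (\<Sum>i\<in>S. z i)"
      by (simp add: linear_sum[OF h(1)] S_def)
    also have "(\<Sum>i\<in>I - S. \<bar>h (z i)\<bar>) = - h (\<Sum>i\<in>I - S. z i)"
      unfolding linear_sum[OF h(1)] sum_negf[symmetric] by (rule sum.cong) (auto simp: S_def)
    also have "h (\<Sum>i\<in>S. z i) + - h (\<Sum>i\<in>I - S. z i) \<le> cmod (\<Sum>i\<in>S. z i) + cmod (\<Sum>i\<in>I - S. z i)"
      using h(2)[of "\<Sum>i\<in>S. z i"] h(2)[of "\<Sum>i\<in>I - S. z i"] by linarith
    also have "\<dots> < (\<Sum>i\<in>I. cmod (z i)) / 2"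
      using less[of S] less[of "I - S"] by (auto simp: S_def)
    finally show ?thesis .
  qed
  have "(\<Sum>i\<in>I. cmod (z i)) \<le> (\<Sum>i\<in>I. \<bar>Re (z i)\<bar>) + (\<Sum>i\<in>I. \<bar>Im (z i)\<bar>)"
    unfolding sum.distrib[symmetric] by (intro sum_mono cmod_le)
  also have "\<dots> < (\<Sum>i\<in>I. cmod (z i)) / 2 + (\<Sum>i\<in>I. cmod (z i)) / 2"
    by (intro add_strict_mono split)
       (auto simp: bounded_linear_Re bounded_linear_Im bounded_linear.linear abs_Re_le_cmod
         abs_Im_le_cmod)
  finally show False by simp
qed

lemma variation_Un:
  assumes "sigma_additive \<mu>" "A \<in> sets borel" "B \<in> sets borel" "A \<inter> B = {}"
  shows "variation \<mu> (A \<union> B) = variation \<mu> A + variation \<mu> B"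
  using assms plus_emeasure[of A "variation_measure \<mu>" B]
  by (simp add: emeasure_variation_measure)

text \<open>The constant \<open>c\<close> makes some union of cells have measure of modulus above
  \<open>1 + cmod (\<mu> E)\<close>. The measure of its complement in \<open>E\<close> then has
  modulus at least 1 too; one of the two sets keeps infinite variation and the other is split
  off.\<close>

lemma infinite_variation_split:
  assumes \<mu>: "sigma_additive \<mu>" and E: "E \<in> sets borel" "variation \<mu> E = \<infinity>"
  obtains A where "A \<in> sets borel" "A \<subseteq> E" "1 \<le> cmod (\<mu> A)" "variation \<mu> (E - A) = \<infinity>"
proof -
  define c where "c = 4 * (1 + cmod (\<mu> E))"
  have "\<not> variation \<mu> E \<le> ennreal c" using E by (simp add: top_unique)
  then obtain P where P: "finite P" "P \<subseteq> sets borel" "partition_on E P"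
      and c: "\<not> (\<Sum>B\<in>P. ennreal (cmod (\<mu> B))) \<le> ennreal c"
    using variation_least[of E \<mu> "ennreal c"] by blast
  have "c < (\<Sum>B\<in>P. cmod (\<mu> B))"
    using c by (metis ennreal_leI norm_ge_zero not_le sum_ennreal)
  moreover obtain S where S: "S \<subseteq> P" "(\<Sum>B\<in>P. cmod (\<mu> B)) \<le> 4 * cmod (\<Sum>B\<in>S. \<mu> B)"
    using complex_subset_sum[OF P(1), of \<mu>] by blast
  moreover have "\<mu> (\<Union>S) = (\<Sum>B\<in>S. \<mu> B)"
    using sigma_additive_UN[OF \<mu>, of S "\<lambda>x. x"] P S finite_subset[OF S(1) P(1)]
    by (auto simp: partition_on_def disjoint_def disjoint_family_on_def subset_eq)
  ultimately have A: "1 + cmod (\<mu> E) < cmod (\<mu> (\<Union>S))" by (simp add: c_def)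
  have Sb: "\<Union>S \<in> sets borel" using finite_subset[OF S(1) P(1)] P S by (intro sets.finite_Union) auto
  have SE: "\<Union>S \<subseteq> E" using P S by (auto simp: partition_on_def)
  have "cmod (\<mu> (\<Union>S)) \<le> cmod (\<mu> E) + cmod (\<mu> (E - \<Union>S))"
    unfolding sigma_additive_Diff[OF \<mu> Sb E(1) SE]
    using norm_triangle_ineq4[of "\<mu> E" "\<mu> E - \<mu> (\<Union>S)"] by simp
  then have B: "1 \<le> cmod (\<mu> (E - \<Union>S))" using A by simp
  have "variation \<mu> (\<Union>S) + variation \<mu> (E - \<Union>S) = variation \<mu> E"
    using variation_Un[OF \<mu> Sb, of "E - \<Union>S"] SE Sb E(1) by (simp add: Un_absorb1)
  then have "variation \<mu> (\<Union>S) = \<infinity> \<or> variation \<mu> (E - \<Union>S) = \<infinity>" using E(2) by simp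
  then show ?thesis
  proof
    assume "variation \<mu> (\<Union>S) = \<infinity>"
    then show ?thesis using B Sb E(1) SE by (intro that[of "E - \<Union>S"]) (auto simp: double_diff)
  next
    assume "variation \<mu> (E - \<Union>S) = \<infinity>"
    then show ?thesis using A Sb SE norm_ge_zero[of "\<mu> E"] by (intro that[of "\<Union>S"]) linarith+
  qed
qed

text \<open>Iterated splitting would yield disjoint sets of measure at least 1 in modulus, whose
  measures cannot form a convergent series.\<close>

lemma variation_finite:
  assumes \<mu>: "sigma_additive \<mu>"
  shows "variation \<mu> UNIV \<noteq> \<infinity>"
proof
  assume inf: "variation \<mu> UNIV = \<infinity>"
  have "\<exists>E. \<forall>n. (E n \<in> sets borel \<and> variation \<mu> (E n) = \<infinity>) \<and>
      (E (Suc n) \<subseteq> E n \<and> 1 \<le> cmod (\<mu> (E n - E (Suc n))))"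
  proof (rule dependent_nat_choice)
    show "\<exists>E. E \<in> sets borel \<and> variation \<mu> E = \<infinity>" using inf by (intro exI[of _ UNIV]) simp
    fix E :: "'a set" assume E: "E \<in> sets borel \<and> variation \<mu> E = \<infinity>"
    then obtain A where "A \<in> sets borel" "A \<subseteq> E" "1 \<le> cmod (\<mu> A)" "variation \<mu> (E - A) = \<infinity>"
      using infinite_variation_split[OF \<mu>] by blast
    then show "\<exists>E'. (E' \<in> sets borel \<and> variation \<mu> E' = \<infinity>) \<and> (E' \<subseteq> E \<and> 1 \<le> cmod (\<mu> (E - E')))"
      using E by (intro exI[of _ "E - A"]) (auto simp: double_diff)
  qed
  then obtain E where E: "\<And>n. E n \<in> sets borel" "\<And>n. E (Suc n) \<subseteq> E n"
      "\<And>n. 1 \<le> cmod (\<mu> (E n - E (Suc n)))" by blast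
  have dec: "E n \<subseteq> E m" if "m \<le> n" for m n using lift_Suc_antimono_le[of E, OF E(2) that] .
  have "disjoint_family (\<lambda>n. E n - E (Suc n))"
    unfolding disjoint_family_on_def
  proof (intro ballI impI)
    fix m n :: nat assume "m \<noteq> n"
    then have "Suc m \<le> n \<or> Suc n \<le> m" by arith
    then show "(E m - E (Suc m)) \<inter> (E n - E (Suc n)) = {}"
      using dec[of "Suc m" n] dec[of "Suc n" m] by auto
  qed
  then have "(\<lambda>n. \<mu> (E n - E (Suc n))) sums \<mu> (\<Union>n. E n - E (Suc n))"
    using E(1) by (intro sigma_additive_sums \<mu>) auto
  then have "(\<lambda>n. \<mu> (E n - E (Suc n))) \<longlonglongrightarrow> 0" by (intro summable_LIMSEQ_zero sums_summable)
  then obtain n where "cmod (\<mu> (E n - E (Suc n))) < 1"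
    using LIMSEQ_D[of _ 0 1] by fastforce
  then show False using E(3)[of n] by simp
qed

lemma finite_variation_measure:
  assumes "sigma_additive \<mu>"
  shows "finite_measure (variation_measure \<mu>)"
  using variation_finite[OF assms] by (intro finite_measureI) (simp add:
    emeasure_variation_measure assms)


section \<open>Integration with respect to a complex measure\<close>

lemma measure_of_borel_simps [simp]:
  "sets (measure_of UNIV (sets borel) f) = sets borel" "space (measure_of UNIV (sets borel) f)
    = UNIV"
  by (simp_all add: sets.sigma_sets_eq[of borel, simplified])

lemma emeasure_of_sigma_additive:
  assumes \<kappa>: "sigma_additive \<kappa>" and nonneg: "\<And>A. A \<in> sets borel \<Longrightarrow> (0::real) \<le> \<kappa> A"
    and f: "\<And>A. A \<in> sets borel \<Longrightarrow> f A = ennreal (\<kappa> A)"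
    and "A \<in> sets borel"
  shows "emeasure (measure_of UNIV (sets borel) f) A = ennreal (\<kappa> A)"
  unfolding f[OF \<open>A \<in> sets borel\<close>, symmetric]
proof (rule emeasure_measure_of_sigma)
  show "sigma_algebra UNIV (sets borel :: 'a set set)"
    using sets.sigma_algebra_axioms[of "borel :: 'a measure"] by simp
  show "positive (sets borel) f" by (simp add: positive_def f sigma_additive_empty[OF \<kappa>])
  show "countably_additive (sets borel) f"
  proof (rule countably_additiveI)
    fix A :: "nat \<Rightarrow> 'a set"
    assume A: "range A \<subseteq> sets borel" "disjoint_family A" "(\<Union>n. A n) \<in> sets borel"
    then have "(\<Sum>n. ennreal (\<kappa> (A n))) = ennreal (\<kappa> (\<Union>n. A n))"
      by (intro suminf_ennreal_eq nonneg sigma_additive_sums \<kappa>) auto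
    then show "(\<Sum>n. f (A n)) = f (\<Union>n. A n)" using A by (simp add: f range_subsetD)
  qed
qed fact

text \<open>Hahn's theorem for a pair of finite measures is applied to the variation
  \<open>V\<close> and to \<open>\<kappa> = V - \<rho>\<close>; their difference is
  \<open>\<rho>\<close>, and \<open>\<kappa>\<close> is nonnegative as \<open>V\<close> dominates
  \<open>\<rho>\<close>.\<close>

lemma Hahn_decomposition_set:
  fixes \<rho> :: "'g::topological_space set \<Rightarrow> real"
  assumes \<rho>: "sigma_additive \<rho>"
  obtains P where "P \<in> sets borel"
    "\<And>B. B \<in> sets borel \<Longrightarrow> B \<subseteq> P \<Longrightarrow> 0 \<le> \<rho> B" "\<And>B. B \<in> sets borel \<Longrightarrow> B \<inter> P = {} \<Longrightarrow> \<rho> B \<le> 0"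
proof -
  have \<mu>: "sigma_additive (\<lambda>B. complex_of_real (\<rho> B))"
    by (intro sigma_additive_compose[OF \<rho>] bounded_linear_of_real)
  define V where "V = variation_measure (\<lambda>B. complex_of_real (\<rho> B))"
  interpret V: finite_measure V unfolding V_def by (rule finite_variation_measure[OF \<mu>])
  have [simp]: "sets V = sets borel" by (simp add: V_def)
  define \<kappa> where "\<kappa> A = measure V A - \<rho> A" for A
  define N where "N = measure_of UNIV (sets borel) (\<lambda>A. ennreal (\<kappa> A))"
  have \<kappa>: "sigma_additive \<kappa>"
    unfolding \<kappa>_def sigma_additive_def
    by (intro allI impI sums_diff V.finite_measure_UNION sigma_additive_sums[OF \<rho>]) auto
  have \<rho>V: "\<bar>\<rho> A\<bar> \<le> measure V A" if "A \<in> sets borel" for A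
  proof -
    have "ennreal (cmod (complex_of_real (\<rho> A))) \<le> emeasure V A"
      unfolding V_def emeasure_variation_measure[OF \<mu> that]
      using that sigma_additive_empty[OF \<rho>] by (intro variation_ge) auto
    then show ?thesis by (simp add: V.emeasure_eq_measure)
  qed
  have N: "emeasure N A = ennreal (\<kappa> A)" if "A \<in> sets borel" for A
    unfolding N_def using that \<rho>V by (intro emeasure_of_sigma_additive \<kappa>) (auto simp: \<kappa>_def
      abs_le_iff)
  have "\<exists>Y\<in>sets V. (\<forall>X\<in>sets V. X \<subseteq> Y \<longrightarrow> N X \<le> V X) \<and> (\<forall>X\<in>sets V. X \<inter> Y = {} \<longrightarrow> V X \<le> N X)"
    by (intro finite_unsigned_Hahn_decomposition V.finite_measure_axioms finite_measureI)
      (auto simp: N_def N[unfolded N_def])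
  then obtain Y where Y: "Y \<in> sets borel"
    "\<And>X. X \<in> sets borel \<Longrightarrow> X \<subseteq> Y \<Longrightarrow> emeasure N X \<le> emeasure V X"
    "\<And>X. X \<in> sets borel \<Longrightarrow> X \<inter> Y = {} \<Longrightarrow> emeasure V X \<le> emeasure N X" by auto
  show ?thesis
  proof (rule that[OF Y(1)])
    fix B assume B: "B \<in> sets borel" "B \<subseteq> Y"
    then show "0 \<le> \<rho> B" using Y(2)[OF B] by (simp add: N V.emeasure_eq_measure \<kappa>_def)
  next
    fix B assume B: "B \<in> sets borel" "B \<inter> Y = {}"
    have "0 \<le> \<kappa> B" using \<rho>V[OF B(1)] by (auto simp: \<kappa>_def)
    then show "\<rho> B \<le> 0" using Y(3)[OF B] B by (simp add: N V.emeasure_eq_measure \<kappa>_def)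
  qed
qed

lemma positive_part_simps [simp]:
  "sets (positive_part \<rho>) = sets borel" "space (positive_part \<rho>) = UNIV"
  by (simp_all add: positive_part_def)

text \<open>Replacing \<open>B\<close> by \<open>B \<inter> P\<close> discards a part of nonpositive
  measure, and enlarging it to \<open>A \<inter> P\<close> adds one of nonnegative measure; the
  defining supremum is attained there.\<close>

lemma emeasure_positive_part:
  assumes \<rho>: "sigma_additive \<rho>" and P: "P \<in> sets borel"
    "\<And>B. B \<in> sets borel \<Longrightarrow> B \<subseteq> P \<Longrightarrow> 0 \<le> \<rho> B" "\<And>B. B \<in> sets borel \<Longrightarrow> B \<inter> P = {} \<Longrightarrow> \<rho> B \<le> 0"
    and A: "A \<in> sets borel"
  shows "emeasure (positive_part \<rho>) A = ennreal (\<rho> (A \<inter> P))"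
  unfolding positive_part_def
proof (rule emeasure_of_sigma_additive)
  show "sigma_additive (\<lambda>A. \<rho> (A \<inter> P))" by (intro sigma_additive_Int \<rho> P)
  show "0 \<le> \<rho> (A \<inter> P)" if "A \<in> sets borel" for A using that P by auto
  fix A :: "'a set" assume A: "A \<in> sets borel"
  show "(SUP B\<in>{B \<in> sets borel. B \<subseteq> A}. ennreal (\<rho> B)) = ennreal (\<rho> (A \<inter> P))"
  proof (rule antisym)
    show "ennreal (\<rho> (A \<inter> P)) \<le> (SUP B\<in>{B \<in> sets borel. B \<subseteq> A}. ennreal (\<rho> B))"
      using A P(1) by (intro SUP_upper) auto
    show "(SUP B\<in>{B \<in> sets borel. B \<subseteq> A}. ennreal (\<rho> B)) \<le> ennreal (\<rho> (A \<inter> P))"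
    proof (intro SUP_least ennreal_leI)
      fix B assume B: "B \<in> {B \<in> sets borel. B \<subseteq> A}"
      have "\<rho> ((B \<inter> P) \<union> (B - P)) = \<rho> (B \<inter> P) + \<rho> (B - P)"
        using B P(1) by (intro sigma_additive_Un \<rho>) auto
      moreover have "\<rho> (B - P) \<le> 0" using B P(1) by (intro P(3)) auto
      moreover have "\<rho> (A \<inter> P - B \<inter> P) = \<rho> (A \<inter> P) - \<rho> (B \<inter> P)"
        using A B P(1) by (intro sigma_additive_Diff \<rho>) auto
      moreover have "0 \<le> \<rho> (A \<inter> P - B \<inter> P)" using A B P(1) by (intro P(2)) auto
      ultimately show "\<rho> B \<le> \<rho> (A \<inter> P)" by (simp add: Int_Diff_Un)
    qed
  qed
qed fact

lemma sigma_additive_uminus: "sigma_additive \<mu> \<Longrightarrow> sigma_additive (\<lambda>B. - \<mu> B)"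
  unfolding sigma_additive_def by (intro allI impI sums_minus) auto

lemma measure_positive_part_diff:
  assumes \<rho>: "sigma_additive \<rho>" and A: "A \<in> sets borel"
  shows "measure (positive_part \<rho>) A - measure (positive_part (\<lambda>B. - \<rho> B)) A = \<rho> A"
proof -
  obtain P where P: "P \<in> sets borel"
    "\<And>B. B \<in> sets borel \<Longrightarrow> B \<subseteq> P \<Longrightarrow> 0 \<le> \<rho> B" "\<And>B. B \<in> sets borel \<Longrightarrow> B \<inter> P = {} \<Longrightarrow> \<rho> B \<le> 0"
    using Hahn_decomposition_set[OF \<rho>] by blast
  \<comment> \<open>The complement of \<open>P\<close> serves as the Hahn set of
    \<open>- \<rho>\<close>.\<close>
  have "emeasure (positive_part (\<lambda>B. - \<rho> B)) A = ennreal (- \<rho> (A \<inter> - P))"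
  proof (rule emeasure_positive_part[OF sigma_additive_uminus[OF \<rho>] _ _ _ A])
    show "- P \<in> sets borel" using P(1) by auto
    show "0 \<le> - \<rho> B" if "B \<in> sets borel" "B \<subseteq> - P" for B using P(3)[of B] that by auto
    show "- \<rho> B \<le> 0" if "B \<in> sets borel" "B \<inter> - P = {}" for B using P(2)[of B] that by auto
  qed
  moreover have "\<rho> ((A \<inter> P) \<union> (A \<inter> - P)) = \<rho> (A \<inter> P) + \<rho> (A \<inter> - P)"
    using A P(1) by (intro sigma_additive_Un \<rho>) auto
  moreover have "0 \<le> \<rho> (A \<inter> P)" "\<rho> (A \<inter> - P) \<le> 0" using A P(1) by (auto intro!: P(2,3))
  moreover have "(A \<inter> P) \<union> (A \<inter> - P) = A" by auto
  ultimately show ?thesis by (simp add: measure_def emeasure_positive_part[OF \<rho> P A])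
qed

lemma positive_part_le_variation:
  assumes \<mu>: "sigma_additive \<mu>" and h: "bounded_linear h" "\<And>w. \<bar>h w\<bar> \<le> cmod w"
    and A: "A \<in> sets borel"
  shows "emeasure (positive_part (\<lambda>B. h (\<mu> B))) A \<le> emeasure (variation_measure \<mu>) A"
proof -
  note \<rho> = sigma_additive_compose[OF \<mu> h(1)]
  obtain P where P: "P \<in> sets borel"
    "\<And>B. B \<in> sets borel \<Longrightarrow> B \<subseteq> P \<Longrightarrow> 0 \<le> h (\<mu> B)" "\<And>B. B \<in> sets borel \<Longrightarrow> B \<inter> P = {} \<Longrightarrow> h (\<mu> B) \<le> 0"
    using Hahn_decomposition_set[OF \<rho>] by blast
  have "emeasure (positive_part (\<lambda>B. h (\<mu> B))) A = ennreal (h (\<mu> (A \<inter> P)))"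
    by (rule emeasure_positive_part[OF \<rho> P A])
  also have "\<dots> \<le> ennreal (cmod (\<mu> (A \<inter> P)))"
    using h(2)[of "\<mu> (A \<inter> P)"] by (intro ennreal_leI) simp
  also have "\<dots> \<le> variation \<mu> A" using A P(1) by (intro variation_ge sigma_additive_empty \<mu>) auto
  finally show ?thesis by (simp add: emeasure_variation_measure \<mu> A)
qed

text \<open>The four positive measures whose integrals make up \<open>complex_integral\<close>. All
  are dominated by the variation, so that estimates are made once for the whole family.\<close>

definition jordan_parts :: "('g::topological_space set \<Rightarrow> complex) \<Rightarrow> 'g measure set" where
  "jordan_parts \<mu> = (\<lambda>h. positive_part (\<lambda>B. h (\<mu> B))) ` {Re, Im, \<lambda>w. - Re w, \<lambda>w. - Im w}"

lemma jordan_partsD: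
  assumes \<mu>: "sigma_additive \<mu>" and M: "M \<in> jordan_parts \<mu>"
  shows "sets M = sets borel" "space M = UNIV" "finite_measure M"
    "\<And>f. f \<in> borel_measurable borel \<Longrightarrow> (\<integral>\<^sup>+x. f x \<partial>M) \<le> (\<integral>\<^sup>+x. f x \<partial>variation_measure \<mu>)"
proof -
  obtain h where h: "bounded_linear h" "\<And>w. \<bar>h w\<bar> \<le> cmod w" and M: "M = positive_part (\<lambda>B. h (\<mu> B))"
  proof -
    have "bounded_linear h \<and> (\<forall>w. \<bar>h w\<bar> \<le> cmod w)"
      if "h \<in> {Re, Im, \<lambda>w. - Re w, \<lambda>w. - Im w}" for h
      using that bounded_linear_minus[OF bounded_linear_Re] bounded_linear_minus[OF
        bounded_linear_Im]
      by (auto simp: bounded_linear_Re bounded_linear_Im abs_Re_le_cmod abs_Im_le_cmod)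
    then show ?thesis using M that unfolding jordan_parts_def by blast
  qed
  show s: "sets M = sets borel" "space M = UNIV" by (simp_all add: M)
  have le: "emeasure M A \<le> emeasure (variation_measure \<mu>) A" if "A \<in> sets borel" for A
    unfolding M by (rule positive_part_le_variation[OF \<mu> h that])
  interpret V: finite_measure "variation_measure \<mu>" by (rule finite_variation_measure[OF \<mu>])
  show "finite_measure M"
    using le[of UNIV] V.emeasure_finite[of UNIV] by (intro finite_measureI) (auto simp: s
      top_unique)
  fix f :: "'a \<Rightarrow> ennreal" assume "f \<in> borel_measurable borel"
  show "(\<integral>\<^sup>+x. f x \<partial>M) \<le> (\<integral>\<^sup>+x. f x \<partial>variation_measure \<mu>)"
    by (rule nn_integral_mono_measure) (auto simp: s le le_measure)
qed

lemma jordan_parts_integrable: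
  assumes \<mu>: "sigma_additive \<mu>" and M: "M \<in> jordan_parts \<mu>"
    and f: "integrable (variation_measure \<mu>) (f :: _ \<Rightarrow> complex)"
  shows "integrable M f" "(\<integral>x. cmod (f x) \<partial>M) \<le> (\<integral>x. cmod (f x) \<partial>variation_measure \<mu>)"
proof -
  note D = jordan_partsD[OF \<mu> M]
  have fm [measurable]: "f \<in> borel_measurable borel"
    using borel_measurable_integrable[OF f] by (simp cong: measurable_cong_sets)
  have le: "(\<integral>\<^sup>+x. ennreal (cmod (f x)) \<partial>M) \<le> (\<integral>\<^sup>+x. ennreal (cmod (f x)) \<partial>variation_measure \<mu>)"
    by (rule D) measurable
  have fin: "(\<integral>\<^sup>+x. ennreal (cmod (f x)) \<partial>variation_measure \<mu>) < \<infinity>"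
    using f by (simp add: integrable_iff_bounded)
  show i: "integrable M f"
    using le fin fm by (simp add: integrable_iff_bounded D(1) cong: measurable_cong_sets)
  have "ennreal (\<integral>x. cmod (f x) \<partial>M) \<le> ennreal (\<integral>x. cmod (f x) \<partial>variation_measure \<mu>)"
    using le i f by (simp add: nn_integral_eq_integral integrable_norm)
  then show "(\<integral>x. cmod (f x) \<partial>M) \<le> (\<integral>x. cmod (f x) \<partial>variation_measure \<mu>)"
    by simp
qed

lemma complex_integral_eq:
  "complex_integral \<mu> A f =
    ((LINT s:A|positive_part (\<lambda>B. Re (\<mu> B)). f s) - (LINT s:A|positive_part (\<lambda>B. - Re (\<mu> B)). f
      s)) +
    \<i> * ((LINT s:A|positive_part (\<lambda>B. Im (\<mu> B)). f s) - (LINT s:A|positive_part (\<lambda>B. - Im (\<mu> B)).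
      f s))"
  by (simp add: complex_integral_def signed_integral_def)

lemma jordan_partsI:
  "positive_part (\<lambda>B. Re (\<mu> B)) \<in> jordan_parts \<mu>" "positive_part (\<lambda>B. - Re (\<mu> B)) \<in> jordan_parts \<mu>"
  "positive_part (\<lambda>B. Im (\<mu> B)) \<in> jordan_parts \<mu>" "positive_part (\<lambda>B. - Im (\<mu> B)) \<in> jordan_parts \<mu>"
  by (auto simp: jordan_parts_def)

text \<open>Each Jordan part contributes at most the integral against the variation. The factor 4 is
  harmless: the bound serves only for errors that tend to 0.\<close>

lemma complex_integral_bound:
  assumes \<mu>: "sigma_additive \<mu>" and f: "integrable (variation_measure \<mu>) f" and A: "A \<in> sets borel"
  shows "cmod (complex_integral \<mu> A f) \<le> 4 * (\<integral>x. cmod (f x) \<partial>variation_measure \<mu>)"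
proof -
  have *: "cmod (LINT s:A|M. f s) \<le> (\<integral>x. cmod (f x) \<partial>variation_measure \<mu>)" if M: "M
    \<in> jordan_parts \<mu>" for M
  proof -
    note i = jordan_parts_integrable[OF \<mu> M f]
    have "cmod (LINT s:A|M. f s) \<le> (\<integral>x. cmod (indicator A x *\<^sub>R f x) \<partial>M)"
      unfolding set_lebesgue_integral_def by (rule integral_norm_bound)
    also have "\<dots> \<le> (\<integral>x. cmod (f x) \<partial>M)"
      using A i(1) by (intro integral_mono integrable_norm integrable_mult_indicator)
        (auto simp: jordan_partsD[OF \<mu> M] indicator_def)
    finally show ?thesis using i(2) by simp
  qed
  show ?thesis
    unfolding complex_integral_eq
    using *[OF jordan_partsI(1)] *[OF jordan_partsI(2)] *[OF jordan_partsI(3)] *[OF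
      jordan_partsI(4)]
    by (intro order.trans[OF norm_triangle_ineq]) 
       (simp add: norm_mult, smt (verit) norm_triangle_ineq4)
qed

lemma complex_integral_diff:
  assumes \<mu>: "sigma_additive \<mu>" and f: "integrable (variation_measure \<mu>) f"
    and g: "integrable (variation_measure \<mu>) g" and A: "A \<in> sets borel"
  shows "complex_integral \<mu> A (\<lambda>s. f s - g s) = complex_integral \<mu> A f - complex_integral \<mu> A g"
proof -
  have *: "(LINT s:A|M. f s - g s) = (LINT s:A|M. f s) - (LINT s:A|M. g s)" if M: "M
    \<in> jordan_parts \<mu>" for M
    using A jordan_parts_integrable(1)[OF \<mu> M f] jordan_parts_integrable(1)[OF \<mu> M g]
    by (intro set_integral_diff) (auto simp: set_integrable_def jordan_partsD[OF \<mu> M] intro!: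
      integrable_mult_indicator)
  show ?thesis
    unfolding complex_integral_eq by (simp add: * jordan_partsI algebra_simps)
qed

section \<open>Integrals of simple functions\<close>

lemma set_integral_simple:
  fixes \<phi> :: "'a::topological_space \<Rightarrow> complex"
  assumes "finite_measure M" "sets M = sets borel" "space M = UNIV"
    and \<phi>: "simple_function borel \<phi>" and A: "A \<in> sets borel"
  shows "(LINT s:A|M. \<phi> s) = (\<Sum>c\<in>range \<phi>. c * of_real (measure M (A \<inter> \<phi> -` {c})))"
proof -
  interpret finite_measure M by fact
  have fin: "finite (range \<phi>)" using simple_functionD(1)[OF \<phi>] by simp
  have m: "A \<inter> \<phi> -` {c} \<in> sets M" for c using simple_functionD(2)[OF \<phi>, of "{c}"] A assms(2) by auto
  have "(LINT s:A|M. \<phi> s) = (\<integral>s. (\<Sum>c\<in>range \<phi>. indicator (A \<inter> \<phi> -` {c}) s *\<^sub>R c) \<partial>M)"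
    unfolding set_lebesgue_integral_def
  proof (rule Bochner_Integration.integral_cong[OF refl])
    fix s
    have "(\<Sum>c\<in>range \<phi>. indicator (A \<inter> \<phi> -` {c}) s *\<^sub>R c) = (\<Sum>c\<in>{\<phi> s}. indicator A s *\<^sub>R c)"
      using fin by (intro sum.mono_neutral_cong_right) (auto simp: indicator_def)
    then show "indicator A s *\<^sub>R \<phi> s = (\<Sum>c\<in>range \<phi>. indicator (A \<inter> \<phi> -` {c}) s *\<^sub>R c)"
      by (cases "s \<in> A") simp_all
  qed
  also have "\<dots> = (\<Sum>c\<in>range \<phi>. \<integral>s. indicator (A \<inter> \<phi> -` {c}) s *\<^sub>R c \<partial>M)"
    using m by (intro Bochner_Integration.integral_sum) (auto intro!: integrable_scaleR_left
      integrable_real_indicator simp: emeasure_finite less_top[symmetric])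
  also have "\<dots> = (\<Sum>c\<in>range \<phi>. c * of_real (measure M (A \<inter> \<phi> -` {c})))"
    using m by (intro sum.cong refl) (simp add: assms(3) scaleR_conv_of_real mult.commute)
  finally show ?thesis .
qed

lemma complex_integral_simple:
  assumes \<mu>: "sigma_additive \<mu>" and \<phi>: "simple_function borel \<phi>" and A: "A \<in> sets borel"
  shows "complex_integral \<mu> A \<phi> = (\<Sum>c\<in>range \<phi>. c * \<mu> (A \<inter> \<phi> -` {c}))"
proof -
  have m: "A \<inter> \<phi> -` {c} \<in> sets borel" for c using simple_functionD(2)[OF \<phi>, of "{c}"] A by auto
  have *: "(LINT s:A|M. \<phi> s) = (\<Sum>c\<in>range \<phi>. c * of_real (measure M (A \<inter> \<phi> -` {c})))" if M: "M
    \<in> jordan_parts \<mu>" for M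
    using jordan_partsD[OF \<mu> M] \<phi> A by (intro set_integral_simple)
  have re: "of_real (Re (\<mu> B)) = complex_of_real (measure (positive_part (\<lambda>B. Re (\<mu> B))) B) -
    of_real (measure (positive_part (\<lambda>B. - Re (\<mu> B))) B)"
    if "B \<in> sets borel" for B
    using measure_positive_part_diff[OF sigma_additive_compose[OF \<mu> bounded_linear_Re] that]
    by (simp flip: of_real_diff)
  have im: "of_real (Im (\<mu> B)) = complex_of_real (measure (positive_part (\<lambda>B. Im (\<mu> B))) B) -
    of_real (measure (positive_part (\<lambda>B. - Im (\<mu> B))) B)"
    if "B \<in> sets borel" for B
    using measure_positive_part_diff[OF sigma_additive_compose[OF \<mu> bounded_linear_Im] that]
    by (simp flip: of_real_diff)
  have "(\<Sum>c\<in>range \<phi>. c * \<mu> (A \<inter> \<phi> -` {c})) =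
      (\<Sum>c\<in>range \<phi>. c * (of_real (Re (\<mu> (A \<inter> \<phi> -` {c}))) + \<i> * of_real (Im (\<mu> (A \<inter> \<phi> -` {c})))))"
    using complex_eq by simp
  also have "\<dots> = complex_integral \<mu> A \<phi>"
    unfolding complex_integral_eq
    by (simp add: * jordan_partsI re[OF m] im[OF m] sum_subtractf sum.distrib sum_distrib_left
      algebra_simps)
  finally show ?thesis by simp
qed


section \<open>Tonelli theorem for inner regular measures\<close>

text \<open>Approximation from within by compact sets, stated through strict lower bounds
  \<open>c\<close> because these persist on neighbouring slices.\<close>

definition inner_regular :: "'a::topological_space measure \<Rightarrow> bool" where
  "inner_regular M \<longleftrightarrow> sets M = sets borel \<and> finite_measure M \<and>
     (\<forall>A\<in>sets borel. \<forall>c<emeasure M A. \<exists>K. compact K \<and> K \<subseteq> A \<and> c < emeasure M K)"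

lemma inner_regularD:
  assumes "inner_regular M"
  shows "sets M = sets borel" "space M = UNIV" "finite_measure M"
    "A \<in> sets borel \<Longrightarrow> c < emeasure M A \<Longrightarrow> \<exists>K. compact K \<and> K \<subseteq> A \<and> c < emeasure M K"
  using assms sets_eq_imp_space_eq[of M borel] by (auto simp: inner_regular_def)

lemma open_Pair_vimage: "open W \<Longrightarrow> open (Pair t -` W)"
  by (rule open_vimage) (auto intro: continuous_intros)

text \<open>The tube lemma thickens {t} x K, with \<open>K\<close> compact in the slice, to a
  rectangle inside \<open>W\<close>.\<close>

lemma inner_regular_open_slice:
  assumes "inner_regular \<mu>" "open W" "c < emeasure \<mu> (Pair t -` W)"
  obtains K N where "compact K" "c < emeasure \<mu> K" "open N" "t \<in> N" "N \<times> K \<subseteq> W"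
proof -
  have "Pair t -` W \<in> sets borel" using open_Pair_vimage[OF assms(2)] by simp
  from inner_regularD(4)[OF assms(1) this assms(3)]
  obtain K where K: "compact K" "K \<subseteq> Pair t -` W" "c < emeasure \<mu> K" by metis
  then have "{t} \<times> K \<subseteq> W" by auto
  from Elementary_Topology.tube_lemma[OF K(1) assms(2) this] show ?thesis using that K by metis
qed

text \<open>Lower semicontinuity of slice measures: a rectangle from the tube lemma keeps the
  measure above \<open>c\<close> for all nearby \<open>t\<close>. This gives Borel measurability
  without a product \<sigma>-algebra.\<close>

lemma open_greater_slice:
  assumes \<mu>: "inner_regular \<mu>" and W: "open W"
  shows "open {t. c < emeasure \<mu> (Pair t -` W)}"
proof (subst open_subopen, rule ballI)
  fix t assume "t \<in> {t. c < emeasure \<mu> (Pair t -` W)}"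
  then have "c < emeasure \<mu> (Pair t -` W)" by simp
  then obtain K N where K: "compact K" "c < emeasure \<mu> K" and N: "t \<in> N" "open N" "N \<times> K \<subseteq> W"
    using inner_regular_open_slice[OF \<mu> W] by metis
  have "c < emeasure \<mu> (Pair t' -` W)" if "t' \<in> N" for t'
  proof -
    have "emeasure \<mu> K \<le> emeasure \<mu> (Pair t' -` W)"
      using N that open_Pair_vimage[OF W]
      by (intro emeasure_mono) (auto simp: inner_regularD[OF \<mu>])
    then show ?thesis using K(2) by simp
  qed
  then show "\<exists>T. open T \<and> t \<in> T \<and> T \<subseteq> {t. c < emeasure \<mu> (Pair t -` W)}" using N by blast
qed

lemma borel_measurable_slice_open:
  assumes "inner_regular \<mu>" "open W"
  shows "(\<lambda>t. emeasure \<mu> (Pair t -` W)) \<in> borel_measurable borel"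
  by (intro borel_measurableI_greater) (use open_greater_slice[OF assms] in simp)

text \<open>
  Borel sets of a product need not belong to the product \<open>\<sigma>\<close>-algebra. An open set \<open>W\<close>, however,
  contains a set \<open>R\<close> of maximal measure in the product \<open>\<sigma>\<close>-algebra, and almost all slices of \<open>R\<close>
  have the measure of the slices of \<open>W\<close>: otherwise compactness would provide a finite union of
  rectangles in \<open>W\<close> that enlarges \<open>R\<close>.
\<close>

lemma Tonelli_open_le:
  assumes \<kappa>: "inner_regular \<kappa>" and \<mu>: "inner_regular \<mu>" and W: "open W"
  shows "(\<integral>\<^sup>+t. emeasure \<mu> (Pair t -` W) \<partial>\<kappa>) \<le> (\<integral>\<^sup>+s. emeasure \<kappa> ((\<lambda>t. (t, s)) -` W) \<partial>\<mu>)"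
proof -
  note sl = inner_regularD(1,2)[OF \<kappa>] and sm = inner_regularD(1,2)[OF \<mu>]
  interpret L: finite_measure \<kappa> by (rule inner_regularD(3)[OF \<kappa>])
  interpret M: finite_measure \<mu> by (rule inner_regularD(3)[OF \<mu>])
  interpret pair_sigma_finite \<kappa> \<mu> ..
  interpret P: finite_measure "\<kappa> \<Otimes>\<^sub>M \<mu>" by (rule finite_measure_pair_measure) unfold_locales
  let ?E = "emeasure (\<kappa> \<Otimes>\<^sub>M \<mu>)"
  define \<R> where "\<R> = {R \<in> sets (\<kappa> \<Otimes>\<^sub>M \<mu>). R \<subseteq> W}"
  have "{} \<in> \<R>" by (simp add: \<R>_def)
  then have "\<exists>f::nat \<Rightarrow> ennreal. range f \<subseteq> ?E ` \<R> \<and> Sup (?E ` \<R>) = Sup (range f)"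
    by (intro ennreal_SUP_countable_SUP) auto
  then obtain f :: "nat \<Rightarrow> ennreal" where f: "range f \<subseteq> ?E ` \<R>" "Sup (?E ` \<R>) = Sup (range f)"
    by blast
  then have "\<forall>n. \<exists>R\<in>\<R>. f n = ?E R" by blast
  then obtain Q where Q: "\<And>n. Q n \<in> \<R>" "\<And>n. f n = ?E (Q n)" by metis
  define R where "R = (\<Union>n. Q n)"
  have R: "R \<in> sets (\<kappa> \<Otimes>\<^sub>M \<mu>)" "R \<subseteq> W" using Q(1) by (auto simp: R_def \<R>_def)
  have max: "?E R' \<le> ?E R" if "R' \<in> sets (\<kappa> \<Otimes>\<^sub>M \<mu>)" "R' \<subseteq> W" for R'
  proof -
    have "?E R' \<le> Sup (?E ` \<R>)" using that by (intro SUP_upper) (auto simp: \<R>_def)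
    also have "\<dots> = Sup (range f)" by (rule f)
    also have "\<dots> \<le> ?E R"
      using R by (auto intro!: SUP_least emeasure_mono simp: Q(2)) (auto simp: R_def)
    finally show ?thesis .
  qed
  define g where "g t = emeasure \<mu> (Pair t -` R)" for t
  define h where "h t = emeasure \<mu> (Pair t -` W)" for t
  have hm [measurable]: "h \<in> borel_measurable \<kappa>"
    using borel_measurable_slice_open[OF \<mu> W] by (simp add: h_def[abs_def] sl cong:
      measurable_cong_sets)
  have gm [measurable]: "g \<in> borel_measurable \<kappa>"
    unfolding g_def[abs_def] by (rule measurable_emeasure_Pair1[OF R(1)])
  \<comment> \<open>Each \<open>q\<close> separates a slice of \<open>R\<close> from the larger
    slice of \<open>W\<close> for almost no \<open>t\<close>; rational \<open>q\<close> detect every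
    strict inequality between the two.\<close>
  have null: "emeasure \<kappa> {t. g t \<le> ennreal q \<and> ennreal q < h t} = 0" for q :: real
  proof (rule ccontr)
    let ?B = "{t. g t \<le> ennreal q \<and> ennreal q < h t}"
    have B: "?B \<in> sets borel"
    proof -
      have "{t \<in> space \<kappa>. g t \<le> ennreal q \<and> ennreal q < h t} \<in> sets \<kappa>" by measurable
      then show ?thesis by (simp add: sl)
    qed
    assume "emeasure \<kappa> ?B \<noteq> 0"
    then obtain C where C: "compact C" "C \<subseteq> ?B" "0 < emeasure \<kappa> C"
      using inner_regularD(4)[OF \<kappa> B, of 0] by (auto simp: zero_less_iff_neq_zero)
    \<comment> \<open>\<open>emeasure\<close> is 0 outside the \<sigma>-algebra by convention, so
      positive measure proves measurability. In a general topological space a compact set need not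
      be closed.\<close>
    have Cs: "C \<in> sets \<kappa>" using C(3) emeasure_notin_sets by fastforce
    have "\<forall>t\<in>C. \<exists>K N. open N \<and> t \<in> N \<and> K \<in> sets \<mu> \<and> N \<times> K \<subseteq> W \<and> ennreal q < emeasure \<mu> K"
    proof
      fix t assume t: "t \<in> C"
      then have "ennreal q < emeasure \<mu> (Pair t -` W)" using C(2) by (auto simp: h_def)
      then obtain K N where K: "ennreal q < emeasure \<mu> K" and N: "t \<in> N" "open N" "N \<times> K \<subseteq> W"
        using inner_regular_open_slice[OF \<mu> W] by metis
      moreover have "K \<in> sets \<mu>" using K emeasure_notin_sets by fastforce
      ultimately show "\<exists>K N. open N \<and> t \<in> N \<and> K \<in> sets \<mu> \<and> N \<times> K \<subseteq> W \<and> ennreal q < emeasure \<mu> K"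
        using K by (intro exI[of _ K] exI[of _ N]) simp
    qed
    then obtain K N where KN: "\<And>t. t \<in> C \<Longrightarrow> open (N t) \<and> t \<in> N t \<and> K t \<in> sets \<mu> \<and> N t \<times> K t \<subseteq> W
      \<and> ennreal q < emeasure \<mu> (K t)"
      by metis
    obtain D where D: "D \<subseteq> C" "finite D" "C \<subseteq> (\<Union>t\<in>D. N t)"
      using compactE_image[OF C(1), of C N] KN by blast
    define R' where "R' = (\<Union>t\<in>D. N t \<times> K t)"
    have R': "R' \<in> sets (\<kappa> \<Otimes>\<^sub>M \<mu>)" "R' \<subseteq> W"
      unfolding R'_def using D KN by (auto intro!: sets.finite_UN pair_measureI simp: sl) blast
    have big: "ennreal q < emeasure \<mu> (Pair t -` (R \<union> R'))" if t: "t \<in> C" for t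
    proof -
      obtain d where d: "d \<in> D" "t \<in> N d" using D t by blast
      have "ennreal q < emeasure \<mu> (K d)" using KN d D by blast
      also have "\<dots> \<le> emeasure \<mu> (Pair t -` (R \<union> R'))"
        using d by (intro emeasure_mono sets_Pair1[of _ \<kappa>] sets.Un R R') (auto simp: R'_def)
      finally show ?thesis .
    qed
    have RR: "R \<union> R' \<in> sets (\<kappa> \<Otimes>\<^sub>M \<mu>)" using R R' by blast
    \<comment> \<open>Maximality of \<open>R\<close> makes the part of \<open>R'\<close> outside
      \<open>R\<close> null. For almost all \<open>t\<close> the slice of the union then has measure
      at most \<open>g t\<close>; on \<open>C\<close>, where \<open>g t \<le> q\<close>, this
      contradicts \<open>big\<close>, so that \<open>C\<close> would be null.\<close>
    have "?E (R' - R) = 0"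
    proof -
      have "?E R + ?E (R' - R) = ?E (R \<union> (R' - R))"
        using R R' by (intro plus_emeasure) auto
      also have "\<dots> \<le> ?E R" using max[OF RR] R R' by simp
      finally show ?thesis using P.emeasure_finite[of R]
        ennreal_add_left_cancel_le[of "?E R" "?E (R' - R)" 0]
        by (simp add: less_top[symmetric])
    qed
    then have "AE t in \<kappa>. emeasure \<mu> (Pair t -` (R' - R)) = 0"
      using R R' by (simp add: M.emeasure_pair_measure_alt nn_integral_0_iff_AE
        measurable_emeasure_Pair1)
    then have "AE t in \<kappa>. t \<notin> C"
    proof eventually_elim
      fix t assume z: "emeasure \<mu> (Pair t -` (R' - R)) = 0"
      have "emeasure \<mu> (Pair t -` (R \<union> R')) \<le> emeasure \<mu> (Pair t -` R) + emeasure \<mu> (Pair t -` (R'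
        - R))"
        using sets_Pair1[OF R(1)] sets_Pair1[of "R' - R" \<kappa> \<mu> t] R R'
        by (subst plus_emeasure) (auto intro!: emeasure_mono)
      then have "emeasure \<mu> (Pair t -` (R \<union> R')) \<le> g t" by (simp add: z g_def)
      then show "t \<notin> C" using big[of t] C(2) by fastforce
    qed
    then have "emeasure \<kappa> C = 0" using Cs
      by (subst (asm) AE_iff_measurable[of C]) (auto simp: sl)
    then show False using C(3) by simp
  qed
  have "AE t in \<kappa>. \<forall>q\<in>\<rat>. \<not> (g t \<le> ennreal q \<and> ennreal q < h t)"
  proof (subst AE_ball_countable[OF countable_rat], intro ballI)
    fix q :: real
    have "{t \<in> space \<kappa>. g t \<le> ennreal q \<and> ennreal q < h t} \<in> sets \<kappa>" by measurable
    then show "AE t in \<kappa>. \<not> (g t \<le> ennreal q \<and> ennreal q < h t)"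
      by (subst AE_iff_measurable[OF _ refl]) (auto simp: sl null)
  qed
  then have "AE t in \<kappa>. h t \<le> g t"
  proof eventually_elim
    fix t assume q: "\<forall>q\<in>\<rat>. \<not> (g t \<le> ennreal q \<and> ennreal q < h t)"
    show "h t \<le> g t"
    proof (rule ccontr)
      assume "\<not> h t \<le> g t"
      moreover have "g t = ennreal (measure \<mu> (Pair t -` R))" "h t
        = ennreal (measure \<mu> (Pair t -` W))"
        by (simp_all add: g_def h_def M.emeasure_eq_measure)
      ultimately have "measure \<mu> (Pair t -` R) < measure \<mu> (Pair t -` W)" by (simp add: not_le
        ennreal_less_iff)
      then obtain q where "q \<in> \<rat>" "measure \<mu> (Pair t -` R) < q" "q < measure \<mu> (Pair t -` W)"
        using Rats_dense_in_real by blast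
      moreover from this have "0 \<le> q" using measure_nonneg[of \<mu> "Pair t -` R"] by linarith
      ultimately show False
        using q by (auto simp: g_def h_def M.emeasure_eq_measure ennreal_less_iff dest!: bspec[of
          _ _ q])
    qed
  qed
  then have "(\<integral>\<^sup>+t. h t \<partial>\<kappa>) \<le> (\<integral>\<^sup>+t. g t \<partial>\<kappa>)" by (rule nn_integral_mono_AE)
  \<comment> \<open>\<open>R\<close> belongs to the product \<sigma>-algebra, where the order of
    integration may be exchanged.\<close>
  also have "\<dots> = ?E R" unfolding g_def by (rule M.emeasure_pair_measure_alt[OF R(1), symmetric])
  also have "\<dots> = (\<integral>\<^sup>+s. emeasure \<kappa> ((\<lambda>t. (t, s)) -` R) \<partial>\<mu>)" by (rule emeasure_pair_measure_alt2[OF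
    R(1)])
  also have "\<dots> \<le> (\<integral>\<^sup>+s. emeasure \<kappa> ((\<lambda>t. (t, s)) -` W) \<partial>\<mu>)"
  proof (intro nn_integral_mono emeasure_mono)
    fix s
    have "open ((\<lambda>t. (t, s)) -` W)" by (rule open_vimage[OF W]) (auto intro: continuous_intros)
    then show "(\<lambda>t. (t, s)) -` W \<in> sets \<kappa>" by (simp add: sl)
  qed (use R in auto)
  finally show ?thesis by (simp add: h_def)
qed

text \<open>Exchanging the coordinates turns the one-sided estimate into its converse.\<close>

lemma Tonelli_open:
  assumes \<kappa>: "inner_regular \<kappa>" and \<mu>: "inner_regular \<mu>" and W: "open W"
  shows "(\<integral>\<^sup>+t. emeasure \<mu> (Pair t -` W) \<partial>\<kappa>) = (\<integral>\<^sup>+s. emeasure \<kappa> ((\<lambda>t. (t, s)) -` W) \<partial>\<mu>)"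
proof (rule antisym)
  let ?W = "(\<lambda>(s, t). (t, s)) -` W"
  have "open ?W" by (rule open_vimage[OF W]) (auto simp: case_prod_unfold intro!: continuous_intros)
  from Tonelli_open_le[OF \<mu> \<kappa> this]
  show "(\<integral>\<^sup>+s. emeasure \<kappa> ((\<lambda>t. (t, s)) -` W) \<partial>\<mu>) \<le> (\<integral>\<^sup>+t. emeasure \<mu> (Pair t -` W) \<partial>\<kappa>)"
    by (simp add: vimage_def)
qed (rule Tonelli_open_le[OF assms])

section \<open>From open sets to Borel functions of a continuous map\<close>

lemma continuous_slices:
  assumes "continuous_on UNIV (\<lambda>(t, s). \<phi> t s)"
  shows "continuous_on UNIV (\<phi> t)" "continuous_on UNIV (\<lambda>t. \<phi> t s)" "continuous_on UNIV (\<lambda>(s, t).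
    \<phi> t s)"
proof -
  show "continuous_on UNIV (\<phi> t)"
    using continuous_on_compose2[OF assms, of UNIV "\<lambda>s. (t, s)"] by (simp add: continuous_on_Pair
      continuous_on_id)
  show "continuous_on UNIV (\<lambda>t. \<phi> t s)"
    using continuous_on_compose2[OF assms, of UNIV "\<lambda>t. (t, s)"] by (simp add: continuous_on_Pair
      continuous_on_id)
  show "continuous_on UNIV (\<lambda>(s, t). \<phi> t s)"
    using continuous_on_compose2[OF assms, of UNIV "\<lambda>x. (snd x, fst x)"]
    by (simp add: case_prod_unfold continuous_on_Pair continuous_on_fst continuous_on_snd
      continuous_on_id)
qed

text \<open>The Dynkin argument runs over subsets of the target of \<open>\<phi>\<close>, whose open
  sets are a generator closed under intersection; general Borel subsets of the product are never
  met. Finiteness of both measures takes care of complements.\<close>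

lemma Tonelli_continuous_set:
  fixes \<phi> :: "'a::topological_space \<Rightarrow> 'b::topological_space \<Rightarrow> 'c::topological_space"
  assumes \<kappa>: "inner_regular \<kappa>" and \<mu>: "inner_regular \<mu>"
    and \<phi>: "continuous_on UNIV (\<lambda>(t, s). \<phi> t s)" and A: "A \<in> sets borel"
  shows "(\<lambda>t. emeasure \<mu> (\<phi> t -` A)) \<in> borel_measurable borel \<and>
    (\<lambda>s. emeasure \<kappa> ((\<lambda>t. \<phi> t s) -` A)) \<in> borel_measurable borel \<and>
    (\<integral>\<^sup>+t. emeasure \<mu> (\<phi> t -` A) \<partial>\<kappa>) = (\<integral>\<^sup>+s. emeasure \<kappa> ((\<lambda>t. \<phi> t s) -` A) \<partial>\<mu>)"
proof -
  note sl = inner_regularD(1,2)[OF \<kappa>] and sm = inner_regularD(1,2)[OF \<mu>]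
  interpret L: finite_measure \<kappa> by (rule inner_regularD(3)[OF \<kappa>])
  interpret M: finite_measure \<mu> by (rule inner_regularD(3)[OF \<mu>])
  have m1: "\<phi> t -` A \<in> sets \<mu>" and m2: "(\<lambda>t. \<phi> t s) -` A \<in> sets \<kappa>" if "A \<in> sets borel" for A t s
    using measurable_sets[OF borel_measurable_continuous_onI[OF continuous_slices(1)[OF \<phi>, of t]]
      that]
      measurable_sets[OF borel_measurable_continuous_onI[OF continuous_slices(2)[OF \<phi>, of s]] that]
    by (auto simp: sl sm)
  have A': "A \<in> sigma_sets UNIV {S. open S}" using A by (simp add: borel_def)
  have sets_eq: "sigma_sets UNIV {S. open S} = sets (borel :: 'c measure)" by (simp add: borel_def)
  have "Int_stable {S::'c set. open S}" "{S::'c set. open S} \<subseteq> Pow UNIV" by (auto simp: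
    Int_stable_def)
  then show ?thesis using A'
  proof (induction rule: sigma_sets_induct_disjoint)
    case (basic S)
    then have S: "open S" by simp
    define W where "W = (\<lambda>(t, s). \<phi> t s) -` S"
    have W: "open W" unfolding W_def by (rule open_vimage[OF S \<phi>])
    have W': "open ((\<lambda>(s, t). (t, s)) -` W)"
      by (rule open_vimage[OF W]) (auto simp: case_prod_unfold intro!: continuous_intros)
    have "Pair t -` W = \<phi> t -` S" "(\<lambda>t. (t, s)) -` W = (\<lambda>t. \<phi> t s) -` S"
      "Pair s -` ((\<lambda>(s, t). (t, s)) -` W) = (\<lambda>t. \<phi> t s) -` S" for t s
      by (auto simp: W_def)
    then show ?case
      using Tonelli_open[OF \<kappa> \<mu> W] borel_measurable_slice_open[OF \<mu> W]
        borel_measurable_slice_open[OF \<kappa> W']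
      by simp
  next
    case empty show ?case by simp
  next
    case (compl A)
    then have A: "A \<in> sets borel" by (simp add: sets_eq)
    note [measurable] = compl.IH[THEN conjunct1] compl.IH[THEN conjunct2, THEN conjunct1]
    have 1: "emeasure \<mu> (\<phi> t -` (UNIV - A)) = emeasure \<mu> UNIV - emeasure \<mu> (\<phi> t -` A)" for t
      using emeasure_compl[of "\<phi> t -` A" \<mu>] m1[OF A, of t] by (simp add: vimage_Diff sm)
    have 2: "emeasure \<kappa> ((\<lambda>t. \<phi> t s) -` (UNIV - A)) = emeasure \<kappa> UNIV - emeasure \<kappa> ((\<lambda>t. \<phi> t s) -`
      A)" for s
      using emeasure_compl[of "(\<lambda>t. \<phi> t s) -` A" \<kappa>] m2[OF A, of s] by (simp add: vimage_Diff sl)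
    have fin: "(\<integral>\<^sup>+t. emeasure \<mu> (\<phi> t -` A) \<partial>\<kappa>) \<noteq> \<infinity>"
    proof -
      have "(\<integral>\<^sup>+t. emeasure \<mu> (\<phi> t -` A) \<partial>\<kappa>) \<le> (\<integral>\<^sup>+t. emeasure \<mu> UNIV \<partial>\<kappa>)"
        by (intro nn_integral_mono emeasure_mono) (auto simp: sm)
      also have "\<dots> < \<infinity>" using L.emeasure_finite[of UNIV] M.emeasure_finite[of UNIV]
        by (auto simp: sl ennreal_mult_eq_top_iff less_top[symmetric])
      finally show ?thesis by simp
    qed
    have "(\<integral>\<^sup>+t. emeasure \<mu> UNIV - emeasure \<mu> (\<phi> t -` A) \<partial>\<kappa>)
      = (\<integral>\<^sup>+t. emeasure \<mu> UNIV \<partial>\<kappa>) - (\<integral>\<^sup>+t. emeasure \<mu> (\<phi> t -` A) \<partial>\<kappa>)"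
      using fin by (intro nn_integral_diff) (auto simp: sl sm cong: measurable_cong_sets intro!:
        emeasure_mono)
    moreover have "(\<integral>\<^sup>+s. emeasure \<kappa> UNIV - emeasure \<kappa> ((\<lambda>t. \<phi> t s) -` A) \<partial>\<mu>)
      = (\<integral>\<^sup>+s. emeasure \<kappa> UNIV \<partial>\<mu>) - (\<integral>\<^sup>+s. emeasure \<kappa> ((\<lambda>t. \<phi> t s) -` A) \<partial>\<mu>)"
      using fin compl.IH by (intro nn_integral_diff) (auto simp: sl sm cong: measurable_cong_sets
        intro!: emeasure_mono)
    ultimately show ?case using compl.IH unfolding 1 2
      by (auto simp: sl sm mult.commute)
  next
    case (union A)
    then have A: "A i \<in> sets borel" for i by (auto simp: sets_eq)
    have d: "disjoint_family (\<lambda>i. \<psi> -` A i)" for \<psi> :: "'d \<Rightarrow> 'c"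
      using union.hyps(1) by (auto simp: disjoint_family_on_def)
    have 1: "emeasure \<mu> (\<phi> t -` (\<Union>i. A i)) = (\<Sum>i. emeasure \<mu> (\<phi> t -` A i))" for t
      unfolding vimage_UN using m1[OF A] by (intro suminf_emeasure[symmetric] d) auto
    have 2: "emeasure \<kappa> ((\<lambda>t. \<phi> t s) -` (\<Union>i. A i)) = (\<Sum>i. emeasure \<kappa> ((\<lambda>t. \<phi> t s) -` A i))" for s
      unfolding vimage_UN using m2[OF A] by (intro suminf_emeasure[symmetric] d) auto
    note m = union.IH[THEN conjunct1] union.IH[THEN conjunct2, THEN conjunct1]
    note [measurable] = m
    have "(\<integral>\<^sup>+t. (\<Sum>i. emeasure \<mu> (\<phi> t -` A i)) \<partial>\<kappa>) = (\<Sum>i. \<integral>\<^sup>+t. emeasure \<mu> (\<phi> t -` A i) \<partial>\<kappa>)"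
      using m by (intro nn_integral_suminf) (simp add: sl cong: measurable_cong_sets)
    moreover have "(\<integral>\<^sup>+s. (\<Sum>i. emeasure \<kappa> ((\<lambda>t. \<phi> t s) -` A i)) \<partial>\<mu>)
      = (\<Sum>i. \<integral>\<^sup>+s. emeasure \<kappa> ((\<lambda>t. \<phi> t s) -` A i) \<partial>\<mu>)"
      using m by (intro nn_integral_suminf) (simp add: sm cong: measurable_cong_sets)
    ultimately show ?case unfolding 1 2 using union.IH by simp
  qed
qed

text \<open>Measurability of both inner integrals is part of the claim because the induction over
  \<open>F\<close> has to integrate them.\<close>

proposition Tonelli_continuous:
  fixes \<phi> :: "'a::topological_space \<Rightarrow> 'b::topological_space \<Rightarrow> 'c::topological_space"
    and F :: "'c \<Rightarrow> ennreal"
  assumes \<kappa>: "inner_regular \<kappa>" and \<mu>: "inner_regular \<mu>"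
    and \<phi>: "continuous_on UNIV (\<lambda>(t, s). \<phi> t s)" and F: "F \<in> borel_measurable borel"
  shows "(\<lambda>t. \<integral>\<^sup>+s. F (\<phi> t s) \<partial>\<mu>) \<in> borel_measurable borel \<and>
    (\<lambda>s. \<integral>\<^sup>+t. F (\<phi> t s) \<partial>\<kappa>) \<in> borel_measurable borel \<and>
    (\<integral>\<^sup>+t. \<integral>\<^sup>+s. F (\<phi> t s) \<partial>\<mu> \<partial>\<kappa>) = (\<integral>\<^sup>+s. \<integral>\<^sup>+t. F (\<phi> t s) \<partial>\<kappa> \<partial>\<mu>)"
proof -
  note sl = inner_regularD(1,2)[OF \<kappa>] and sm = inner_regularD(1,2)[OF \<mu>]
  have [measurable]: "\<phi> t \<in> measurable \<mu> borel" "(\<lambda>t. \<phi> t s) \<in> measurable \<kappa> borel" for t s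
    using borel_measurable_continuous_onI[OF continuous_slices(1)[OF \<phi>, of t]]
      borel_measurable_continuous_onI[OF continuous_slices(2)[OF \<phi>, of s]]
    by (simp_all add: sl sm cong: measurable_cong_sets)
  have ml: "f \<in> borel_measurable borel \<Longrightarrow> f \<in> borel_measurable \<kappa>" for f :: "'a \<Rightarrow> ennreal"
    by (simp add: sl cong: measurable_cong_sets)
  have mm: "f \<in> borel_measurable borel \<Longrightarrow> f \<in> borel_measurable \<mu>" for f :: "'b \<Rightarrow> ennreal"
    by (simp add: sm cong: measurable_cong_sets)
  show ?thesis using F
  proof (induction rule: borel_measurable_induct)
    case (cong f g)
    then have "f = g" by auto
    then show ?case using cong by simp
  next
    case (set A)
    have sets: "\<phi> t -` A \<in> sets \<mu>" "(\<lambda>t. \<phi> t s) -` A \<in> sets \<kappa>" for t s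
      using measurable_sets[of "\<phi> t" \<mu> borel A] measurable_sets[of "\<lambda>t. \<phi> t s" \<kappa> borel A] set
      by (auto simp: sl sm)
    have "(\<integral>\<^sup>+s. indicator A (\<phi> t s) \<partial>\<mu>) = emeasure \<mu> (\<phi> t -` A)" for t
      unfolding nn_integral_indicator[OF sets(1), symmetric] by (intro nn_integral_cong) (simp
        add: indicator_def)
    moreover have "(\<integral>\<^sup>+t. indicator A (\<phi> t s) \<partial>\<kappa>) = emeasure \<kappa> ((\<lambda>t. \<phi> t s) -` A)" for s
      unfolding nn_integral_indicator[OF sets(2), symmetric] by (intro nn_integral_cong) (simp
        add: indicator_def)
    ultimately show ?case using Tonelli_continuous_set[OF \<kappa> \<mu> \<phi> set] by simp
  next
    case (mult u c)
    note [measurable] = mult.hyps(2)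
    note IH = mult.IH[THEN conjunct1] mult.IH[THEN conjunct2, THEN conjunct1] mult.IH[THEN
      conjunct2, THEN conjunct2]
    show ?case using IH(1,2) IH(3) ml[OF IH(1)] mm[OF IH(2)] by (simp add: nn_integral_cmult)
  next
    case (add u v)
    note [measurable] = add.hyps(1,3)
    note IH = add.IH(1)[THEN conjunct1] add.IH(1)[THEN conjunct2, THEN conjunct1] add.IH(1)[THEN
      conjunct2, THEN conjunct2]
      add.IH(2)[THEN conjunct1] add.IH(2)[THEN conjunct2, THEN conjunct1] add.IH(2)[THEN
        conjunct2, THEN conjunct2]
    show ?case using IH ml[OF IH(1)] mm[OF IH(2)] ml[OF IH(4)] mm[OF IH(5)] by (simp add:
      nn_integral_add)
  next
    case (seq U)
    note [measurable] = seq.hyps(1)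
    note IH = seq.IH[THEN conjunct1] seq.IH[THEN conjunct2, THEN conjunct1] seq.IH[THEN conjunct2,
      THEN conjunct2]
    have inc: "incseq (\<lambda>i x. U i (\<psi> x))" for \<psi> :: "'d \<Rightarrow> 'c"
      using seq.hyps(3) by (auto simp: incseq_def le_fun_def)
    have 1: "(\<integral>\<^sup>+s. (SUP i. U i) (\<phi> t s) \<partial>\<mu>) = (SUP i. \<integral>\<^sup>+s. U i (\<phi> t s) \<partial>\<mu>)" for t
      unfolding SUP_apply by (intro nn_integral_monotone_convergence_SUP inc) measurable
    have 2: "(\<integral>\<^sup>+t. (SUP i. U i) (\<phi> t s) \<partial>\<kappa>) = (SUP i. \<integral>\<^sup>+t. U i (\<phi> t s) \<partial>\<kappa>)" for s
      unfolding SUP_apply by (intro nn_integral_monotone_convergence_SUP inc) measurable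
    have inc1: "incseq (\<lambda>i t. \<integral>\<^sup>+s. U i (\<phi> t s) \<partial>\<mu>)"
      using seq.hyps(3) by (auto simp: incseq_def le_fun_def intro!: nn_integral_mono)
    have inc2: "incseq (\<lambda>i s. \<integral>\<^sup>+t. U i (\<phi> t s) \<partial>\<kappa>)"
      using seq.hyps(3) by (auto simp: incseq_def le_fun_def intro!: nn_integral_mono)
    have "(\<integral>\<^sup>+t. (SUP i. \<integral>\<^sup>+s. U i (\<phi> t s) \<partial>\<mu>) \<partial>\<kappa>) = (SUP i. \<integral>\<^sup>+t. \<integral>\<^sup>+s. U i (\<phi> t s) \<partial>\<mu> \<partial>\<kappa>)"
      by (intro nn_integral_monotone_convergence_SUP inc1 ml IH)
    moreover have "(\<integral>\<^sup>+s. (SUP i. \<integral>\<^sup>+t. U i (\<phi> t s) \<partial>\<kappa>) \<partial>\<mu>)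
      = (SUP i. \<integral>\<^sup>+s. \<integral>\<^sup>+t. U i (\<phi> t s) \<partial>\<kappa> \<partial>\<mu>)"
      by (intro nn_integral_monotone_convergence_SUP inc2 mm IH)
    ultimately show ?case unfolding 1 2 using IH by (auto intro!: borel_measurable_SUP)
  qed
qed


section \<open>Uniform boundedness\<close>

text \<open>By Baire some sublevel set, at height n, contains a ball of radius \<open>r\<close>
  about a point \<open>u0\<close>. If \<open>norm u \<le> 1\<close>, then
  \<open>r *\<^sub>R u\<close> is a difference of two points of that set, whence the bound 2 n / r
  on the unit ball.\<close>

lemma uniform_boundedness_seminorm:
  fixes p :: "'a::banach \<Rightarrow> ennreal"
  assumes cl: "\<And>n::nat. closed {u. p u \<le> of_nat n}" and fin: "\<And>u. p u < \<infinity>"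
    and diff: "\<And>u v. p (u - v) \<le> p u + p v" and scale: "\<And>c u. p (c *\<^sub>R u) = ennreal \<bar>c\<bar> * p u"
  obtains K where "0 \<le> K" "\<And>u. p u \<le> ennreal (K * norm u)"
proof -
  define E where "E n = {u. p u \<le> of_nat n}" for n :: nat
  have "\<exists>n. interior (E n) \<noteq> {}"
  proof (rule ccontr)
    assume "\<nexists>n. interior (E n) \<noteq> {}"
    then have "euclidean interior_of \<Union>(range E) = {}"
      by (intro Baire_category_alt)
        (auto simp: completely_metrizable_space_euclidean E_def cl simp flip: closedin_def)
    moreover have "u \<in> \<Union>(range E)" for u
    proof -
      obtain n :: nat where "enn2real (p u) \<le> n" using real_arch_simple by blast
      then have "ennreal (enn2real (p u)) \<le> ennreal n" by (rule ennreal_leI)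
      moreover have "ennreal (enn2real (p u)) = p u" using fin[of u] by simp
      ultimately have "u \<in> E n" by (simp only: E_def ennreal_of_nat_eq_real_of_nat mem_Collect_eq)
      then show ?thesis by blast
    qed
    then have "\<Union>(range E) = UNIV" by blast
    ultimately show False by simp
  qed
  then obtain n u0 where "u0 \<in> interior (E n)" by blast
  then obtain r where r: "0 < r" "cball u0 r \<subseteq> E n"
    by (meson open_contains_cball open_interior interior_subset subset_trans)
  have unit: "p u \<le> ennreal (2 * n / r)" if u: "norm u \<le> 1" for u
  proof -
    have "norm (r *\<^sub>R u) \<le> r" using u r(1) by (simp add: mult_left_le)
    then have "u0 + r *\<^sub>R u \<in> E n" "u0 \<in> E n" using r by (auto simp: dist_norm)
    then have "p ((u0 + r *\<^sub>R u) - u0) \<le> of_nat n + of_nat n"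
      unfolding E_def using diff[of "u0 + r *\<^sub>R u" u0] by (auto intro: order_trans add_mono)
    then have "ennreal r * p u \<le> ennreal (2 * n)" using r(1)
      by (simp add: scale ennreal_of_nat_eq_real_of_nat flip: ennreal_plus)
    then have "ennreal (1 / r) * (ennreal r * p u) \<le> ennreal (1 / r) * ennreal (2 * n)"
      by (rule mult_left_mono) simp
    then show ?thesis using r(1)
      by (simp add: mult.assoc[symmetric] flip: ennreal_mult)
  qed
  show ?thesis
  proof (rule that[of "2 * n / r"])
    show "0 \<le> 2 * n / r" using r(1) by simp
    fix u
    show "p u \<le> ennreal (2 * n / r * norm u)"
    proof (cases "u = 0")
      case True
      then show ?thesis using scale[of 0 0] by simp
    next
      case False
      have "p (norm u *\<^sub>R (u /\<^sub>R norm u)) = ennreal (norm u) * p (u /\<^sub>R norm u)" by (simp only: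
        scale abs_norm_cancel)
      also have "\<dots> \<le> ennreal (norm u) * ennreal (2 * n / r)" using False by (intro mult_left_mono
        unit) auto
      finally show ?thesis using False r(1) by (simp add: ennreal_mult[symmetric] mult.commute)
    qed
  qed
qed

text \<open>\<open>topdual\<close> is a mere set of functions. The type
  \<open>'x \<Rightarrow>\<^sub>L real\<close> is a Banach space and parametrises it through real
  parts, which makes the Baire category theorem applicable.\<close>

definition dual_of :: "('x::complex_normed_vector \<Rightarrow>\<^sub>L real) \<Rightarrow> 'x \<Rightarrow> complex" where
  "dual_of u = complexify (blinfun_apply u)"

lemma dual_of_topdual: "dual_of u \<in> topdual" and dual_of_bound: "cmod (dual_of u x)
  \<le> norm u * norm x"
proof -
  have "blinfun_apply u x \<le> norm u * norm x" for x using norm_blinfun[of u x] by simp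
  from complexify_topdual[OF _ this] show "dual_of u \<in> topdual" "cmod (dual_of u x)
    \<le> norm u * norm x"
    by (auto simp: dual_of_def bounded_linear.linear[OF blinfun.bounded_linear_right])
qed

lemma dual_of_diff: "dual_of (u - v) x = dual_of u x - dual_of v x"
  and dual_of_scaleR: "dual_of (c *\<^sub>R u) x = complex_of_real c * dual_of u x"
  by (simp_all add: dual_of_def complexify_def complex_eq_iff blinfun.diff_left blinfun.scaleR_left)

lemma continuous_dual_of: "continuous_on UNIV (\<lambda>u. dual_of u x)"
  unfolding dual_of_def complexify_def Complex_eq by (intro continuous_intros)

lemma dual_of_surj:
  assumes x': "x' \<in> dual_ball"
  obtains u where "norm u \<le> 1" "dual_of u = x'"
proof
  have bl: "bounded_linear (\<lambda>x. Re (x' x))"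
    by (intro bounded_linear_compose[OF bounded_linear_Re] topdual_linear dual_ball_topdual x')
  show "dual_of (Blinfun (\<lambda>x. Re (x' x))) = x'"
    by (simp add: dual_of_def bounded_linear_Blinfun_apply[OF bl] complexify_Re dual_ball_topdual
      x')
  show "norm (Blinfun (\<lambda>x. Re (x' x))) \<le> 1"
  proof (rule norm_blinfun_bound)
    fix x
    show "norm (blinfun_apply (Blinfun (\<lambda>x. Re (x' x))) x) \<le> 1 * norm x"
      using abs_Re_le_cmod[of "x' x"] dual_ball_bound[OF x', of x]
      by (simp add: bounded_linear_Blinfun_apply[OF bl])
  qed simp
qed

lemma sigma_additive_weak:
  "sigma_additive \<nu> \<Longrightarrow> x' \<in> topdual \<Longrightarrow> sigma_additive (\<lambda>B. x' (\<nu> B))"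
  using sigma_additive_compose[of \<nu> x'] topdual_linear[of x'] by blast

lemma variation_diff_le:
  assumes "A \<in> sets borel" "\<mu> {} = 0" "\<mu>' {} = 0"
  shows "variation (\<lambda>B. \<mu> B - \<mu>' B) A \<le> variation \<mu> A + variation \<mu>' A"
proof (rule variation_least)
  fix P assume P: "finite P" "P \<subseteq> sets borel" "partition_on A P"
  have "(\<Sum>E\<in>P. ennreal (cmod (\<mu> E - \<mu>' E))) \<le> (\<Sum>E\<in>P. ennreal (cmod (\<mu> E)) + ennreal (cmod (\<mu>' E)))"
    by (intro sum_mono) (simp add: norm_triangle_ineq4 flip: ennreal_plus)
  also have "\<dots> \<le> variation \<mu> A + variation \<mu>' A"
    unfolding sum.distrib variation_def by (intro add_mono SUP_upper) (use P in auto)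
  finally show "(\<Sum>E\<in>P. ennreal (cmod (\<mu> E - \<mu>' E))) \<le> variation \<mu> A + variation \<mu>' A" .
qed

text \<open>For a fixed partition the sum of moduli is continuous in \<open>u\<close>, so the
  supremum over partitions has closed sublevel sets. Finiteness for each \<open>u\<close> is that of
  the total variation, and uniform boundedness yields one \<open>K\<close> for all.\<close>

lemma semivariation_bound:
  fixes \<nu> :: "'g::topological_space set \<Rightarrow> 'x::complex_normed_vector"
  assumes \<nu>: "sigma_additive \<nu>"
  obtains K where "0 \<le> K" "\<And>u A. A \<in> sets borel \<Longrightarrow> variation (\<lambda>B. dual_of u (\<nu> B)) A
    \<le> ennreal (K * norm u)"
proof -
  note sa = sigma_additive_weak[OF \<nu> dual_of_topdual]
  obtain K where K: "0 \<le> K" "\<And>u. variation (\<lambda>B. dual_of u (\<nu> B)) UNIV \<le> ennreal (K * norm u)"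
  proof (rule uniform_boundedness_seminorm[of "\<lambda>u. variation (\<lambda>B. dual_of u (\<nu> B)) UNIV"])
    fix n :: nat
    have "{u. variation (\<lambda>B. dual_of u (\<nu> B)) UNIV \<le> of_nat n} =
      (\<Inter>P\<in>{P. finite P \<and> P \<subseteq> sets borel \<and> partition_on UNIV P}. {u. (\<Sum>E\<in>P. cmod (dual_of u (\<nu> E)))
        \<le> n})"
      by (auto simp: variation_def SUP_le_iff ennreal_of_nat_eq_real_of_nat)
    also have "closed \<dots>"
      by (intro closed_INT ballI closed_Collect_le continuous_intros continuous_dual_of)
    finally show "closed {u. variation (\<lambda>B. dual_of u (\<nu> B)) UNIV \<le> of_nat n}" .
    show "variation (\<lambda>B. dual_of u (\<nu> B)) UNIV < \<infinity>" for u
      using variation_finite[OF sa[of u]] by (simp add: less_top)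
    show "variation (\<lambda>B. dual_of (u - v) (\<nu> B)) UNIV \<le> variation (\<lambda>B. dual_of u (\<nu> B)) UNIV +
      variation (\<lambda>B. dual_of v (\<nu> B)) UNIV" for u v
      unfolding dual_of_diff by (intro variation_diff_le sigma_additive_empty sa) auto
    show "variation (\<lambda>B. dual_of (c *\<^sub>R u) (\<nu> B)) UNIV = ennreal \<bar>c\<bar> * variation (\<lambda>B. dual_of u (\<nu>
      B)) UNIV" for c u
      unfolding dual_of_scaleR variation_cmult by simp
  qed blast
  show ?thesis
  proof (rule that[OF K(1)])
    fix u :: "'x \<Rightarrow>\<^sub>L real" and A :: "'g set"
    have "variation (\<lambda>B. dual_of u (\<nu> B)) A \<le> variation (\<lambda>B. dual_of u (\<nu> B)) UNIV"
      by (intro variation_mono sigma_additive_empty sa) auto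
    then show "variation (\<lambda>B. dual_of u (\<nu> B)) A \<le> ennreal (K * norm u)" using K(2)[of u] by simp
  qed
qed

lemma nn_integral_le_add_measure:
  assumes "sets M = sets borel" "sets N = sets borel" "sets N' = sets borel"
    and le: "\<And>A. A \<in> sets borel \<Longrightarrow> emeasure M A \<le> emeasure N A + emeasure N' A"
    and F: "F \<in> borel_measurable borel"
  shows "(\<integral>\<^sup>+x. F x \<partial>M) \<le> (\<integral>\<^sup>+x. F x \<partial>N) + (\<integral>\<^sup>+x. F x \<partial>N')"
  using F
proof (induction rule: borel_measurable_induct)
  case (cong f g)
  then have "f = g" by auto
  then show ?case using cong by simp
next
  case (set A) then show ?case by (simp add: assms)
next
  case (mult u c)
  have "(\<integral>\<^sup>+x. c * u x \<partial>M) = c * (\<integral>\<^sup>+x. u x \<partial>M)" "(\<integral>\<^sup>+x. c * u x \<partial>N) = c * (\<integral>\<^sup>+x. u x \<partial>N)"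
    "(\<integral>\<^sup>+x. c * u x \<partial>N') = c * (\<integral>\<^sup>+x. u x \<partial>N')"
    using mult.hyps(2) by (intro nn_integral_cmult; simp add: assms cong: measurable_cong_sets)+
  then show ?case using mult.IH by (simp add: distrib_left[symmetric] mult_left_mono)
next
  case (add u v)
  have "(\<integral>\<^sup>+x. v x + u x \<partial>M') = (\<integral>\<^sup>+x. v x \<partial>M') + (\<integral>\<^sup>+x. u x \<partial>M')" if "sets M' = sets borel" for M'
    using add.hyps(1,3) that by (intro nn_integral_add) (simp_all cong: measurable_cong_sets)
  then show ?case using add_mono[OF add.IH(2) add.IH(1)] by (simp add: assms algebra_simps)
next
  case (seq U)
  have *: "(\<integral>\<^sup>+x. (SUP i. U i) x \<partial>M') = (SUP i. \<integral>\<^sup>+x. U i x \<partial>M')" if "sets M' = sets borel" for M'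
    using seq.hyps that unfolding SUP_apply
    by (intro nn_integral_monotone_convergence_SUP) (simp_all cong: measurable_cong_sets)
  show ?case unfolding *[OF assms(1)]
  proof (rule SUP_least)
    fix i
    have "(\<integral>\<^sup>+x. U i x \<partial>M) \<le> (\<integral>\<^sup>+x. U i x \<partial>N) + (\<integral>\<^sup>+x. U i x \<partial>N')" by (rule seq.IH)
    also have "\<dots> \<le> (\<integral>\<^sup>+x. (SUP i. U i) x \<partial>N) + (\<integral>\<^sup>+x. (SUP i. U i) x \<partial>N')"
      by (intro add_mono nn_integral_mono) (auto intro: SUP_upper)
    finally show "(\<integral>\<^sup>+x. U i x \<partial>M) \<le> (\<integral>\<^sup>+x. (SUP i. U i) x \<partial>N) + (\<integral>\<^sup>+x. (SUP i. U i) x \<partial>N')" .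
  qed
qed

lemma nn_integral_cmult_measure:
  assumes "sets M = sets borel" "sets N = sets borel"
    and eq: "\<And>A. A \<in> sets borel \<Longrightarrow> emeasure M A = c * emeasure N A"
    and F: "F \<in> borel_measurable borel"
  shows "(\<integral>\<^sup>+x. F x \<partial>M) = c * (\<integral>\<^sup>+x. F x \<partial>N)"
proof -
  have "M = scale_measure c N" using eq by (intro measure_eqI) (auto simp: assms)
  then show ?thesis using F assms by (simp add: nn_integral_scale_measure cong:
    measurable_cong_sets)
qed

section \<open>Uniform finiteness over the dual ball\<close>

abbreviation dual_variation ::
  "('g::topological_space set \<Rightarrow> 'x::complex_normed_vector) \<Rightarrow> ('x \<Rightarrow> complex) \<Rightarrow> 'g measure" where
  "dual_variation \<nu> x' \<equiv> variation_measure (\<lambda>B. x' (\<nu> B))"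

abbreviation enorm :: "('a \<Rightarrow> complex) \<Rightarrow> 'a \<Rightarrow> ennreal" where
  "enorm f \<equiv> \<lambda>s. ennreal (cmod (f s))"

text \<open>The quantity N(F) of the overview; with values in \<open>ennreal\<close> it makes sense
  without any finiteness condition.\<close>

definition weak_norm :: "('g::topological_space set \<Rightarrow> 'x::complex_normed_vector) \<Rightarrow> ('g \<Rightarrow> ennreal)
  \<Rightarrow> ennreal" where
  "weak_norm \<nu> F = (SUP x' \<in> dual_ball. \<integral>\<^sup>+ s. F s \<partial>dual_variation \<nu> x')"

lemma weak_norm_upper:
  "x' \<in> dual_ball \<Longrightarrow> (\<integral>\<^sup>+ s. F s \<partial>dual_variation \<nu> x') \<le> weak_norm \<nu> F"
  unfolding weak_norm_def by (rule SUP_upper)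

lemma weak_norm_least:
  "(\<And>x'. x' \<in> dual_ball \<Longrightarrow> (\<integral>\<^sup>+ s. F s \<partial>dual_variation \<nu> x') \<le> c) \<Longrightarrow> weak_norm \<nu> F \<le> c"
  unfolding weak_norm_def by (rule SUP_least)

text \<open>Uniform boundedness is used twice: for measures of sets, where it gives continuity in
  the functional, and then for the integrals of \<open>F\<close>, which are suprema of such
  continuous functions.\<close>

lemma weak_norm_finite:
  fixes \<nu> :: "'g::topological_space set \<Rightarrow> 'x::complex_normed_vector"
  assumes \<nu>: "sigma_additive \<nu>" and F: "F \<in> borel_measurable borel"
    and fin: "\<And>x'. x' \<in> topdual \<Longrightarrow> (\<integral>\<^sup>+ s. F s \<partial>dual_variation \<nu> x') < \<infinity>"
  shows "weak_norm \<nu> F < \<infinity>"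
proof -
  note sa = sigma_additive_weak[OF \<nu> dual_of_topdual]
  define V where "V u = variation_measure (\<lambda>B. dual_of u (\<nu> B))" for u :: "'x \<Rightarrow>\<^sub>L real"
  have sV [simp]: "sets (V u) = sets borel" "space (V u) = UNIV" for u by (simp_all add: V_def)
  have V: "emeasure (V u) A = variation (\<lambda>B. dual_of u (\<nu> B)) A" if "A \<in> sets borel" for u A
    unfolding V_def by (rule emeasure_variation_measure[OF sa that])
  have Vdiff: "emeasure (V (u - v)) A \<le> emeasure (V u) A + emeasure (V v) A" if "A
    \<in> sets borel" for u v A
    using that unfolding V[OF that] dual_of_diff by (intro variation_diff_le sigma_additive_empty
      sa)
  have Vscale: "emeasure (V (c *\<^sub>R u)) A = ennreal \<bar>c\<bar> * emeasure (V u) A" if "A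
    \<in> sets borel" for c u A
    unfolding V[OF that] dual_of_scaleR variation_cmult by simp
  obtain K1 where K1: "0 \<le> K1" "\<And>u A. A \<in> sets borel \<Longrightarrow> emeasure (V u) A \<le> ennreal (K1 * norm u)"
    using semivariation_bound[OF \<nu>] V by metis
  have fm: "finite_measure (V u)" for u unfolding V_def by (rule finite_variation_measure[OF sa])
  \<comment> \<open>The uniform bound \<open>K1\<close> is a Lipschitz constant of the measure of
    \<open>A\<close> as a function of \<open>u\<close>.\<close>
  have cont: "continuous_on UNIV (\<lambda>u. measure (V u) A)" if A: "A \<in> sets borel" for A
  proof -
    have real: "emeasure (V u) A = ennreal (measure (V u) A)" for u
      by (rule finite_measure.emeasure_eq_measure[OF fm])
    have "measure (V u) A \<le> K1 * norm (u - v) + measure (V v) A" for u v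
    proof -
      have "emeasure (V ((u - v) - (- v))) A \<le> emeasure (V (u - v)) A + emeasure (V ((-1) *\<^sub>R v)) A"
        using Vdiff[OF A, of "u - v" "- v"] by simp
      also have "\<dots> \<le> ennreal (K1 * norm (u - v)) + emeasure (V v) A"
        unfolding Vscale[OF A] by (intro add_mono K1 A) simp
      finally show ?thesis using K1(1) unfolding real by (simp flip: ennreal_plus)
    qed
    from this[of _ _] have "dist (measure (V u) A) (measure (V v) A) \<le> K1 * dist u v" for u v
      unfolding dist_norm real_norm_def by (smt (verit) norm_minus_commute)
    then have "K1-lipschitz_on UNIV (\<lambda>u. measure (V u) A)" using K1(1) by (intro lipschitz_onI) auto
    then show ?thesis by (rule lipschitz_on_continuous_on)
  qed
  obtain K where K: "0 \<le> K" "\<And>u. (\<integral>\<^sup>+s. F s \<partial>V u) \<le> ennreal (K * norm u)"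
  proof (rule uniform_boundedness_seminorm[of "\<lambda>u. \<integral>\<^sup>+s. F s \<partial>V u"])
    fix n :: nat
    \<comment> \<open>Finite values of \<open>g\<close> turn its integral into a finite real
      combination of measures of sets, hence into a continuous function of \<open>u\<close>.\<close>
    define S where "S = {g. simple_function borel g \<and> g \<le> F \<and> (\<forall>x. g x < top)}"
    have int: "integral\<^sup>S (V u) g = ennreal (\<Sum>c\<in>range g. enn2real c * measure (V u) (g -` {c}))"
      if g: "g \<in> S" for g u
    proof -
      have "c * emeasure (V u) (g -` {c}) = ennreal (enn2real c * measure (V u) (g -` {c}))"
        if "c \<in> range g" for c
      proof -
        have "c < top" using that g by (auto simp: S_def)
        then have "c * emeasure (V u) (g -` {c}) = ennreal (enn2real c) * ennreal (measure (V u)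
          (g -` {c}))"
          by (simp add: finite_measure.emeasure_eq_measure[OF fm])
        then show ?thesis by (simp add: ennreal_mult)
      qed
      then show ?thesis by (simp add: simple_integral_def sum_nonneg sum_ennreal[symmetric] del:
        sum_ennreal)
    qed
    have "{u. (\<integral>\<^sup>+s. F s \<partial>V u) \<le> of_nat n} =
      (\<Inter>g\<in>S. {u. (\<Sum>c\<in>range g. enn2real c * measure (V u) (g -` {c})) \<le> n})"
    proof -
      have eq: "(\<integral>\<^sup>+s. F s \<partial>V u) = (SUP g\<in>S. integral\<^sup>S (V u) g)" for u
        unfolding nn_integral_def_finite S_def
        by (simp add: simple_function_def)
      have "(\<integral>\<^sup>+s. F s \<partial>V u) \<le> of_nat n \<longleftrightarrow>
          (\<forall>g\<in>S. (\<Sum>c\<in>range g. enn2real c * measure (V u) (g -` {c})) \<le> n)" for u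
        by (simp add: eq SUP_le_iff int ennreal_of_nat_eq_real_of_nat)
      then show ?thesis by auto
    qed
    also have "closed \<dots>"
    proof (intro closed_INT ballI closed_Collect_le continuous_intros cont)
      fix g c assume "g \<in> S"
      then show "g -` {c} \<in> sets borel" using simple_functionD(2)[of borel g "{c}"] by (simp add:
        S_def)
    qed
    finally show "closed {u. (\<integral>\<^sup>+s. F s \<partial>V u) \<le> of_nat n}" .
    show "(\<integral>\<^sup>+s. F s \<partial>V u) < \<infinity>" for u unfolding V_def by (intro fin dual_of_topdual)
    show "(\<integral>\<^sup>+s. F s \<partial>V (u - v)) \<le> (\<integral>\<^sup>+s. F s \<partial>V u) + (\<integral>\<^sup>+s. F s \<partial>V v)" for u v
      by (intro nn_integral_le_add_measure Vdiff F) auto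
    show "(\<integral>\<^sup>+s. F s \<partial>V (c *\<^sub>R u)) = ennreal \<bar>c\<bar> * (\<integral>\<^sup>+s. F s \<partial>V u)" for c u
      by (intro nn_integral_cmult_measure Vscale F) auto
  qed blast
  have "weak_norm \<nu> F \<le> ennreal K"
  proof (rule weak_norm_least)
    fix x' :: "'x \<Rightarrow> complex" assume "x' \<in> dual_ball"
    then obtain u where u: "norm u \<le> 1" "dual_of u = x'" using dual_of_surj by blast
    have "(\<integral>\<^sup>+s. F s \<partial>V u) \<le> ennreal (K * norm u)" by (rule K)
    also have "\<dots> \<le> ennreal K" using u(1) K(1) by (intro ennreal_leI) (simp add: mult_left_le)
    finally show "(\<integral>\<^sup>+ s. F s \<partial>dual_variation \<nu> x') \<le> ennreal K" by (simp add: V_def u(2))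
  qed
  then show ?thesis by (simp add: le_less_trans[OF _ ennreal_less_top])
qed


section \<open>Haar measure and invariant vector measures\<close>

text \<open>Closed sets are compact here, so the gap between \<open>c\<close> and the measure of
  \<open>A\<close> can be taken as the error.\<close>

lemma inner_regularI_closed:
  fixes M :: "'g::t2_space measure"
  assumes "compact (UNIV :: 'g set)" and M: "sets M = sets borel" "finite_measure M"
    and closed: "\<And>e A. 0 < e \<Longrightarrow> A \<in> sets borel \<Longrightarrow> \<exists>F. closed F \<and> F \<subseteq> A
      \<and> emeasure M (A - F) < ennreal e"
  shows "inner_regular M"
  unfolding inner_regular_def
proof (intro conjI M ballI allI impI)
  interpret finite_measure M by fact
  fix A c assume A: "A \<in> sets borel" and c: "c < emeasure M A"
  then obtain r where r: "c = ennreal r" "0 \<le> r" by (cases c) auto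
  then have "0 < measure M A - r" using c by (simp add: emeasure_eq_measure ennreal_less_iff)
  from closed[OF this A] obtain F where F: "closed F" "F \<subseteq> A" "emeasure M (A - F) < ennreal
    (measure M A - r)" by blast
  then have "measure M (A - F) < measure M A - r" by (simp add: emeasure_eq_measure
    ennreal_less_iff)
  moreover have "measure M (A - F) = measure M A - measure M F"
    using A F by (intro finite_measure_Diff) (auto simp: M)
  ultimately have "c < emeasure M F" using r by (simp add: emeasure_eq_measure ennreal_less_iff)
  moreover have "compact F" using compact_Int_closed[OF assms(1) F(1)] by simp
  ultimately show "\<exists>K. compact K \<and> K \<subseteq> A \<and> c < emeasure M K" using F by blast
qed

text \<open>Countably many compact subsets exhaust \<open>A\<close> up to an \<open>M\<close>-null
  set, which is also null for the density; finite unions of them approximate the mass from below. A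
  weight can thus be absorbed into the measure while the Tonelli theorem stays available.\<close>

lemma inner_regular_density:
  fixes M :: "'g::t2_space measure"
  assumes M: "inner_regular M" and w: "w \<in> borel_measurable borel" and fin: "(\<integral>\<^sup>+x. w x \<partial>M) < \<infinity>"
  shows "inner_regular (density M w)"
proof -
  note sM = inner_regularD(1,2)[OF M]
  interpret finite_measure M by (rule inner_regularD(3)[OF M])
  have wM [measurable]: "w \<in> borel_measurable M" using w by (simp add: sM cong:
    measurable_cong_sets)
  show ?thesis
    unfolding inner_regular_def
  proof (intro conjI ballI allI impI)
    show "sets (density M w) = sets borel" by (simp add: sM)
    show "finite_measure (density M w)"
      using fin by (intro finite_measureI) (simp add: emeasure_density sM cong: nn_integral_cong)
    fix A c assume A: "A \<in> sets borel" and c: "c < emeasure (density M w) A"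
    define \<K> where "\<K> = {K. compact K \<and> K \<subseteq> A}"
    have "{} \<in> \<K>" by (simp add: \<K>_def)
    then have "\<exists>f::nat \<Rightarrow> ennreal. range f \<subseteq> emeasure M ` \<K> \<and> Sup (emeasure M ` \<K>) = Sup (range f)"
      by (intro ennreal_SUP_countable_SUP) auto
    then obtain f :: "nat \<Rightarrow> ennreal" where f: "range f \<subseteq> emeasure M ` \<K>" "Sup (emeasure M ` \<K>)
      = Sup (range f)"
      by blast
    then have "\<forall>n. \<exists>K\<in>\<K>. f n = emeasure M K" by blast
    then obtain K where K: "\<And>n. K n \<in> \<K>" "\<And>n. f n = emeasure M (K n)" by metis
    have Ks: "K n \<in> sets M" for n using K(1)[of n] by (auto simp: \<K>_def sM compact_imp_closed)
    define B where "B = (\<Union>n. K n)"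
    have B: "B \<in> sets M" "B \<subseteq> A" using Ks K(1) by (auto simp: B_def \<K>_def)
    have "emeasure M A \<le> Sup (emeasure M ` \<K>)"
    proof (rule ccontr)
      assume "\<not> ?thesis"
      then obtain L where "compact L" "L \<subseteq> A" "Sup (emeasure M ` \<K>) < emeasure M L"
        using inner_regularD(4)[OF M A, of "Sup (emeasure M ` \<K>)"] by (auto simp: not_le)
      moreover from this have "emeasure M L \<le> Sup (emeasure M ` \<K>)" by (intro SUP_upper) (auto
        simp: \<K>_def)
      ultimately show False by simp
    qed
    also have "\<dots> \<le> emeasure M B"
      unfolding f(2) K(2)[abs_def] using B by (intro SUP_least emeasure_mono) (auto simp: B_def)
    finally have "emeasure M A \<le> emeasure M B" .
    then have "emeasure M (A - B) = 0"
      using emeasure_Diff[of M B A] B A by (simp add: sM diff_eq_0_iff_ennreal less_top[symmetric])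
    then have "AE x in M. x \<notin> A - B" using A B by (subst AE_iff_measurable[of "A - B"]) (auto
      simp: sM)
    then have "AE x in M. w x * indicator A x = w x * indicator B x"
      by eventually_elim (use B(2) in \<open>auto simp: indicator_def\<close>)
    then have "emeasure (density M w) A = emeasure (density M w) B"
      using A B by (simp add: emeasure_density sM nn_integral_cong_AE)
    also have "\<dots> = (SUP n. emeasure (density M w) (\<Union>i\<le>n. K i))"
    proof (subst SUP_emeasure_incseq)
      show "range (\<lambda>n. \<Union>i\<le>n. K i) \<subseteq> sets (density M w)" using Ks by auto
      show "incseq (\<lambda>n. \<Union>i\<le>n. K i)" unfolding incseq_def by (intro allI impI UN_mono) auto
      show "emeasure (density M w) B = emeasure (density M w) (\<Union>n. \<Union>i\<le>n. K i)"
        by (rule arg_cong[where f = "emeasure (density M w)"]) (auto simp: B_def)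
    qed
    finally obtain n where "c < emeasure (density M w) (\<Union>i\<le>n. K i)" using c by (auto simp:
      less_SUP_iff)
    moreover have "compact (\<Union>i\<le>n. K i)" using K(1) by (intro compact_UN) (auto simp: \<K>_def)
    moreover have "(\<Union>i\<le>n. K i) \<subseteq> A" using K(1) by (auto simp: \<K>_def)
    ultimately show "\<exists>K. compact K \<and> K \<subseteq> A \<and> c < emeasure (density M w) K" by blast
  qed
qed

section \<open>Simple functions and semivariation\<close>

lemma sum_range_fibre:
  assumes "finite (range \<phi>)"
  shows "(\<Sum>c\<in>range \<phi>. f c * indicator (\<phi> -` {c}) s) = (f (\<phi> s) :: ennreal)"
proof -
  have "(\<Sum>c\<in>range \<phi>. f c * indicator (\<phi> -` {c}) s) = (\<Sum>c\<in>{\<phi> s}. f c)"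
    using assms by (intro sum.mono_neutral_cong_right) (auto simp: indicator_def)
  then show ?thesis by simp
qed

text \<open>The formula d|\<phi>\<mu>| = |\<phi>| d|\<mu>| for simple \<open>\<phi>\<close>: on the
  fibre over \<open>c\<close> the set function is \<open>c\<close> times \<open>\<mu>\<close>, and
  the variations of the fibres add up.\<close>

lemma variation_simple:
  fixes \<mu> :: "'g::topological_space set \<Rightarrow> complex"
  assumes \<mu>: "sigma_additive \<mu>" and \<phi>: "simple_function borel \<phi>"
  shows "variation (\<lambda>B. \<Sum>c\<in>range \<phi>. c * \<mu> (B \<inter> \<phi> -` {c})) UNIV
    = (\<integral>\<^sup>+s. ennreal (cmod (\<phi> s)) \<partial>variation_measure \<mu>)"
proof -
  define \<kappa> where "\<kappa> B = (\<Sum>c\<in>range \<phi>. c * \<mu> (B \<inter> \<phi> -` {c}))" for B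
  have fin: "finite (range \<phi>)" using simple_functionD(1)[OF \<phi>] by simp
  have E: "\<phi> -` {c} \<in> sets borel" for c using simple_functionD(2)[OF \<phi>, of "{c}"] by simp
  have sa: "sigma_additive (\<lambda>B. c * \<mu> (B \<inter> \<phi> -` {c}))" for c
    by (rule sigma_additive_compose[OF sigma_additive_Int[OF \<mu> E] bounded_linear_mult_right])
  have \<kappa>: "sigma_additive \<kappa>" unfolding \<kappa>_def[abs_def] by (rule sigma_additive_sum) (rule sa)
  have var: "variation \<kappa> (\<phi> -` {c}) = ennreal (cmod c) * emeasure (variation_measure \<mu>) (\<phi> -`
    {c})" for c
  proof -
    have "variation \<kappa> (\<phi> -` {c}) = variation (\<lambda>B. c * \<mu> B) (\<phi> -` {c})"
    proof (rule variation_cong)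
      fix B assume B: "B \<in> sets borel" "B \<subseteq> \<phi> -` {c}"
      have "\<kappa> B = c * \<mu> B"
      proof (cases "c \<in> range \<phi>")
        case True
        have "\<kappa> B = (\<Sum>c\<in>{c}. c * \<mu> (B \<inter> \<phi> -` {c}))"
          unfolding \<kappa>_def
        proof (rule sum.mono_neutral_right[OF fin])
          show "\<forall>d\<in>range \<phi> - {c}. d * \<mu> (B \<inter> \<phi> -` {d}) = 0"
          proof
            fix d assume "d \<in> range \<phi> - {c}"
            then have "B \<inter> \<phi> -` {d} = {}" using B(2) by auto
            then show "d * \<mu> (B \<inter> \<phi> -` {d}) = 0" by (simp add: sigma_additive_empty[OF \<mu>])
          qed
        qed (use True in auto)
        also have "\<dots> = c * \<mu> B" using B(2) by (simp add: Int_absorb2)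
        finally show ?thesis .
      next
        case False
        then have "B = {}" using B(2) by auto
        then show ?thesis by (simp add: sigma_additive_empty \<kappa> \<mu>)
      qed
      then show "cmod (\<kappa> B) = cmod (c * \<mu> B)" by simp
    qed
    then show ?thesis by (simp add: variation_cmult emeasure_variation_measure[OF \<mu> E])
  qed
  have "variation \<kappa> UNIV = emeasure (variation_measure \<kappa>) (\<Union>c\<in>range \<phi>. \<phi> -` {c})"
  proof -
    have "(\<Union>c\<in>range \<phi>. \<phi> -` {c}) = UNIV" by auto
    then show ?thesis using emeasure_variation_measure[OF \<kappa>, of UNIV] by simp
  qed
  also have "\<dots> = (\<Sum>c\<in>range \<phi>. emeasure (variation_measure \<kappa>) (\<phi> -` {c}))"
    using E fin by (intro sum_emeasure[symmetric]) (auto simp: disjoint_family_on_def)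
  also have "\<dots> = (\<Sum>c\<in>range \<phi>. ennreal (cmod c) * emeasure (variation_measure \<mu>) (\<phi> -` {c}))"
    by (simp add: emeasure_variation_measure[OF \<kappa> E] var)
  also have "\<dots> = (\<Sum>c\<in>range \<phi>. \<integral>\<^sup>+s. ennreal (cmod c) * indicator (\<phi> -` {c}) s \<partial>variation_measure \<mu>)"
    using E by (simp add: nn_integral_cmult_indicator)
  also have "\<dots> = (\<integral>\<^sup>+s. (\<Sum>c\<in>range \<phi>. ennreal (cmod c) * indicator (\<phi> -` {c}) s) \<partial>variation_measure
    \<mu>)"
    using E by (intro nn_integral_sum[symmetric]) (auto intro!: borel_measurable_times_ennreal
      borel_measurable_indicator)
  also have "\<dots> = (\<integral>\<^sup>+s. ennreal (cmod (\<phi> s)) \<partial>variation_measure \<mu>)"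
    by (simp only: sum_range_fibre[OF fin])
  finally show ?thesis by (simp add: \<kappa>_def[abs_def])
qed

lemma vector_integral_simple:
  fixes \<nu> :: "'g::topological_space set \<Rightarrow> 'x::complex_normed_vector"
  assumes \<nu>: "sigma_additive \<nu>" and \<phi>: "simple_function borel \<phi>" and A: "A \<in> sets borel"
  shows "is_integral \<nu> \<phi> A (\<Sum>c\<in>range \<phi>. c *\<^sub>C \<nu> (A \<inter> \<phi> -` {c}))"
    and "vector_integral \<nu> \<phi> A = (\<Sum>c\<in>range \<phi>. c *\<^sub>C \<nu> (A \<inter> \<phi> -` {c}))"
proof -
  show *: "is_integral \<nu> \<phi> A (\<Sum>c\<in>range \<phi>. c *\<^sub>C \<nu> (A \<inter> \<phi> -` {c}))"
    unfolding is_integral_def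
  proof
    fix x' :: "'x \<Rightarrow> complex" assume x': "x' \<in> topdual"
    show "x' (\<Sum>c\<in>range \<phi>. c *\<^sub>C \<nu> (A \<inter> \<phi> -` {c})) = complex_integral (\<lambda>B. x' (\<nu> B)) A \<phi>"
      unfolding complex_integral_simple[OF sigma_additive_weak[OF \<nu> x'] \<phi> A]
      by (simp add: linear_sum[OF bounded_linear.linear[OF topdual_linear[OF x']]]
        topdual_scaleC[OF x'])
  qed
  show "vector_integral \<nu> \<phi> A = (\<Sum>c\<in>range \<phi>. c *\<^sub>C \<nu> (A \<inter> \<phi> -` {c}))"
    unfolding vector_integral_def
  proof (rule the_equality[where P = "is_integral \<nu> \<phi> A", OF *])
    fix x assume "is_integral \<nu> \<phi> A x"
    then show "x = (\<Sum>c\<in>range \<phi>. c *\<^sub>C \<nu> (A \<inter> \<phi> -` {c}))"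
      using * unfolding is_integral_def by (intro topdual_separates) metis
  qed
qed

text \<open>Translates the invariance hypothesis, an equation of semivariations, into one between
  weak norms of moduli.\<close>

lemma semivariation_simple:
  fixes \<nu> :: "'g::topological_space set \<Rightarrow> 'x::complex_normed_vector"
  assumes \<nu>: "sigma_additive \<nu>" and \<phi>: "simple_function borel \<phi>"
  shows "semivariation (vector_integral \<nu> \<phi>) UNIV = weak_norm \<nu> (enorm \<phi>)"
  unfolding semivariation_def weak_norm_def
proof (rule SUP_cong[OF refl])
  fix x' :: "'x \<Rightarrow> complex" assume "x' \<in> dual_ball"
  then have x': "x' \<in> topdual" by (rule dual_ball_topdual)
  have "variation (\<lambda>B. x' (vector_integral \<nu> \<phi> B)) UNIV
      = variation (\<lambda>B. \<Sum>c\<in>range \<phi>. c * x' (\<nu> (B \<inter> \<phi> -` {c}))) UNIV"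
    by (rule variation_cong)
      (simp add: vector_integral_simple(2)[OF \<nu> \<phi>] topdual_scaleC[OF x']
        linear_sum[OF bounded_linear.linear[OF topdual_linear[OF x']]])
  also have "\<dots> = (\<integral>\<^sup>+s. ennreal (cmod (\<phi> s)) \<partial>dual_variation \<nu> x')"
    by (rule variation_simple[OF sigma_additive_weak[OF \<nu> x'] \<phi>])
  finally show "variation (\<lambda>B. x' (vector_integral \<nu> \<phi> B)) UNIV =
    (\<integral>\<^sup>+s. ennreal (cmod (\<phi> s)) \<partial>dual_variation \<nu> x')" .
qed

section \<open>Translations\<close>

lemma image_add_right: "(\<lambda>s. s + t) ` A = (\<lambda>s. s - t) -` (A :: 'g::group_add set)"
  by (auto simp: image_iff) (metis diff_add_cancel)

lemma borel_measurable_translate: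
  fixes t :: "'g::topological_group_add"
  shows "(\<lambda>s. s - t) \<in> borel_measurable borel" "(\<lambda>s. t - s) \<in> borel_measurable borel"
    "(\<lambda>s. t + s) \<in> borel_measurable borel" "uminus \<in> borel_measurable (borel :: 'g measure)"
proof -
  have m: "continuous_on UNIV (uminus :: 'g \<Rightarrow> 'g)"
    unfolding continuous_on_def by (auto intro!: tendsto_intros)
  show "uminus \<in> borel_measurable (borel :: 'g measure)" by (intro borel_measurable_continuous_onI
    m)
  have "continuous_on UNIV (\<lambda>s. t + - s)" "continuous_on UNIV (\<lambda>s. s + - t)" "continuous_on UNIV
    (\<lambda>s. t + s)"
    by (intro continuous_intros m)+
  then show "(\<lambda>s. s - t) \<in> borel_measurable borel" "(\<lambda>s. t - s) \<in> borel_measurable borel"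
    "(\<lambda>s. t + s) \<in> borel_measurable borel"
    by (auto intro: borel_measurable_continuous_onI)
qed

lemma translate_sets:
  fixes A :: "'g::topological_group_add set"
  assumes "A \<in> sets borel" shows "(\<lambda>s. s + t) ` A \<in> sets borel"
  using measurable_sets[OF borel_measurable_translate(1) assms] by (simp add: image_add_right)

lemma sigma_additive_translate:
  fixes \<nu> :: "'g::topological_group_add set \<Rightarrow> 'b::real_normed_vector"
  assumes \<nu>: "sigma_additive \<nu>" shows "sigma_additive (translate t \<nu>)"
  unfolding sigma_additive_def translate_def
proof (intro allI impI)
  fix A :: "nat \<Rightarrow> 'g set" assume A: "range A \<subseteq> sets borel" "disjoint_family A"
  have "disjoint_family (\<lambda>n. (\<lambda>s. s + t) ` A n)"
    using A(2) by (simp add: disjoint_family_on_def image_add_right flip: vimage_Int)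
  then have "(\<lambda>n. \<nu> ((\<lambda>s. s + t) ` A n)) sums \<nu> (\<Union>n. (\<lambda>s. s + t) ` A n)"
    using A(1) by (intro sigma_additive_sums \<nu>) (auto intro!: translate_sets)
  then show "(\<lambda>n. \<nu> ((\<lambda>s. s + t) ` A n)) sums \<nu> ((\<lambda>s. s + t) ` (\<Union>n. A n))" by (simp add: image_UN)
qed

lemma variation_translate_le:
  fixes \<mu> :: "'g::topological_group_add set \<Rightarrow> complex"
  assumes "\<mu> {} = 0" "A \<in> sets borel"
  shows "variation (translate t \<mu>) A \<le> variation \<mu> ((\<lambda>s. s + t) ` A)"
proof (rule variation_least)
  fix P assume P: "finite P" "P \<subseteq> sets borel" "partition_on A P"
  show "(\<Sum>E\<in>P. ennreal (cmod (translate t \<mu> E))) \<le> variation \<mu> ((\<lambda>s. s + t) ` A)"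
    unfolding translate_def
  proof (rule variation_upper)
    show "disjoint_family_on ((`) (\<lambda>s. s + t)) P"
      using partition_onD2[OF P(3)] unfolding disjoint_family_on_def disjoint_def image_add_right
        by auto
    show "(\<Union>E\<in>P. (\<lambda>s. s + t) ` E) \<subseteq> (\<lambda>s. s + t) ` A" using partition_onD1[OF P(3)] by auto
  qed (use P assms in \<open>auto intro!: translate_sets\<close>)
qed

text \<open>Translating back by \<open>- t\<close> reverses the inequality.\<close>

lemma variation_translate:
  fixes \<mu> :: "'g::topological_group_add set \<Rightarrow> complex"
  assumes "\<mu> {} = 0" "A \<in> sets borel"
  shows "variation (translate t \<mu>) A = variation \<mu> ((\<lambda>s. s + t) ` A)"
proof (rule antisym[OF variation_translate_le[of \<mu> A t, OF assms]])
  have tr: "(\<lambda>s. s + (- t)) ` (\<lambda>s. s + t) ` A = A" for A :: "'g set" by (simp add: image_image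
    add.assoc)
  have tr': "(\<lambda>s. s + t) ` (\<lambda>s. s + (- t)) ` A = A" for A :: "'g set" by (simp add: image_image
    add.assoc)
  have "translate (- t) (translate t \<mu>) = \<mu>" by (rule ext) (simp add: translate_def tr' del:
    add_uminus_conv_diff)
  moreover have "variation (translate (- t) (translate t \<mu>)) ((\<lambda>s. s + t) ` A)
    \<le> variation (translate t \<mu>) A"
    using variation_translate_le[of "translate t \<mu>" "(\<lambda>s. s + t) ` A" "- t"] translate_sets[OF
      assms(2)]
    by (simp only: tr) (simp add: translate_def assms(1))
  ultimately show "variation \<mu> ((\<lambda>s. s + t) ` A) \<le> variation (translate t \<mu>) A" by simp
qed

text \<open>The set A + t is the preimage of \<open>A\<close> under the map from \<open>s\<close> to
  \<open>s - t\<close>, so the variation of the translated measure is the image measure under that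
  map.\<close>

lemma nn_integral_variation_translate:
  fixes \<mu> :: "'g::topological_group_add set \<Rightarrow> complex"
  assumes \<mu>: "sigma_additive \<mu>" and F: "F \<in> borel_measurable borel"
  shows "(\<integral>\<^sup>+s. F s \<partial>variation_measure (translate t \<mu>)) = (\<integral>\<^sup>+s. F (s - t) \<partial>variation_measure \<mu>)"
proof -
  have m: "(\<lambda>s. s - t) \<in> measurable (variation_measure \<mu>) borel"
    using borel_measurable_translate(1)[of t] by (simp cong: measurable_cong_sets)
  have "variation_measure (translate t \<mu>) = distr (variation_measure \<mu>) borel (\<lambda>s. s - t)"
  proof (rule measure_eqI)
    fix A assume "A \<in> sets (variation_measure (translate t \<mu>))"
    then have A: "A \<in> sets borel" by simp
    have "emeasure (variation_measure (translate t \<mu>)) A = variation \<mu> ((\<lambda>s. s + t) ` A)"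
      by (simp add: emeasure_variation_measure[OF sigma_additive_translate[OF \<mu>] A]
          variation_translate[of \<mu> A t, OF sigma_additive_empty[OF \<mu>] A])
    also have "\<dots> = emeasure (variation_measure \<mu>) ((\<lambda>s. s - t) -` A)"
      using translate_sets[OF A] by (simp add: emeasure_variation_measure[OF \<mu>] image_add_right)
    finally show "emeasure (variation_measure (translate t \<mu>)) A
      = emeasure (distr (variation_measure \<mu>) borel (\<lambda>s. s - t)) A"
      by (simp add: emeasure_distr[OF m A])
  qed simp
  then show ?thesis using F by (simp add: nn_integral_distr[OF m])
qed

lemma weak_norm_mono: "(\<And>s. F s \<le> H s) \<Longrightarrow> weak_norm \<nu> F \<le> weak_norm \<nu> H"
  unfolding weak_norm_def by (intro SUP_mono) (auto intro!: nn_integral_mono)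

lemma weak_norm_translate:
  fixes \<nu> :: "'g::topological_group_add set \<Rightarrow> 'x::complex_normed_vector"
  assumes \<nu>: "sigma_additive \<nu>" and inv: "semivariation_translation_invariant \<nu>"
    and F: "F \<in> borel_measurable borel" and x': "x' \<in> dual_ball"
  shows "(\<integral>\<^sup>+s. F (s - t) \<partial>dual_variation \<nu> x') \<le> weak_norm \<nu> F"
proof -
  note sa = sigma_additive_weak[OF \<nu> dual_ball_topdual[OF x']]
  have tr: "(\<lambda>B. x' (translate t \<nu> B)) = translate t (\<lambda>B. x' (\<nu> B))" by (simp add:
    translate_def[abs_def])
  obtain U where U: "\<And>i. simple_function borel (U i)" "incseq U" "\<And>i x. U i x < top" "\<And>x. (SUP i.
    U i x) = F x"
    using borel_measurable_implies_simple_function_sequence'[OF F] by metis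
  have "(\<integral>\<^sup>+s. U i s \<partial>variation_measure (translate t (\<lambda>B. x' (\<nu> B)))) \<le> weak_norm \<nu> F" for i
  proof -
    \<comment> \<open>The approximating functions are finite-valued, hence moduli of complex simple
      functions, to which the invariance hypothesis applies.\<close>
    define \<phi> where "\<phi> s = complex_of_real (enn2real (U i s))" for s
    have \<phi>: "simple_function borel \<phi>"
      using simple_function_compose1[OF U(1), of "\<lambda>r. complex_of_real (enn2real r)" i] by (simp
        add: \<phi>_def[abs_def])
    have eq: "U i s = ennreal (cmod (\<phi> s))" for s using U(3)[of i s] by (simp add: \<phi>_def)
    have "(\<integral>\<^sup>+s. U i s \<partial>variation_measure (translate t (\<lambda>B. x' (\<nu> B))))
      \<le> weak_norm (translate t \<nu>) (enorm \<phi>)"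
      using weak_norm_upper[OF x', of "translate t \<nu>" "U i"] by (simp only: tr eq[abs_def])
    also have "\<dots> = weak_norm \<nu> (enorm \<phi>)"
      using inv \<phi> by (simp add: semivariation_translation_invariant_def
          flip: semivariation_simple[OF sigma_additive_translate[OF \<nu>]] semivariation_simple[OF \<nu>])
    also have "\<dots> \<le> weak_norm \<nu> F"
      unfolding eq[symmetric] by (intro weak_norm_mono) (metis U(4) UNIV_I SUP_upper)
    finally show ?thesis .
  qed
  then have "(SUP i. \<integral>\<^sup>+s. U i s \<partial>variation_measure (translate t (\<lambda>B. x' (\<nu> B)))) \<le> weak_norm \<nu> F"
    by (intro SUP_least)
  also have "(SUP i. \<integral>\<^sup>+s. U i s \<partial>variation_measure (translate t (\<lambda>B. x' (\<nu> B))))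
      = (\<integral>\<^sup>+s. F s \<partial>variation_measure (translate t (\<lambda>B. x' (\<nu> B))))"
    unfolding U(4)[symmetric] using U(1)
    by (intro nn_integral_monotone_convergence_SUP[symmetric] U(2))
      (auto dest: borel_measurable_simple_function cong: measurable_cong_sets)
  also have "\<dots> = (\<integral>\<^sup>+s. F (s - t) \<partial>dual_variation \<nu> x')"
    by (rule nn_integral_variation_translate[OF sa F])
  finally show ?thesis .
qed

section \<open>Haar integrals and convolution estimates for an invariant vector measure\<close>

locale invariant_vector_measure =
  fixes \<nu> :: "'g::{topological_group_add,t2_space} set \<Rightarrow> 'x::{complex_normed_vector,banach}"
    and m :: "'g measure"
  assumes compact_G: "compact (UNIV :: 'g set)"
    and haar: "normalized_haar_measure m"
    and regular: "\<nu> \<in> regular_vector_measures"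
    and invariant: "semivariation_translation_invariant \<nu>"
begin

lemma sigma_additive: "sigma_additive \<nu>"
  using regular by (auto simp: regular_vector_measures_def vector_measure_def sigma_additive_def)

abbreviation V :: "('x \<Rightarrow> complex) \<Rightarrow> 'g measure" where
  "V x' \<equiv> dual_variation \<nu> x'"

lemmas sigma_additive_dual = sigma_additive_weak[OF sigma_additive]

lemma sets_m [simp]: "sets m = sets borel" and emeasure_m_UNIV [simp]: "emeasure m UNIV = 1"
  using haar by (auto simp: normalized_haar_measure_def)

lemma space_m [simp]: "space m = UNIV"
  using sets_eq_imp_space_eq[OF sets_m] by simp

lemma measurable_m [simp]: "measurable m N = measurable borel N"
  by (rule measurable_cong_sets) simp_all

lemma measurable_V [simp]: "measurable (V x') N = measurable borel N"
  by (rule measurable_cong_sets) simp_all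

lemma inner_regular_m: "inner_regular m"
proof (rule inner_regularI_closed[OF compact_G])
  show "finite_measure m" by (rule finite_measureI) simp
  fix e :: real and A :: "'g set" assume "0 < e" "A \<in> sets borel"
  then obtain U F where UF: "open U" "closed F" "F \<subseteq> A" "A \<subseteq> U" "emeasure m (U - F) < ennreal e"
    using haar unfolding normalized_haar_measure_def by metis
  have "emeasure m (A - F) \<le> emeasure m (U - F)" using UF by (intro emeasure_mono) auto
  then show "\<exists>F. closed F \<and> F \<subseteq> A \<and> emeasure m (A - F) < ennreal e" using UF by (auto intro:
    le_less_trans)
qed simp

lemma inner_regular_V:
  assumes x': "x' \<in> dual_ball" shows "inner_regular (V x')"
proof (rule inner_regularI_closed[OF compact_G])
  note sa = sigma_additive_dual[OF dual_ball_topdual[OF x']]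
  show "finite_measure (V x')" by (rule finite_variation_measure[OF sa])
  fix e :: real and A :: "'g set" assume "0 < e" and A: "A \<in> sets borel"
  then obtain U F where UF: "open U" "closed F" "F \<subseteq> A" "A \<subseteq> U" "semivariation \<nu> (U - F) < ennreal
    e"
    using regular unfolding regular_vector_measures_def by blast
  have "emeasure (V x') (A - F) \<le> emeasure (V x') (U - F)" using UF by (intro emeasure_mono) auto
  also have "\<dots> = variation (\<lambda>B. x' (\<nu> B)) (U - F)" using UF by (intro emeasure_variation_measure
    sa) auto
  also have "\<dots> \<le> semivariation \<nu> (U - F)" unfolding semivariation_def by (rule SUP_upper[OF x'])
  also note UF(5)
  finally show "\<exists>F. closed F \<and> F \<subseteq> A \<and> emeasure (V x') (A - F) < ennreal e" using UF by auto
qed simp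

lemma continuous_group_diff:
  "continuous_on UNIV (\<lambda>(t::'g, s). t - s)" "continuous_on UNIV (\<lambda>(t::'g, s). - t + s)"
proof -
  have m: "continuous_on UNIV (uminus :: 'g \<Rightarrow> 'g)"
    unfolding continuous_on_def by (auto intro!: tendsto_intros)
  have m': "continuous_on UNIV (\<lambda>x. - f x)" if "continuous_on UNIV f" for f :: "'g \<times> 'g \<Rightarrow> 'g"
    using continuous_on_compose2[OF m that] by simp
  show "continuous_on UNIV (\<lambda>(t::'g, s). - t + s)"
    unfolding case_prod_unfold by (intro continuous_intros m')
  have "continuous_on UNIV (\<lambda>x::'g \<times> 'g. fst x + - snd x)" by (intro continuous_intros m')
  then show "continuous_on UNIV (\<lambda>(t::'g, s). t - s)" by (simp add: case_prod_unfold)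
qed

lemma haar_left:
  assumes F: "F \<in> borel_measurable borel"
  shows "(\<integral>\<^sup>+s. F (t + s) \<partial>m) = (\<integral>\<^sup>+s. F s \<partial>m)"
proof -
  have t: "(\<lambda>s. t + s) \<in> measurable m borel" using borel_measurable_translate(3)[of t] by simp
  have "distr m borel (\<lambda>s. t + s) = m"
  proof (rule measure_eqI)
    fix A assume "A \<in> sets (distr m borel (\<lambda>s. t + s))"
    then have A: "A \<in> sets borel" by simp
    have "(\<lambda>s. t + s) -` A = (\<lambda>s. - t + s) ` A"
      by (auto simp: image_iff) (metis add.assoc add.left_neutral left_minus)+
    then show "emeasure (distr m borel (\<lambda>s. t + s)) A = emeasure m A"
      using haar A by (simp add: emeasure_distr[OF t A] normalized_haar_measure_def)
  qed simp
  then have "(\<integral>\<^sup>+s. F s \<partial>m) = (\<integral>\<^sup>+s. F s \<partial>distr m borel (\<lambda>s. t + s))" by simp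
  then show ?thesis using F by (simp add: nn_integral_distr[OF t])
qed

text \<open>Unimodularity of compact groups. Both inner integrals of F(-t + s) are constant: in
  \<open>s\<close> by left invariance, in \<open>t\<close> after writing -t + s = -(-s + t). Total
  mass 1 removes the outer integrals.\<close>

lemma haar_minus:
  assumes F: "F \<in> borel_measurable borel"
  shows "(\<integral>\<^sup>+s. F (- s) \<partial>m) = (\<integral>\<^sup>+s. F s \<partial>m)"
proof -
  have F': "(\<lambda>t. F (- t)) \<in> borel_measurable borel"
    using measurable_compose[OF borel_measurable_translate(4) F] .
  have "(\<integral>\<^sup>+s. F s \<partial>m) = (\<integral>\<^sup>+t. \<integral>\<^sup>+s. F (- t + s) \<partial>m \<partial>m)"
    by (simp only: haar_left[OF F]) simp
  also have "\<dots> = (\<integral>\<^sup>+s. \<integral>\<^sup>+t. F (- t + s) \<partial>m \<partial>m)"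
    using Tonelli_continuous[OF inner_regular_m inner_regular_m continuous_group_diff(2) F] by blast
  also have "\<dots> = (\<integral>\<^sup>+s. \<integral>\<^sup>+t. F (- (- s + t)) \<partial>m \<partial>m)" by (simp add: minus_add)
  also have "\<dots> = (\<integral>\<^sup>+t. F (- t) \<partial>m)" by (simp only: haar_left[OF F']) simp
  finally show ?thesis by simp
qed

lemma haar_diff:
  assumes F: "F \<in> borel_measurable borel"
  shows "(\<integral>\<^sup>+s. F (t - s) \<partial>m) = (\<integral>\<^sup>+s. F s \<partial>m)"
  using haar_minus[OF measurable_compose[OF borel_measurable_translate(3)[of t] F]] haar_left[OF
    F, of t] by simp

text \<open>F(s - t) is integrated in \<open>s\<close> against |<\<nu>,x'>| and in \<open>t\<close>
  against Haar measure, with \<open>x'\<close> norming \<open>\<nu> UNIV\<close>. Integrating in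
  \<open>t\<close> first leaves the Haar integral of \<open>F\<close> times a total mass of at least
  \<open>norm (\<nu> UNIV)\<close>; in \<open>s\<close> first, each translate is bounded by the weak
  norm.\<close>

lemma norm_times_haar_le:
  assumes F: "F \<in> borel_measurable borel"
  shows "ennreal (norm (\<nu> UNIV)) * (\<integral>\<^sup>+s. F s \<partial>m) \<le> weak_norm \<nu> F"
proof -
  obtain x' where x': "x' \<in> dual_ball" "x' (\<nu> UNIV) = complex_of_real (norm (\<nu> UNIV))"
    using norming_functional by blast
  note sa = sigma_additive_dual[OF dual_ball_topdual[OF x'(1)]]
  have "ennreal (norm (\<nu> UNIV)) = ennreal (cmod (x' (\<nu> UNIV)))" by (simp add: x'(2))
  also have "\<dots> \<le> emeasure (V x') UNIV"
    using emeasure_variation_measure[OF sa, of UNIV] variation_ge[of UNIV UNIV "\<lambda>B. x' (\<nu> B)"]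
      sigma_additive_empty[OF sa] by simp
  finally have "ennreal (norm (\<nu> UNIV)) * (\<integral>\<^sup>+s. F s \<partial>m) \<le> emeasure (V x') UNIV * (\<integral>\<^sup>+s. F s \<partial>m)"
    by (rule mult_right_mono) simp
  also have "\<dots> = (\<integral>\<^sup>+s. \<integral>\<^sup>+t. F (s - t) \<partial>m \<partial>V x')" by (simp add: haar_diff[OF F] mult.commute)
  also have "\<dots> = (\<integral>\<^sup>+t. \<integral>\<^sup>+s. F (s - t) \<partial>V x' \<partial>m)"
    using Tonelli_continuous[OF inner_regular_V[OF x'(1)] inner_regular_m continuous_group_diff(1)
      F] by blast
  also have "\<dots> \<le> (\<integral>\<^sup>+t. weak_norm \<nu> F \<partial>m)"
    by (intro nn_integral_mono weak_norm_translate sigma_additive invariant F x')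
  finally show ?thesis by simp
qed

text \<open>The nonnegative integral makes it exist at every point, possibly with value
  \<infinity>.\<close>

definition conv :: "('g \<Rightarrow> ennreal) \<Rightarrow> ('g \<Rightarrow> ennreal) \<Rightarrow> 'g \<Rightarrow> ennreal" where
  "conv u w t = (\<integral>\<^sup>+s. u (t - s) * w s \<partial>m)"

text \<open>The product u(t - s) w(s) is not a function of \<open>t - s\<close>. With
  \<open>w\<close> as a density the integrand becomes one, as the Tonelli theorem requires.\<close>

lemma conv_eq_density:
  assumes u: "u \<in> borel_measurable borel" and w: "w \<in> borel_measurable borel"
  shows "conv u w t = (\<integral>\<^sup>+s. u (t - s) \<partial>density m w)"
  using measurable_compose[OF borel_measurable_translate(2)[of t] u] w
  by (simp add: conv_def nn_integral_density mult.commute)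

lemma borel_measurable_conv:
  assumes u: "u \<in> borel_measurable borel" and w: "w \<in> borel_measurable borel" "(\<integral>\<^sup>+s. w s \<partial>m) < \<infinity>"
  shows "conv u w \<in> borel_measurable borel"
  using Tonelli_continuous[OF inner_regular_m inner_regular_density[OF inner_regular_m w]
    continuous_group_diff(1) u]
  by (simp add: conv_eq_density[OF u w(1), abs_def])

text \<open>After the interchange the inner integral is that of a right translate of
  \<open>u\<close>, bounded by the weak norm; the mass of \<open>density m w\<close> remains as a
  factor.\<close>

lemma weak_norm_conv_le:
  assumes u: "u \<in> borel_measurable borel" and w: "w \<in> borel_measurable borel" "(\<integral>\<^sup>+s. w s \<partial>m) < \<infinity>"
  shows "weak_norm \<nu> (conv u w) \<le> weak_norm \<nu> u * (\<integral>\<^sup>+s. w s \<partial>m)"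
proof (rule weak_norm_least)
  fix x' :: "'x \<Rightarrow> complex" assume x': "x' \<in> dual_ball"
  have "(\<integral>\<^sup>+t. conv u w t \<partial>V x') = (\<integral>\<^sup>+s. \<integral>\<^sup>+t. u (t - s) \<partial>V x' \<partial>density m w)"
    unfolding conv_eq_density[OF u w(1)]
    using Tonelli_continuous[OF inner_regular_V[OF x'] inner_regular_density[OF inner_regular_m w]
      continuous_group_diff(1) u]
    by blast
  also have "\<dots> \<le> (\<integral>\<^sup>+s. weak_norm \<nu> u \<partial>density m w)"
    by (intro nn_integral_mono weak_norm_translate sigma_additive invariant u x')
  also have "\<dots> = weak_norm \<nu> u * (\<integral>\<^sup>+s. w s \<partial>m)"
    using w by (simp add: emeasure_density cong: nn_integral_cong)
  finally show "(\<integral>\<^sup>+t. conv u w t \<partial>V x') \<le> weak_norm \<nu> u * (\<integral>\<^sup>+s. w s \<partial>m)" .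
qed

end


section \<open>Convolution\<close>

lemma complex_integral_bound_nn:
  assumes \<mu>: "sigma_additive \<mu>" and f: "integrable (variation_measure \<mu>) f" and A: "A \<in> sets borel"
  shows "ennreal (cmod (complex_integral \<mu> A f)) \<le> 4 * (\<integral>\<^sup>+x. ennreal (cmod (f x))
    \<partial>variation_measure \<mu>)"
proof -
  have "ennreal (cmod (complex_integral \<mu> A f)) \<le> ennreal (4 * (\<integral>x. cmod (f x) \<partial>variation_measure
    \<mu>))"
    by (intro ennreal_leI complex_integral_bound assms)
  also have "\<dots> = 4 * (\<integral>\<^sup>+x. ennreal (cmod (f x)) \<partial>variation_measure \<mu>)"
    using f by (simp add: ennreal_mult' nn_integral_eq_integral)
  finally show ?thesis .
qed

lemma borel_measurable_ennreal_norm: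
  "f \<in> borel_measurable M \<Longrightarrow> (\<lambda>s. ennreal (norm (f s))) \<in> borel_measurable M"
  by measurable

text \<open>The constant \<open>c\<close> does not depend on \<open>F\<close>. It carries estimates
  from the dual ball to the whole dual, over which L1(\<nu>) quantifies.\<close>

lemma topdual_integral_le:
  fixes \<nu> :: "'g::topological_space set \<Rightarrow> 'x::complex_normed_vector"
  assumes \<nu>: "sigma_additive \<nu>" and x': "x' \<in> topdual"
  obtains c where "0 < c" "\<And>F. F \<in> borel_measurable borel \<Longrightarrow>
    (\<integral>\<^sup>+s. F s \<partial>dual_variation \<nu> x') \<le> ennreal c * weak_norm \<nu> F"
proof -
  obtain c y' where c: "0 < c" "y' \<in> dual_ball" "x' = (\<lambda>x. complex_of_real c * y' x)"
    using topdual_normalize[OF x'] by blast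
  have "(\<integral>\<^sup>+s. F s \<partial>dual_variation \<nu> x') = ennreal c * (\<integral>\<^sup>+s. F s \<partial>dual_variation \<nu> y')"
    if "F \<in> borel_measurable borel" for F
  proof (rule nn_integral_cmult_measure)
    fix A :: "'g set" assume A: "A \<in> sets borel"
    show "emeasure (dual_variation \<nu> x') A = ennreal c * emeasure (dual_variation \<nu> y') A"
      unfolding emeasure_variation_measure[OF sigma_additive_weak[OF \<nu> x'] A]
        emeasure_variation_measure[OF sigma_additive_weak[OF \<nu> dual_ball_topdual[OF c(2)]] A]
      using c(1) by (simp add: c(3) variation_cmult)
  qed (use that in auto)
  then show ?thesis using c that weak_norm_upper[OF c(2)] by (metis mult_left_mono zero_le)
qed

text \<open>Simple functions have explicit vector integrals. Their weak errors are uniformly small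
  on the dual ball, so norming functionals make these integrals a Cauchy sequence; completeness
  gives a limit, which is then checked against every functional.\<close>

lemma L1v_approx:
  fixes \<nu> :: "'g::topological_space set \<Rightarrow> 'x::{complex_normed_vector,banach}"
  assumes \<nu>: "sigma_additive \<nu>" and f: "f \<in> borel_measurable borel"
    and fin: "weak_norm \<nu> (enorm f) < \<infinity>"
    and approx: "\<And>e. 0 < e \<Longrightarrow> \<exists>\<phi>. simple_function borel \<phi>
      \<and> weak_norm \<nu> (\<lambda>s. ennreal (cmod (\<phi> s - f s))) \<le> ennreal e"
  shows "f \<in> L1v \<nu>"
proof -
  have int_f: "integrable (dual_variation \<nu> x') f" if x': "x' \<in> topdual" for x'
  proof -
    obtain c where "0 < c" "(\<integral>\<^sup>+s. ennreal (cmod (f s)) \<partial>dual_variation \<nu> x')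
      \<le> ennreal c * weak_norm \<nu> (enorm f)"
      using topdual_integral_le[OF \<nu> x'] f by (metis borel_measurable_norm measurable_compose
        measurable_ennreal)
    then have "(\<integral>\<^sup>+s. ennreal (cmod (f s)) \<partial>dual_variation \<nu> x') < \<infinity>"
      using fin by (auto intro: le_less_trans simp: ennreal_mult_less_top)
    then show ?thesis using f by (simp add: integrable_iff_bounded cong: measurable_cong_sets)
  qed
  have int_simple: "integrable (dual_variation \<nu> x') \<phi>"
    if x': "x' \<in> topdual" and \<phi>: "simple_function borel \<phi>" for x' and \<phi> :: "'g \<Rightarrow> complex"
  proof -
    interpret finite_measure "dual_variation \<nu> x'"
      by (intro finite_variation_measure sigma_additive_weak \<nu> x')
    have "simple_function (dual_variation \<nu> x') \<phi>" using \<phi> by (simp add: simple_function_def)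
    then show ?thesis by (rule integrable_simple_function) simp
  qed
  have ex: "\<exists>x. is_integral \<nu> f A x" if A: "A \<in> sets borel" for A
  proof -
    let ?I = "\<lambda>x'. complex_integral (\<lambda>B. x' (\<nu> B)) A f"
    have "\<forall>n::nat. \<exists>\<phi>. simple_function borel \<phi> \<and> weak_norm \<nu> (\<lambda>s. ennreal (cmod (\<phi> s - f s)))
      \<le> ennreal (1 / Suc n)"
      by (intro allI approx) simp
    then obtain \<phi> where \<phi>: "\<And>n. simple_function borel (\<phi> n)"
        "\<And>n. weak_norm \<nu> (\<lambda>s. ennreal (cmod (\<phi> n s - f s))) \<le> ennreal (1 / Suc n)" by metis
    note \<phi>_meas = borel_measurable_simple_function[OF \<phi>(1)]
    define X where "X n = vector_integral \<nu> (\<phi> n) A" for n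
    have X: "x' (X n) = complex_integral (\<lambda>B. x' (\<nu> B)) A (\<phi> n)" if "x' \<in> topdual" for x' n
      using vector_integral_simple[OF \<nu> \<phi>(1) A, of n] that by (simp add: is_integral_def X_def)
    have diff: "ennreal (cmod (x' (X n) - ?I x'))
        \<le> 4 * (\<integral>\<^sup>+s. ennreal (cmod (\<phi> n s - f s)) \<partial>dual_variation \<nu> x')" if x': "x'
          \<in> topdual" for x' n
      unfolding X[OF x'] complex_integral_diff[OF sigma_additive_weak[OF \<nu> x'] int_simple[OF x'
        \<phi>(1)] int_f[OF x'] A, symmetric]
      by (intro complex_integral_bound_nn sigma_additive_weak \<nu> x' A
        Bochner_Integration.integrable_diff int_simple int_f \<phi>)
    have est1: "cmod (x' (X n) - ?I x') \<le> 4 / Suc n" if x': "x' \<in> dual_ball" for x' n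
    proof -
      have "ennreal (cmod (x' (X n) - ?I x')) \<le> 4 * ennreal (1 / Suc n)"
        using diff[OF dual_ball_topdual[OF x'], of n]
          mult_left_mono[OF order_trans[OF weak_norm_upper[OF x'] \<phi>(2)[of n]], of 4]
        by (meson order_trans zero_le)
      also have "4 * ennreal (1 / Suc n) = ennreal (4 / Suc n)" using ennreal_mult'[of 4 "1 / Suc
        n"] by simp
      finally show ?thesis by simp
    qed
    have "Cauchy X"
    proof (rule metric_CauchyI)
      fix e :: real assume "0 < e"
      \<comment> \<open>8 = 4 + 4: two weak errors, each with the factor 4 of the Jordan
        parts.\<close>
      then obtain N :: nat where N: "8 / e < N" using reals_Archimedean2 by blast
      show "\<exists>M. \<forall>i\<ge>M. \<forall>j\<ge>M. dist (X i) (X j) < e"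
      proof (intro exI[of _ N] allI impI)
        fix i j assume ij: "N \<le> i" "N \<le> j"
        obtain y' where y': "y' \<in> dual_ball" "y' (X i - X j) = complex_of_real (norm (X i - X j))"
          using norming_functional[of "X i - X j"] by blast
        have "norm (X i - X j) = cmod (y' (X i - X j))" by (simp add: y'(2))
        also have "y' (X i - X j) = (y' (X i) - ?I y') - (y' (X j) - ?I y')"
          by (simp add: linear_diff[OF bounded_linear.linear[OF topdual_linear[OF
            dual_ball_topdual[OF y'(1)]]]])
        also have "cmod \<dots> \<le> 4 / Suc i + 4 / Suc j"
          by (intro order_trans[OF norm_triangle_ineq4] add_mono est1 y')
        also have "\<dots> \<le> 4 / Suc N + 4 / Suc N" using ij by (intro add_mono divide_left_mono) auto
        also have "\<dots> = 8 / Suc N" by (simp add: add_divide_distrib[symmetric])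
        also have "\<dots> < e"
        proof -
          have "8 < e * N" using N \<open>0 < e\<close> by (simp add: field_simps)
          also have "\<dots> \<le> e * Suc N" using \<open>0 < e\<close> by simp
          finally show ?thesis by (simp add: pos_divide_less_eq)
        qed
        finally show "dist (X i) (X j) < e" by (simp add: dist_norm)
      qed
    qed
    then obtain x where x: "X \<longlonglongrightarrow> x" using Cauchy_convergent convergent_def by blast
    have "x' x = ?I x'" if x': "x' \<in> topdual" for x'
    proof (rule LIMSEQ_unique)
      show "(\<lambda>n. x' (X n)) \<longlonglongrightarrow> x' x" by (rule bounded_linear.tendsto[OF topdual_linear[OF x'] x])
      \<comment> \<open>Outside the dual ball the error is multiplied by a constant that depends on
        \<open>x'\<close> but not on \<open>n\<close>.\<close>
      obtain c where c: "0 < c" "\<And>F. F \<in> borel_measurable borel \<Longrightarrow>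
          (\<integral>\<^sup>+s. F s \<partial>dual_variation \<nu> x') \<le> ennreal c * weak_norm \<nu> F"
        using topdual_integral_le[OF \<nu> x'] by blast
      have est: "cmod (x' (X n) - ?I x') \<le> 4 * c * (1 / Suc n)" for n
      proof -
        have "(\<integral>\<^sup>+s. ennreal (cmod (\<phi> n s - f s)) \<partial>dual_variation \<nu> x')
            \<le> ennreal c * weak_norm \<nu> (\<lambda>s. ennreal (cmod (\<phi> n s - f s)))"
          using \<phi>_meas[of n] f by (intro c) measurable
        also have "\<dots> \<le> ennreal c * ennreal (1 / Suc n)" by (intro mult_left_mono \<phi>) simp
        finally have "ennreal (cmod (x' (X n) - ?I x')) \<le> 4 * (ennreal c * ennreal (1 / Suc n))"
          using diff[OF x', of n] by (meson mult_left_mono order_trans zero_le)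
        also have "\<dots> = ennreal (4 * c * (1 / Suc n))"
          using c(1) ennreal_mult'[of 4 "c * (1 / Suc n)"] ennreal_mult'[of c "1 / Suc n"] by simp
        finally show ?thesis using c(1) by simp
      qed
      have "(\<lambda>n. x' (X n) - ?I x') \<longlonglongrightarrow> 0"
      proof (rule Lim_null_comparison)
        show "\<forall>\<^sub>F n in sequentially. cmod (x' (X n) - ?I x') \<le> 4 * c * (1 / Suc n)"
          using est by simp
        show "(\<lambda>n. 4 * c * (1 / real (Suc n))) \<longlonglongrightarrow> 0"
          using tendsto_mult_right_zero[OF LIMSEQ_inverse_real_of_nat, of "4 * c"] by (simp add:
            divide_inverse)
      qed
      then show "(\<lambda>n. x' (X n)) \<longlonglongrightarrow> ?I x'" by (rule LIM_zero_cancel)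
    qed
    then show ?thesis by (auto simp: is_integral_def)
  qed
  have "\<exists>!x. is_integral \<nu> f A x" if A: "A \<in> sets borel" for A
  proof (rule ex_ex1I[OF ex[OF A]])
    fix x y assume "is_integral \<nu> f A x" "is_integral \<nu> f A y"
    then show "x = y" unfolding is_integral_def by (intro topdual_separates) metis
  qed
  then show ?thesis using int_f by (simp add: L1v_def)
qed

lemma L1vD:
  fixes \<nu> :: "'g::topological_space set \<Rightarrow> 'x::complex_normed_vector"
  assumes \<nu>: "sigma_additive \<nu>" and f: "f \<in> L1v \<nu>"
  shows "f \<in> borel_measurable borel" "weak_norm \<nu> (enorm f) < \<infinity>"
proof -
  have int: "integrable (dual_variation \<nu> x') f" if "x' \<in> topdual" for x'
    using f that by (simp add: L1v_def)
  show fm: "f \<in> borel_measurable borel"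
    \<comment> \<open>The zero functional always lies in the dual, so there is at least one
      integrability condition from which to read off Borel measurability.\<close>
    using borel_measurable_integrable[OF int[OF dual_ball_topdual[OF zero_dual_ball]]]
    by (simp cong: measurable_cong_sets)
  show "weak_norm \<nu> (enorm f) < \<infinity>"
    using int fm by (intro weak_norm_finite \<nu>) (auto simp: integrable_iff_bounded)
qed

lemma L1v_norm_eq: "L1v_norm \<nu> f = enn2real (weak_norm \<nu> (enorm f))"
  by (simp add: L1v_norm_def weak_norm_def)

lemma weak_norm_add:
  assumes "F \<in> borel_measurable borel" "H \<in> borel_measurable borel"
  shows "weak_norm \<nu> (\<lambda>s. F s + H s) \<le> weak_norm \<nu> F + weak_norm \<nu> H"
proof (rule weak_norm_least)
  fix x' :: "'b \<Rightarrow> complex" assume x': "x' \<in> dual_ball"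
  have "(\<integral>\<^sup>+s. F s + H s \<partial>dual_variation \<nu> x')
      = (\<integral>\<^sup>+s. F s \<partial>dual_variation \<nu> x') + (\<integral>\<^sup>+s. H s \<partial>dual_variation \<nu> x')"
    using assms by (intro nn_integral_add) (simp_all cong: measurable_cong_sets)
  also have "\<dots> \<le> weak_norm \<nu> F + weak_norm \<nu> H" by (intro add_mono weak_norm_upper x')
  finally show "(\<integral>\<^sup>+s. F s + H s \<partial>dual_variation \<nu> x') \<le> weak_norm \<nu> F + weak_norm \<nu> H" .
qed

lemma weak_norm_cmult:
  assumes "F \<in> borel_measurable borel"
  shows "weak_norm \<nu> (\<lambda>s. c * F s) = c * weak_norm \<nu> F"
  unfolding weak_norm_def SUP_mult_left_ennreal
  using assms by (intro SUP_cong refl nn_integral_cmult) (simp cong: measurable_cong_sets)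

lemma simple_function_approx:
  fixes h :: "'a::topological_space \<Rightarrow> real"
  assumes h: "h \<in> borel_measurable borel" and bd: "\<And>t. 0 \<le> h t" "\<And>t. h t \<le> B" and \<delta>: "0 < \<delta>"
  obtains \<phi> :: "'a \<Rightarrow> real" where "simple_function borel \<phi>" "\<And>t. \<bar>\<phi> t - h t\<bar> \<le> \<delta>"
proof
  \<comment> \<open>Rounding down to a multiple of \<open>\<delta>\<close>; boundedness of
    \<open>h\<close> leaves finitely many values.\<close>
  define \<phi> where "\<phi> t = \<delta> * real_of_int \<lfloor>h t / \<delta>\<rfloor>" for t
  have "\<phi> \<in> borel_measurable borel" unfolding \<phi>_def using h by measurable
  moreover have "\<lfloor>h t / \<delta>\<rfloor> \<in> {0..\<lfloor>B / \<delta>\<rfloor>}" for t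
    using bd[of t] \<delta> by (auto intro!: floor_mono divide_right_mono)
  then have "range \<phi> \<subseteq> (\<lambda>k. \<delta> * real_of_int k) ` {0..\<lfloor>B / \<delta>\<rfloor>}" by (auto simp: \<phi>_def)
  then have "finite (range \<phi>)" by (rule finite_subset) simp
  ultimately show "simple_function borel \<phi>" by (intro simple_function_borel_measurable) auto
  fix t
  have "real_of_int \<lfloor>h t / \<delta>\<rfloor> \<le> h t / \<delta>" "h t / \<delta> < real_of_int \<lfloor>h t / \<delta>\<rfloor> + 1" by linarith+
  then have "real_of_int \<lfloor>h t / \<delta>\<rfloor> * \<delta> \<le> h t" "h t < (real_of_int \<lfloor>h t / \<delta>\<rfloor> + 1) * \<delta>"
    using pos_le_divide_eq[OF \<delta>] pos_divide_less_eq[OF \<delta>] by blast+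
  then have "\<phi> t \<le> h t" "h t < \<phi> t + \<delta>" by (simp_all add: \<phi>_def algebra_simps)
  then show "\<bar>\<phi> t - h t\<bar> \<le> \<delta>" by linarith
qed

text \<open>The tangent at \<open>a\<close> to the convex function y^p lies below its graph. This
  follows from Young's inequality with weights 1/p and 1 - 1/p for y^p and a^p.\<close>

lemma powr_tangent:
  fixes a y p :: real
  assumes "1 \<le> p" "0 < a" "0 \<le> y"
  shows "a powr p + p * a powr (p - 1) * (y - a) \<le> y powr p"
proof -
  have a: "a * a powr (p - 1) = a powr p" using assms powr_add[of a 1 "p - 1"] by simp
  have "p * (y * a powr (p - 1)) \<le> y powr p + (p - 1) * a powr p"
  proof (cases "y = 0")
    case False
    have "(y powr p) powr (1 / p) * (a powr p) powr (1 - 1 / p)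
      \<le> (1 / p) * y powr p + (1 - 1 / p) * a powr p"
      using assms False by (intro Youngs_inequality_0) auto
    moreover have "(y powr p) powr (1 / p) = y" "(a powr p) powr (1 - 1 / p) = a powr (p - 1)"
      using assms by (simp_all add: powr_powr right_diff_distrib)
    ultimately show ?thesis using assms by (simp add: field_simps)
  qed (use assms in simp)
  then show ?thesis by (simp add: algebra_simps a)
qed

text \<open>Jensen's inequality for the measure with density \<open>F\<close>.\<close>

lemma integral_powr_le:
  fixes F \<Gamma> :: "'a \<Rightarrow> real" and k :: "'a \<Rightarrow> complex"
  assumes [measurable]: "F \<in> borel_measurable M" "\<Gamma> \<in> borel_measurable M" "k \<in> borel_measurable M"
    and nonneg: "\<And>s. 0 \<le> F s" "\<And>s. 0 \<le> \<Gamma> s" and k: "\<And>s. cmod (k s) \<le> F s * \<Gamma> s"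
    and A: "0 \<le> A" "(\<integral>\<^sup>+s. ennreal (F s) \<partial>M) = ennreal A" and p: "1 \<le> p"
  shows "ennreal (cmod (\<integral>s. k s \<partial>M) powr p) \<le> ennreal (A powr (p - 1)) * (\<integral>\<^sup>+s. ennreal (F s) *
    ennreal (\<Gamma> s powr p) \<partial>M)"
proof (cases "cmod (\<integral>s. k s \<partial>M) = 0")
  case False
  have F: "integrable M F" using A nonneg by (simp add: integrable_iff_bounded)
  \<comment> \<open>For \<open>A = 0\<close> the right-hand side is 0, even if \<open>p = 1\<close>,
    because \<open>0 powr 0 = 0\<close>. But then \<open>F\<close>, and with it \<open>k\<close>,
    vanishes almost everywhere, against the case assumption.\<close>
  have A0: "0 < A"
  proof (rule ccontr)
    assume "\<not> 0 < A"
    then have "AE s in M. ennreal (F s) = 0" using A by (simp add: nn_integral_0_iff_AE)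
    then have "AE s in M. k s = 0"
    proof eventually_elim
      fix s assume "ennreal (F s) = 0"
      then show "k s = 0" using k[of s] nonneg(1)[of s] by (simp add: ennreal_eq_0_iff)
    qed
    then have "(\<integral>s. k s \<partial>M) = (\<integral>s. 0 \<partial>M)" by (intro integral_cong_AE) auto
    then show False using False by simp
  qed
  show ?thesis
  proof (cases "(\<integral>\<^sup>+s. ennreal (F s) * ennreal (\<Gamma> s powr p) \<partial>M) = \<infinity>")
    case True
    then show ?thesis using A0 by (simp add: ennreal_mult_top)
  next
    case fin: False
    have FG: "integrable M (\<lambda>s. F s * \<Gamma> s powr p)"
      using fin nonneg by (simp add: integrable_iff_bounded less_top ennreal_mult)
    have "\<Gamma> s \<le> 1 + \<Gamma> s powr p" for s
    proof (cases "\<Gamma> s \<le> 1")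
      case False
      then have "\<Gamma> s powr 1 \<le> \<Gamma> s powr p" using p by (intro powr_mono) auto
      then show ?thesis using False by simp
    qed (simp add: add_increasing2)
    then have le: "F s * \<Gamma> s \<le> F s + F s * \<Gamma> s powr p" for s
      using mult_left_mono[of "\<Gamma> s" "1 + \<Gamma> s powr p" "F s"] nonneg(1)[of s] by (simp add:
        distrib_left)
    have F1: "integrable M (\<lambda>s. F s * \<Gamma> s)"
      by (rule Bochner_Integration.integrable_bound[OF Bochner_Integration.integrable_add[OF F FG]])
        (use le nonneg in \<open>auto intro!: AE_I2 simp: abs_mult\<close>)
    define I where "I = (\<integral>s. F s * \<Gamma> s \<partial>M)"
    have kI: "cmod (\<integral>s. k s \<partial>M) \<le> I"
    proof -
      have "integrable M k"
        by (rule Bochner_Integration.integrable_bound[OF F1]) (use k nonneg in \<open>auto intro!: AE_I2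
          simp: abs_mult\<close>)
      then show ?thesis unfolding I_def
        using F1 k by (intro order_trans[OF integral_norm_bound] integral_mono) auto
    qed
    then have I: "0 < I" using False by (smt (verit) norm_ge_zero)
    \<comment> \<open>\<open>a\<close> is the mean of \<open>\<Gamma>\<close> for the normalized
      weight F / A; with the tangent taken there, the linear term integrates to 0.\<close>
    define a where "a = I / A"
    have a: "0 < a" "a * A = I" using I A0 by (auto simp: a_def)
    have AF: "(\<integral>s. F s \<partial>M) = A" using A nonneg by (simp add: integral_eq_nn_integral)
    have "a powr p * A + p * a powr (p - 1) * (I - a * A)
      = (\<integral>s. a powr p * F s + p * a powr (p - 1) * (F s * \<Gamma> s - a * F s) \<partial>M)"
      using F F1 by (simp add: AF I_def)
    also have "\<dots> \<le> (\<integral>s. F s * \<Gamma> s powr p \<partial>M)"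
    proof (rule integral_mono)
      show "integrable M (\<lambda>s. a powr p * F s + p * a powr (p - 1) * (F s * \<Gamma> s - a * F s))" using
        F F1 by simp
      fix s
      have "F s * (a powr p + p * a powr (p - 1) * (\<Gamma> s - a)) \<le> F s * \<Gamma> s powr p"
        using nonneg by (intro mult_left_mono powr_tangent p a)
      then show "a powr p * F s + p * a powr (p - 1) * (F s * \<Gamma> s - a * F s) \<le> F s * \<Gamma> s powr p"
        by (simp add: algebra_simps)
    qed (rule FG)
    finally have *: "a powr p * A \<le> (\<integral>s. F s * \<Gamma> s powr p \<partial>M)" by (simp add: a(2))
    have "cmod (\<integral>s. k s \<partial>M) powr p \<le> I powr p" using kI p by (intro powr_mono2) auto
    also have "I powr p = A powr (p - 1) * (a powr p * A)"
      using a A0 powr_add[of A "p - 1" 1] by (simp add: a(2)[symmetric] powr_mult)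
    also have "\<dots> \<le> A powr (p - 1) * (\<integral>s. F s * \<Gamma> s powr p \<partial>M)" using * by (intro mult_left_mono)
      auto
    finally have "ennreal (cmod (\<integral>s. k s \<partial>M) powr p) \<le> ennreal (A powr (p - 1) * (\<integral>s. F s * \<Gamma> s
      powr p \<partial>M))"
      by (rule ennreal_leI)
    also have "\<dots> = ennreal (A powr (p - 1)) * (\<integral>\<^sup>+s. ennreal (F s * \<Gamma> s powr p) \<partial>M)"
      using nn_integral_eq_integral[OF FG] nonneg by (simp only: ennreal_mult' powr_ge_zero) simp
    also have "(\<integral>\<^sup>+s. ennreal (F s * \<Gamma> s powr p) \<partial>M) = (\<integral>\<^sup>+s. ennreal (F s) * ennreal (\<Gamma> s powr p)
      \<partial>M)"
      using nonneg by (simp add: ennreal_mult)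
    finally show ?thesis .
  qed
qed simp

text \<open>For k = 0, 1, 2, 3 these are the positive parts of Re z, Im z, -Re z, -Im z, which
  recover \<open>z\<close> with the coefficients i^k.\<close>

definition quarter_part :: "nat \<Rightarrow> complex \<Rightarrow> real" where
  "quarter_part k z = max 0 (Re ((- \<i>) ^ k * z))"

lemma quarter_part_sum: "(\<Sum>k<4. \<i> ^ k * complex_of_real (quarter_part k z)) = z"
  by (auto simp: quarter_part_def complex_eq_iff eval_nat_numeral max_def)

lemma quarter_part_bound: "0 \<le> quarter_part k z" "quarter_part k z \<le> cmod z"
  using complex_Re_le_cmod[of "(- \<i>) ^ k * z"] by (auto simp: quarter_part_def norm_mult norm_power)

lemma borel_measurable_quarter_part [measurable]: "quarter_part k \<in> borel_measurable borel"
  unfolding quarter_part_def[abs_def]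
  by (intro borel_measurable_continuous_onI continuous_intros)

section \<open>Measurability of the complex convolution\<close>

context invariant_vector_measure
begin

lemma conv_finite_sets:
  assumes f: "f \<in> borel_measurable borel" and g: "g \<in> borel_measurable borel"
    and fin: "(\<integral>\<^sup>+s. ennreal (cmod (g s)) \<partial>m) < \<infinity>"
  shows "{t. conv (enorm f) (enorm g) t < \<infinity>} \<in> sets borel"
proof -
  have "conv (enorm f) (enorm g) \<in> borel_measurable borel"
    by (intro borel_measurable_conv fin borel_measurable_ennreal_norm f g)
  then have "{t \<in> space borel. conv (enorm f) (enorm g) t < \<infinity>} \<in> sets borel"
    by measurable
  then show ?thesis by simp
qed

text \<open>Where it converges absolutely, the convolution is a combination of sixteen convolutions
  of nonnegative functions, whose measurability comes from the Tonelli theorem.\<close>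

lemma convolution_eq_parts:
  fixes f g :: "'g \<Rightarrow> complex"
  assumes f: "f \<in> borel_measurable borel" and g: "g \<in> borel_measurable borel"
    and fin: "conv (enorm f) (enorm g) t < \<infinity>"
  shows "convolution m f g t = (\<Sum>k<4. \<Sum>l<4. \<i> ^ k * \<i> ^ l *
    complex_of_real (enn2real (conv (\<lambda>s. ennreal (quarter_part k (f s))) (\<lambda>s. ennreal
      (quarter_part l (g s))) t)))"
proof -
  have ft [measurable]: "(\<lambda>s. f (t - s)) \<in> borel_measurable borel"
    using measurable_compose[OF borel_measurable_translate(2)[of t] f] .
  note [measurable] = g
  have int: "integrable m (\<lambda>s. complex_of_real (quarter_part k (f (t - s)) * quarter_part l (g
    s)))" for k l
  proof (rule integrableI_bounded)
    have "(\<integral>\<^sup>+s. ennreal (cmod (complex_of_real (quarter_part k (f (t - s)) * quarter_part l (g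
      s)))) \<partial>m)
        \<le> (\<integral>\<^sup>+s. ennreal (cmod (f (t - s))) * ennreal (cmod (g s)) \<partial>m)"
      by (intro nn_integral_mono)
        (auto simp: abs_mult norm_mult quarter_part_bound abs_of_nonneg simp flip: ennreal_mult
          intro!: ennreal_leI mult_mono)
    also have "\<dots> < \<infinity>" using fin by (simp add: conv_def)
    finally show "(\<integral>\<^sup>+s. ennreal (cmod (complex_of_real (quarter_part k (f (t - s)) * quarter_part
      l (g s)))) \<partial>m) < \<infinity>" .
  qed simp
  have parts: "(\<integral>s. complex_of_real (quarter_part k (f (t - s)) * quarter_part l (g s)) \<partial>m)
    = complex_of_real (enn2real (conv (\<lambda>s. ennreal (quarter_part k (f s))) (\<lambda>s. ennreal
      (quarter_part l (g s))) t))" for k l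
    unfolding integral_complex_of_real conv_def
    by (subst integral_eq_nn_integral) (auto simp: quarter_part_bound ennreal_mult)
  have "convolution m f g t = (\<integral>s. (\<Sum>k<4. \<Sum>l<4. (\<i> ^ k * \<i> ^ l) * complex_of_real (quarter_part k
    (f (t - s)) * quarter_part l (g s))) \<partial>m)"
    unfolding convolution_def
  proof (rule Bochner_Integration.integral_cong[OF refl])
    fix s
    have "f (t - s) * g s = (\<Sum>k<4. \<i> ^ k * complex_of_real (quarter_part k (f (t - s)))) * (\<Sum>l<4.
      \<i> ^ l * complex_of_real (quarter_part l (g s)))"
      by (simp only: quarter_part_sum)
    also have "\<dots> = (\<Sum>k<4. \<Sum>l<4. (\<i> ^ k * \<i> ^ l) * complex_of_real (quarter_part k (f (t - s)) *
      quarter_part l (g s)))"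
      unfolding sum_product by (intro sum.cong refl) simp
    finally show "f (t - s) * g s = (\<Sum>k<4. \<Sum>l<4. (\<i> ^ k * \<i> ^ l) * complex_of_real (quarter_part k
      (f (t - s)) * quarter_part l (g s)))" .
  qed
  also have "\<dots> = (\<Sum>k<4. \<Sum>l<4. (\<i> ^ k * \<i> ^ l) * (\<integral>s. complex_of_real (quarter_part k (f (t - s)) *
    quarter_part l (g s)) \<partial>m))"
    using int by (simp add: Bochner_Integration.integral_sum)
  finally show ?thesis by (simp only: parts)
qed

lemma borel_measurable_convolution:
  fixes f g :: "'g \<Rightarrow> complex"
  assumes f: "f \<in> borel_measurable borel" and g: "g \<in> borel_measurable borel"
    and fin: "(\<integral>\<^sup>+s. ennreal (cmod (g s)) \<partial>m) < \<infinity>"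
  shows "convolution m f g \<in> borel_measurable borel"
proof -
  let ?D = "{t. conv (enorm f) (enorm g) t < \<infinity>}"
  let ?S = "\<lambda>t. \<Sum>k<4. \<Sum>l<4. \<i> ^ k * \<i> ^ l *
    complex_of_real (enn2real (conv (\<lambda>s. ennreal (quarter_part k (f s))) (\<lambda>s. ennreal
      (quarter_part l (g s))) t))"
  have [measurable]: "conv (\<lambda>s. ennreal (quarter_part k (f s))) (\<lambda>s. ennreal (quarter_part l (g
    s))) \<in> borel_measurable borel" for k l
  proof (rule borel_measurable_conv)
    have "(\<integral>\<^sup>+s. ennreal (quarter_part l (g s)) \<partial>m) \<le> (\<integral>\<^sup>+s. ennreal (cmod (g s)) \<partial>m)"
      by (intro nn_integral_mono ennreal_leI quarter_part_bound)
    then show "(\<integral>\<^sup>+s. ennreal (quarter_part l (g s)) \<partial>m) < \<infinity>" using fin by simp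
  qed (use f g in measurable)
  have "convolution m f g = (\<lambda>t. if t \<in> ?D then ?S t else 0)"
  proof
    fix t
    show "convolution m f g t = (if t \<in> ?D then ?S t else 0)"
    proof (cases "t \<in> ?D")
      case True
      then show ?thesis using convolution_eq_parts[OF f g, of t] by simp
    next
      case False
      \<comment> \<open>Without absolute convergence the Bochner integral has the default value 0,
        which the case distinction has to match.\<close>
      then have "\<not> integrable m (\<lambda>s. f (t - s) * g s)"
        by (simp add: integrable_iff_bounded conv_def norm_mult ennreal_mult)
      then show ?thesis using False by (simp add: convolution_def not_integrable_integral_eq)
    qed
  qed
  moreover have "(\<lambda>t. if t \<in> ?D then ?S t else 0) \<in> borel_measurable borel"
  proof (rule measurable_If_set)
    have "(\<lambda>t. complex_of_real (enn2real (conv (\<lambda>s. ennreal (quarter_part k (f s))) (\<lambda>s. ennreal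
      (quarter_part l (g s))) t))) \<in> borel_measurable borel" for k l
      by measurable
    then show "?S \<in> borel_measurable borel"
      by (intro borel_measurable_sum borel_measurable_times borel_measurable_const)
  qed (use conv_finite_sets[OF f g fin] in simp_all)
  ultimately show ?thesis by simp
qed

section \<open>Truncation and domination by a convolution\<close>

lemma weak_norm_const_finite:
  obtains K where "0 \<le> K" "weak_norm \<nu> (\<lambda>_. 1) = ennreal K"
proof -
  have "weak_norm \<nu> (\<lambda>_. 1) < \<infinity>"
  proof (rule weak_norm_finite[OF sigma_additive])
    fix x' :: "'x \<Rightarrow> complex" assume x': "x' \<in> topdual"
    interpret finite_measure "V x'" by (intro finite_variation_measure sigma_additive_dual x')
    show "(\<integral>\<^sup>+s. 1 \<partial>V x') < \<infinity>" by (simp add: less_top[symmetric])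
  qed simp
  then show ?thesis using that by (cases "weak_norm \<nu> (\<lambda>_. 1)") auto
qed

text \<open>The truncations increase to \<open>w\<close> pointwise, also where \<open>w\<close> is
  infinite; finiteness of the integral of \<open>w\<close> permits the subtraction.\<close>

lemma truncation_small:
  assumes w: "w \<in> borel_measurable borel" and fin: "(\<integral>\<^sup>+s. w s \<partial>m) < \<infinity>" and e: "0 < e"
  obtains n :: nat where "(\<integral>\<^sup>+s. w s - min (w s) (of_nat n) \<partial>m) \<le> e"
proof -
  have SUP: "(SUP n::nat. min (w s) (of_nat n)) = w s" for s
  proof -
    have "(SUP n::nat. min (w s) (of_nat n)) = min (w s) (SUP n::nat. of_nat n)"
      by (simp add: inf_min[symmetric] inf_SUP)
    then show ?thesis by (simp add: ennreal_SUP_of_nat_eq_top)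
  qed
  have "(\<integral>\<^sup>+s. (SUP n::nat. min (w s) (of_nat n)) \<partial>m) = (SUP n::nat. \<integral>\<^sup>+s. min (w s) (of_nat n) \<partial>m)"
    using w by (intro nn_integral_monotone_convergence_SUP)
      (auto simp: incseq_def le_fun_def intro: min.coboundedI2)
  then have "(\<integral>\<^sup>+s. w s \<partial>m) = (SUP n::nat. \<integral>\<^sup>+s. min (w s) (of_nat n) \<partial>m)" by (simp only: SUP)
  note W = this
  have "\<exists>n::nat. (\<integral>\<^sup>+s. w s \<partial>m) \<le> (\<integral>\<^sup>+s. min (w s) (of_nat n) \<partial>m) + e"
  proof (rule ccontr)
    assume "\<not> ?thesis"
    then have "(SUP n::nat. (\<integral>\<^sup>+s. min (w s) (of_nat n) \<partial>m) + e) \<le> (\<integral>\<^sup>+s. w s \<partial>m)"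
      by (intro SUP_least) (auto simp: not_le intro: less_imp_le)
    then have "(\<integral>\<^sup>+s. w s \<partial>m) + e \<le> (\<integral>\<^sup>+s. w s \<partial>m) + 0"
      by (simp add: ennreal_SUP_add_left W[symmetric])
    then show False using e fin by (simp only: ennreal_add_left_cancel_le) auto
  qed
  then obtain n :: nat where n: "(\<integral>\<^sup>+s. w s \<partial>m) \<le> (\<integral>\<^sup>+s. min (w s) (of_nat n) \<partial>m) + e" ..
  have le: "(\<integral>\<^sup>+s. min (w s) (of_nat n) \<partial>m) \<le> (\<integral>\<^sup>+s. w s \<partial>m)" by (intro nn_integral_mono) simp
  have "(\<integral>\<^sup>+s. w s - min (w s) (of_nat n) \<partial>m) = (\<integral>\<^sup>+s. w s \<partial>m) - (\<integral>\<^sup>+s. min (w s) (of_nat n) \<partial>m)"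
    using w fin le by (intro nn_integral_diff) (auto simp: less_top[symmetric] top_unique)
  also have "\<dots> \<le> e" using n fin by (auto simp add: ennreal_minus_le_iff)
  finally show ?thesis using that by blast
qed

lemma conv_add:
  assumes "u \<in> borel_measurable borel" "w \<in> borel_measurable borel" "w' \<in> borel_measurable borel"
  shows "conv u (\<lambda>s. w s + w' s) t = conv u w t + conv u w' t"
  unfolding conv_def distrib_left
  using measurable_compose[OF borel_measurable_translate(2)[of t] assms(1)] assms(2,3)
  by (intro nn_integral_add) simp_all

text \<open>Truncating the weight induces a truncation of \<open>h\<close>: cut at a bound
  \<open>B\<close> of the convolution with the truncated weight, \<open>h\<close> loses at most what
  the convolution with the remaining weight dominates. The cut function is bounded, hence a uniform
  limit of simple functions.\<close>

proposition dominated_by_conv: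
  assumes nz: "\<nu> UNIV \<noteq> 0"
    and u: "u \<in> borel_measurable borel" "weak_norm \<nu> u < \<infinity>"
    and w: "w \<in> borel_measurable borel" "(\<integral>\<^sup>+s. w s \<partial>m) < \<infinity>"
    and h: "h \<in> borel_measurable borel" "\<And>t. 0 \<le> h t" and C: "0 \<le> C"
    and dom: "\<And>t. ennreal (h t) \<le> ennreal C * conv u w t"
  shows "(\<lambda>t. complex_of_real (h t)) \<in> L1v \<nu>"
    and "weak_norm \<nu> (\<lambda>t. ennreal (h t)) \<le> ennreal C * (weak_norm \<nu> u * (\<integral>\<^sup>+s. w s \<partial>m))"
proof -
  have bound: "weak_norm \<nu> (\<lambda>t. ennreal C * conv u w' t)
    \<le> ennreal C * (weak_norm \<nu> u * (\<integral>\<^sup>+s. w' s \<partial>m))"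
    if "w' \<in> borel_measurable borel" "(\<integral>\<^sup>+s. w' s \<partial>m) < \<infinity>" for w'
    unfolding weak_norm_cmult[OF borel_measurable_conv[OF u(1) that]]
    by (rule mult_left_mono[OF weak_norm_conv_le[OF u(1) that]]) simp
  show le: "weak_norm \<nu> (\<lambda>t. ennreal (h t)) \<le> ennreal C * (weak_norm \<nu> u * (\<integral>\<^sup>+s. w s \<partial>m))"
    by (rule order_trans[OF weak_norm_mono bound[OF w]]) (rule dom)
  \<comment> \<open>Here \<open>\<nu> UNIV \<noteq> 0\<close> enters: it makes \<open>u\<close>
    integrable for Haar measure.\<close>
  obtain U where U: "0 \<le> U" "(\<integral>\<^sup>+s. u s \<partial>m) = ennreal U"
  proof -
    have "ennreal (norm (\<nu> UNIV)) * (\<integral>\<^sup>+s. u s \<partial>m) < \<infinity>" using norm_times_haar_le[OF u(1)] u(2) by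
      simp
    then have "(\<integral>\<^sup>+s. u s \<partial>m) < \<infinity>" using nz by (auto simp: ennreal_mult_less_top)
    then show ?thesis using that by (cases "\<integral>\<^sup>+s. u s \<partial>m") auto
  qed
  obtain N where N: "0 \<le> N" "weak_norm \<nu> u = ennreal N" using u(2) by (cases "weak_norm \<nu> u") auto
  obtain K where K: "0 \<le> K" "weak_norm \<nu> (\<lambda>_. 1) = ennreal K" by (rule weak_norm_const_finite)
  show "(\<lambda>t. complex_of_real (h t)) \<in> L1v \<nu>"
  proof (rule L1v_approx[OF sigma_additive])
    show "(\<lambda>t. complex_of_real (h t)) \<in> borel_measurable borel" using h by measurable
    show "weak_norm \<nu> (\<lambda>s. ennreal (cmod (complex_of_real (h s)))) < \<infinity>"
      using le_less_trans[OF le] u(2) w(2) h(2) by (simp add: ennreal_mult_less_top)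
    fix e :: real assume e: "0 < e"
    \<comment> \<open>Chosen so that the truncation error C N \<eta> is at most e / 2; the summand 2
      in the denominator excludes division by 0.\<close>
    define \<eta> where "\<eta> = e / (2 * (C * N) + 2)"
    have CN: "0 \<le> C * N" using C N(1) by simp
    then have "0 < \<eta>" using e by (simp add: \<eta>_def)
    moreover have "\<eta> * (2 * (C * N) + 2) = e" using CN by (simp add: \<eta>_def)
    ultimately have \<eta>: "0 < \<eta>" "C * N * \<eta> \<le> e / 2" by (simp_all add: algebra_simps)
    obtain n :: nat where n: "(\<integral>\<^sup>+s. w s - min (w s) (of_nat n) \<partial>m) \<le> ennreal \<eta>"
      using truncation_small[OF w, of "ennreal \<eta>"] \<eta>(1) by auto
    define w1 where "w1 s = min (w s) (of_nat n)" for s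
    define w2 where "w2 s = w s - min (w s) (of_nat n)" for s
    have w12: "w1 \<in> borel_measurable borel" "w2 \<in> borel_measurable borel"
      using w(1) by (auto simp: w1_def[abs_def] w2_def[abs_def])
    have w_eq: "w = (\<lambda>s. w1 s + w2 s)"
    proof
      fix s show "w s = w1 s + w2 s"
        unfolding w1_def w2_def by (metis add.commute diff_add_cancel_ennreal min.cobounded1)
    qed
    \<comment> \<open>A bound for \<open>C\<close> times the convolution with \<open>w1\<close>:
      that weight is at most \<open>n\<close>, and by invariance u(t - s) has Haar integral
      \<open>U\<close> in \<open>s\<close>.\<close>
    define B where "B = C * (U * n)"
    have conv1: "ennreal C * conv u w1 t \<le> ennreal B" for t
    proof -
      have "conv u w1 t \<le> (\<integral>\<^sup>+s. u (t - s) * of_nat n \<partial>m)"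
        unfolding conv_def w1_def by (intro nn_integral_mono mult_left_mono) auto
      also have "\<dots> = ennreal U * ennreal n"
        using u(1) measurable_compose[OF borel_measurable_translate(2)[of t] u(1)]
        by (simp add: nn_integral_multc haar_diff U(2) ennreal_of_nat_eq_real_of_nat)
      finally have "ennreal C * conv u w1 t \<le> ennreal C * (ennreal U * ennreal n)" by (rule
        mult_left_mono) simp
      then show ?thesis using C U(1) by (simp add: B_def ennreal_mult)
    qed
    define h' where "h' t = min (h t) B" for t
    have B0: "0 \<le> B" using C U(1) by (simp add: B_def)
    have hh': "ennreal (h t - h' t) \<le> ennreal C * conv u w2 t" for t
    proof (cases "h t \<le> B")
      case False
      have "ennreal (h t) \<le> ennreal C * conv u w1 t + ennreal C * conv u w2 t"
        using dom[of t] conv_add[OF u(1) w12, of t] w_eq by (simp add: distrib_left)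
      also have "\<dots> \<le> ennreal B + ennreal C * conv u w2 t" by (intro add_right_mono conv1)
      finally have "ennreal (h t) - ennreal B \<le> ennreal C * conv u w2 t" by (simp add:
        ennreal_minus_le_iff)
      then show ?thesis using False B0 by (simp add: h'_def ennreal_minus)
    qed (simp add: h'_def)
    \<comment> \<open>Uniform rounding by \<open>\<delta>\<close> costs at most \<delta> K \<le> e /
      2, where \<open>K\<close> is the weak norm of the constant 1.\<close>
    define \<delta> where "\<delta> = e / (2 * K + 2)"
    have "0 < \<delta>" using e K(1) by (simp add: \<delta>_def)
    moreover have "\<delta> * (2 * K + 2) = e" using K(1) by (simp add: \<delta>_def)
    ultimately have \<delta>: "0 < \<delta>" "\<delta> * K \<le> e / 2" by (simp_all add: algebra_simps)
    have h': "h' \<in> borel_measurable borel" "\<And>t. 0 \<le> h' t" "\<And>t. h' t \<le> B"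
      using h B0 by (auto simp: h'_def[abs_def])
    obtain \<phi> :: "'g \<Rightarrow> real" where \<phi>: "simple_function borel \<phi>" "\<And>t. \<bar>\<phi> t - h' t\<bar> \<le> \<delta>"
      using simple_function_approx[OF h' \<delta>(1)] by blast
    show "\<exists>\<phi>. simple_function borel \<phi> \<and> weak_norm \<nu> (\<lambda>s. ennreal (cmod (\<phi> s - complex_of_real (h
      s)))) \<le> ennreal e"
    proof (intro exI[of _ "\<lambda>t. complex_of_real (\<phi> t)"] conjI)
      show "simple_function borel (\<lambda>t. complex_of_real (\<phi> t))" by (rule
        simple_function_compose1[OF \<phi>(1)])
      have "ennreal (cmod (complex_of_real (\<phi> t) - complex_of_real (h t)))
        \<le> ennreal \<delta> * 1 + ennreal C * conv u w2 t" for t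
      proof -
        have "cmod (complex_of_real (\<phi> t) - complex_of_real (h t)) = \<bar>\<phi> t - h t\<bar>"
          by (simp only: of_real_diff[symmetric] norm_of_real)
        also have "\<dots> \<le> \<delta> + (h t - h' t)" using \<phi>(2)[of t] by (simp add: h'_def)
        finally have "ennreal (cmod (complex_of_real (\<phi> t) - complex_of_real (h t)))
          \<le> ennreal \<delta> + ennreal (h t - h' t)"
          using \<delta>(1) by (simp add: h'_def flip: ennreal_plus)
        also have "\<dots> \<le> ennreal \<delta> * 1 + ennreal C * conv u w2 t" using hh'[of t] by (intro
          add_mono) auto
        finally show ?thesis .
      qed
      then have "weak_norm \<nu> (\<lambda>t. ennreal (cmod (complex_of_real (\<phi> t) - complex_of_real (h t))))
          \<le> weak_norm \<nu> (\<lambda>t. ennreal \<delta> * 1 + ennreal C * conv u w2 t)" by (rule weak_norm_mono)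
      also have fin2: "(\<integral>\<^sup>+s. w2 s \<partial>m) < \<infinity>" using n by (simp add: w2_def[abs_def] le_less_trans)
      have "weak_norm \<nu> (\<lambda>t. ennreal \<delta> * 1 + ennreal C * conv u w2 t)
          \<le> weak_norm \<nu> (\<lambda>t. ennreal \<delta> * 1) + weak_norm \<nu> (\<lambda>t. ennreal C * conv u w2 t)"
        using borel_measurable_conv[OF u(1) w12(2) fin2] by (intro weak_norm_add) measurable
      also have "\<dots> \<le> ennreal \<delta> * ennreal K + ennreal C * (ennreal N * ennreal \<eta>)"
      proof (rule add_mono)
        show "weak_norm \<nu> (\<lambda>t. ennreal \<delta> * 1) \<le> ennreal \<delta> * ennreal K"
          by (subst weak_norm_cmult) (simp_all add: K(2))
        have "weak_norm \<nu> (\<lambda>t. ennreal C * conv u w2 t)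
          \<le> ennreal C * (weak_norm \<nu> u * (\<integral>\<^sup>+s. w2 s \<partial>m))"
          by (rule bound[OF w12(2) fin2])
        also have "\<dots> \<le> ennreal C * (ennreal N * ennreal \<eta>)"
          unfolding N(2) using n by (intro mult_left_mono) (simp_all add: w2_def[abs_def])
        finally show "weak_norm \<nu> (\<lambda>t. ennreal C * conv u w2 t)
          \<le> ennreal C * (ennreal N * ennreal \<eta>)" .
      qed
      also have "\<dots> = ennreal (\<delta> * K + C * N * \<eta>)"
        using \<delta>(1) K(1) C N(1) \<eta>(1) by (simp add: ennreal_mult[symmetric] mult.assoc flip:
          ennreal_plus)
      also have "\<dots> \<le> ennreal e" using \<delta>(2) \<eta>(2) by (intro ennreal_leI) simp
      finally show "weak_norm \<nu> (\<lambda>s. ennreal (cmod (complex_of_real (\<phi> s) - complex_of_real (h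
        s)))) \<le> ennreal e" .
    qed
  qed
qed

text \<open>Jensen's inequality with weight |f(t - s)| in the first claim and |g(s)| in the second.
  Haar measure is invariant under replacing \<open>s\<close> by \<open>t - s\<close>, so the mass
  \<open>A\<close> of the first weight does not depend on \<open>t\<close>.\<close>

lemma convolution_powr_le:
  fixes f g :: "'g \<Rightarrow> complex"
  assumes f: "f \<in> borel_measurable borel" and g: "g \<in> borel_measurable borel" and p: "1 \<le> p"
  shows "0 \<le> A \<Longrightarrow> (\<integral>\<^sup>+s. ennreal (cmod (f s)) \<partial>m) = ennreal A \<Longrightarrow>
      ennreal (cmod (convolution m f g t) powr p)
        \<le> ennreal (A powr (p - 1)) * conv (enorm f) (\<lambda>s. ennreal (cmod (g s) powr p)) t"
    and "0 \<le> B \<Longrightarrow> (\<integral>\<^sup>+s. ennreal (cmod (g s)) \<partial>m) = ennreal B \<Longrightarrow>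
      ennreal (cmod (convolution m f g t) powr p)
        \<le> ennreal (B powr (p - 1)) * conv (\<lambda>s. ennreal (cmod (f s) powr p)) (enorm g) t"
proof -
  have ft: "(\<lambda>s. f (t - s)) \<in> borel_measurable m"
    using measurable_compose[OF borel_measurable_translate(2)[of t] f] by simp
  have fg: "(\<lambda>s. f (t - s) * g s) \<in> borel_measurable m" using ft g by simp
  show "ennreal (cmod (convolution m f g t) powr p)
      \<le> ennreal (A powr (p - 1)) * conv (enorm f) (\<lambda>s. ennreal (cmod (g s) powr p)) t"
    if "0 \<le> A" "(\<integral>\<^sup>+s. ennreal (cmod (f s)) \<partial>m) = ennreal A"
    unfolding convolution_def conv_def
  proof (rule integral_powr_le)
    show "(\<integral>\<^sup>+s. ennreal (cmod (f (t - s))) \<partial>m) = ennreal A"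
      using that haar_diff[OF borel_measurable_ennreal_norm[OF f], of t] by simp
  qed (use ft g fg that p in \<open>auto simp: norm_mult\<close>)
  have "ennreal (cmod (convolution m f g t) powr p)
      \<le> ennreal (B powr (p - 1)) * (\<integral>\<^sup>+s. ennreal (cmod (g s)) * ennreal (cmod (f (t - s)) powr p)
        \<partial>m)"
    if "0 \<le> B" "(\<integral>\<^sup>+s. ennreal (cmod (g s)) \<partial>m) = ennreal B"
    unfolding convolution_def
    by (rule integral_powr_le) (use ft g fg that p in \<open>auto simp: norm_mult\<close>)
  then show "ennreal (cmod (convolution m f g t) powr p)
      \<le> ennreal (B powr (p - 1)) * conv (\<lambda>s. ennreal (cmod (f s) powr p)) (enorm g) t"
    if "0 \<le> B" "(\<integral>\<^sup>+s. ennreal (cmod (g s)) \<partial>m) = ennreal B"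
    using that by (simp add: conv_def mult.commute)
qed

text \<open>Common conclusion for (i) and (ii), which differ in the dominating pair
  \<open>u\<close>, \<open>w\<close> and in the constant \<open>C\<close>.\<close>

lemma convolution_Lpv:
  fixes f g :: "'g \<Rightarrow> complex"
  assumes nz: "\<nu> UNIV \<noteq> 0" and f: "f \<in> borel_measurable borel"
    and g: "g \<in> borel_measurable borel" "(\<integral>\<^sup>+s. ennreal (cmod (g s)) \<partial>m) < \<infinity>"
    and u: "u \<in> borel_measurable borel" "weak_norm \<nu> u = ennreal N" "0 \<le> N"
    and w: "w \<in> borel_measurable borel" "(\<integral>\<^sup>+s. w s \<partial>m) = ennreal W" "0 \<le> W"
    and C: "0 \<le> C" and dom: "\<And>t. ennreal (cmod (convolution m f g t) powr p)
      \<le> ennreal C * conv u w t"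
  shows "convolution m f g \<in> Lpv \<nu> p"
    and "L1v_norm \<nu> (\<lambda>t. complex_of_real (cmod (convolution m f g t) powr p)) \<le> C * N * W"
proof -
  have c: "convolution m f g \<in> borel_measurable borel" by (rule borel_measurable_convolution[OF f
    g])
  then have "(\<lambda>t. cmod (convolution m f g t) powr p) \<in> borel_measurable borel" by measurable
  note d = dominated_by_conv[OF nz u(1) _ w(1) _ this powr_ge_zero C dom]
  show "convolution m f g \<in> Lpv \<nu> p" using c d(1) u w by (simp add: Lpv_def)
  have "weak_norm \<nu> (\<lambda>t. ennreal (cmod (convolution m f g t) powr p)) \<le> ennreal (C * N * W)"
    using d(2) C u w by (simp add: ennreal_mult mult.assoc)
  then have "enn2real (weak_norm \<nu> (\<lambda>t. ennreal (cmod (convolution m f g t) powr p))) \<le> C * N * W"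
    using C u w by (intro enn2real_leI) auto
  then show "L1v_norm \<nu> (\<lambda>t. complex_of_real (cmod (convolution m f g t) powr p)) \<le> C * N * W"
    by (simp add: L1v_norm_eq)
qed

section \<open>The two norm estimates\<close>

lemma L1v_norm_ennreal:
  assumes "f \<in> L1v \<nu>"
  shows "weak_norm \<nu> (enorm f) = ennreal (L1v_norm \<nu> f)" "0 \<le> L1v_norm \<nu> f"
  using L1vD(2)[OF sigma_additive assms] by (simp_all add: L1v_norm_eq)

text \<open>The inclusion of L1(\<nu>) in L1(G), with its constant.\<close>

lemma haar_le_L1v_norm:
  assumes nz: "\<nu> UNIV \<noteq> 0" and f: "f \<in> L1v \<nu>"
  obtains A where "0 \<le> A" "(\<integral>\<^sup>+s. ennreal (cmod (f s)) \<partial>m) = ennreal A" "A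
    \<le> L1v_norm \<nu> f / norm (\<nu> UNIV)"
proof -
  have le: "ennreal (norm (\<nu> UNIV)) * (\<integral>\<^sup>+s. ennreal (cmod (f s)) \<partial>m) \<le> ennreal (L1v_norm \<nu> f)"
    unfolding L1v_norm_ennreal(1)[OF f, symmetric]
    by (intro norm_times_haar_le borel_measurable_ennreal_norm L1vD[OF sigma_additive f])
  then have "ennreal (norm (\<nu> UNIV)) * (\<integral>\<^sup>+s. ennreal (cmod (f s)) \<partial>m) < \<infinity>" by (simp add:
    le_less_trans)
  then have "(\<integral>\<^sup>+s. ennreal (cmod (f s)) \<partial>m) < \<infinity>" using nz by (auto simp: ennreal_mult_less_top)
  then obtain A where A: "0 \<le> A" "(\<integral>\<^sup>+s. ennreal (cmod (f s)) \<partial>m) = ennreal A"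
    by (cases "\<integral>\<^sup>+s. ennreal (cmod (f s)) \<partial>m") auto
  have "norm (\<nu> UNIV) * A \<le> L1v_norm \<nu> f"
    using le A L1v_norm_ennreal(2)[OF f] by (simp flip: ennreal_mult)
  then have "A \<le> L1v_norm \<nu> f / norm (\<nu> UNIV)" using nz by (simp add: field_simps)
  then show ?thesis using that A by blast
qed

text \<open>Integrability follows from |g| <= 1 + |g|^p, as Haar measure has total mass 1.\<close>

lemma Lp_imp_L1:
  assumes g: "g \<in> Lp m p" and p: "1 \<le> p"
  shows "g \<in> borel_measurable borel" "(\<integral>\<^sup>+s. ennreal (cmod (g s)) \<partial>m) < \<infinity>"
    "(\<integral>\<^sup>+s. ennreal (cmod (g s) powr p) \<partial>m) = ennreal (\<integral>s. cmod (g s) powr p \<partial>m)"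
proof -
  show gm: "g \<in> borel_measurable borel" using g by (simp add: Lp_def)
  have int: "integrable m (\<lambda>s. cmod (g s) powr p)" using g by (simp add: Lp_def)
  show eq: "(\<integral>\<^sup>+s. ennreal (cmod (g s) powr p) \<partial>m) = ennreal (\<integral>s. cmod (g s) powr p \<partial>m)"
    by (rule nn_integral_eq_integral[OF int]) simp
  have "ennreal (cmod (g s)) \<le> 1 + ennreal (cmod (g s) powr p)" for s
  proof -
    have "cmod (g s) \<le> 1 + cmod (g s) powr p"
    proof (cases "cmod (g s) \<le> 1")
      case False
      then have "cmod (g s) powr 1 \<le> cmod (g s) powr p" using p by (intro powr_mono) auto
      then show ?thesis using False by simp
    qed (simp add: add_increasing2)
    then have "ennreal (cmod (g s)) \<le> ennreal (1 + cmod (g s) powr p)" by (rule ennreal_leI)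
    then show ?thesis by (simp add: ennreal_plus)
  qed
  then have "(\<integral>\<^sup>+s. ennreal (cmod (g s)) \<partial>m) \<le> (\<integral>\<^sup>+s. 1 + ennreal (cmod (g s) powr p) \<partial>m)"
    by (rule nn_integral_mono)
  also have "\<dots> = 1 + (\<integral>\<^sup>+s. ennreal (cmod (g s) powr p) \<partial>m)"
    using gm by (subst nn_integral_add) auto
  also have "\<dots> < \<infinity>" by (simp add: eq)
  finally show "(\<integral>\<^sup>+s. ennreal (cmod (g s)) \<partial>m) < \<infinity>" .
qed

lemma convolution_L1v_Lp:
  assumes nz: "\<nu> UNIV \<noteq> 0" and p: "1 \<le> p" and f: "f \<in> L1v \<nu>" and g: "g \<in> Lp m p"
  shows "convolution m f g \<in> Lpv \<nu> p \<and> Lpv_norm \<nu> p (convolution m f g)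
    \<le> L1v_norm \<nu> f * Lp_norm m p g * norm (\<nu> UNIV) powr (- (1 / conjugate_exponent p))"
proof
  note fm = L1vD(1)[OF sigma_additive f] and gm = Lp_imp_L1[OF g p]
  define N where "N = L1v_norm \<nu> f"
  define W where "W = (\<integral>s. cmod (g s) powr p \<partial>m)"
  have N: "0 \<le> N" and W: "0 \<le> W" using L1v_norm_ennreal(2)[OF f] by (simp_all add: N_def W_def)
  obtain A where A: "0 \<le> A" "(\<integral>\<^sup>+s. ennreal (cmod (f s)) \<partial>m) = ennreal A" "A \<le> N / norm (\<nu> UNIV)"
    using haar_le_L1v_norm[OF nz f] unfolding N_def by blast
  have gp: "(\<lambda>s. ennreal (cmod (g s) powr p)) \<in> borel_measurable borel" using gm(1) by measurable
  note c = convolution_Lpv[OF nz fm gm(1,2) borel_measurable_ennreal_norm[OF fm]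
    L1v_norm_ennreal[OF f] gp gm(3) _
    powr_ge_zero convolution_powr_le(1)[OF fm gm(1) p A(1,2)]]
  show "convolution m f g \<in> Lpv \<nu> p" by (rule c) simp
  have "L1v_norm \<nu> (\<lambda>t. complex_of_real (cmod (convolution m f g t) powr p))
    \<le> A powr (p - 1) * N * W"
    unfolding N_def W_def by (rule c) simp
  then have "Lpv_norm \<nu> p (convolution m f g) \<le> (A powr (p - 1) * N * W) powr (1 / p)"
    unfolding Lpv_norm_def using p by (intro powr_mono2) (auto simp: L1v_norm_def)
  \<comment> \<open>The Haar norm of \<open>f\<close> is traded for its norm in L1(\<nu>); this
    produces the power of \<open>norm (\<nu> UNIV)\<close>.\<close>
  also have "\<dots> \<le> ((N / norm (\<nu> UNIV)) powr (p - 1) * N * W) powr (1 / p)"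
    using A p N W by (intro powr_mono2 mult_right_mono) auto
  also have "\<dots> = (N / norm (\<nu> UNIV)) powr ((p - 1) / p) * N powr (1 / p) * W powr (1 / p)"
    using N W by (simp add: powr_mult powr_powr)
  also have "\<dots> = (N powr ((p - 1) / p) * N powr (1 / p)) * W powr (1 / p) * norm (\<nu> UNIV) powr (-
    ((p - 1) / p))"
    using N by (simp add: powr_divide powr_minus field_simps)
  also have "N powr ((p - 1) / p) * N powr (1 / p) = N"
  proof -
    have "(p - 1) / p + 1 / p = 1" using p by (simp add: field_simps)
    then show ?thesis using N by (simp flip: powr_add)
  qed
  \<comment> \<open>For \<open>p = 1\<close> both sides are 0, the right one because division by 0
    yields 0.\<close>
  also have "(p - 1) / p = 1 / conjugate_exponent p" by (simp add: conjugate_exponent_def)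
  finally show "Lpv_norm \<nu> p (convolution m f g)
    \<le> L1v_norm \<nu> f * Lp_norm m p g * norm (\<nu> UNIV) powr (- (1 / conjugate_exponent p))"
    by (simp add: N_def W_def Lp_norm_def)
qed

lemma convolution_Lpv_L1:
  assumes nz: "\<nu> UNIV \<noteq> 0" and p: "1 \<le> p" and f: "f \<in> Lpv \<nu> p" and g: "g \<in> Lp m 1"
  shows "convolution m f g \<in> Lpv \<nu> p \<and> Lpv_norm \<nu> p (convolution m f g)
    \<le> Lpv_norm \<nu> p f * Lp_norm m 1 g"
proof
  have fm: "f \<in> borel_measurable borel" and fp: "(\<lambda>s. complex_of_real (cmod (f s) powr p)) \<in> L1v \<nu>"
    using f by (simp_all add: Lpv_def)
  define N where "N = L1v_norm \<nu> (\<lambda>s. complex_of_real (cmod (f s) powr p))"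
  define W where "W = (\<integral>s. cmod (g s) \<partial>m)"
  note gm = Lp_imp_L1(1,2)[OF g order_refl]
  have gW: "(\<integral>\<^sup>+s. ennreal (cmod (g s)) \<partial>m) = ennreal W"
    using Lp_imp_L1(3)[OF g order_refl] by (simp add: W_def)
  have N: "weak_norm \<nu> (\<lambda>s. ennreal (cmod (f s) powr p)) = ennreal N" "0 \<le> N"
    using L1v_norm_ennreal[OF fp] by (simp_all add: N_def)
  have W: "0 \<le> W" by (simp add: W_def)
  have fpm: "(\<lambda>s. ennreal (cmod (f s) powr p)) \<in> borel_measurable borel" using fm by measurable
  note c = convolution_Lpv[OF nz fm gm fpm N borel_measurable_ennreal_norm[OF gm(1)] gW W
    powr_ge_zero convolution_powr_le(2)[OF fm gm(1) p W gW]]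
  show "convolution m f g \<in> Lpv \<nu> p" by (rule c)
  \<comment> \<open>W^(p-1) stems from Jensen and the further \<open>W\<close> from the convolution
    estimate; under the power 1/p their product becomes \<open>W\<close>.\<close>
  have eq: "W powr (p - 1) * N * W = N * W powr p"
    using W powr_add[of W "p - 1" 1] by simp
  have "L1v_norm \<nu> (\<lambda>t. complex_of_real (cmod (convolution m f g t) powr p)) \<le> N * W powr p"
    using c(2) unfolding eq .
  then have "Lpv_norm \<nu> p (convolution m f g) \<le> (N * W powr p) powr (1 / p)"
    unfolding Lpv_norm_def using p by (intro powr_mono2) (auto simp: L1v_norm_def)
  also have "\<dots> = N powr (1 / p) * W" using N W p by (simp add: powr_mult powr_powr)
  finally show "Lpv_norm \<nu> p (convolution m f g) \<le> Lpv_norm \<nu> p f * Lp_norm m 1 g"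
    using W by (simp add: Lpv_norm_def Lp_norm_def N_def W_def)
qed

end

theorem theorem9p4:
  fixes \<nu> :: "'g::{topological_group_add,t2_space} set \<Rightarrow> 'x::{operator_space,banach}"
    and m :: "'g measure"
    and p :: real
  assumes "compact (UNIV :: 'g set)"
    and "normalized_haar_measure m"
    and "\<nu> \<in> regular_vector_measures"
    and "semivariation_translation_invariant \<nu>"
    and "\<nu> UNIV \<noteq> 0"
    and "1 \<le> p"
  shows "(\<forall>f\<in>L1v \<nu>. \<forall>g\<in>Lp m p.
            convolution m f g \<in> Lpv \<nu> p \<and>
            Lpv_norm \<nu> p (convolution m f g)
              \<le> L1v_norm \<nu> f * Lp_norm m p g * norm (\<nu> UNIV) powr (- (1 / conjugate_exponent p))) \<and>
         (\<forall>f\<in>Lpv \<nu> p. \<forall>g\<in>Lp m 1.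
            convolution m f g \<in> Lpv \<nu> p \<and>
            Lpv_norm \<nu> p (convolution m f g) \<le> Lpv_norm \<nu> p f * Lp_norm m 1 g)"
proof -
  interpret invariant_vector_measure \<nu> m
    using assms(1-4) by unfold_locales
  show ?thesis
    using convolution_L1v_Lp[OF assms(5,6)] convolution_Lpv_L1[OF assms(5,6)] by blast
qed

end
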